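(* The Activation Edge-Cover problem admits approximation ratio $1+\omega(\theta)$ for $\theta$-bounded instances. The problem also admits ratio $1+\ln(\Delta+1)$, and ratio $1+\ln\Delta$ if $R$ is an independent set in $G$, where $\Delta$ is the maximum number of terminal neighbors of a node in $G$.
   Context: Activation Edge-Cover: given an undirected multigraph $G=(V,E)$, a set of terminals $R\subseteq V$, and thresholds $\{t^e_u,t^e_v\}$ for each $uv$-edge $e\in E$, find an assignment ${\bf a}=\{a_v:v\in V\}$ of minimum value ${\bf a}(V)=\sum_{v\in V}a_v$ such that the activated edge set $E_{\bf a}=\{e=uv\in E: a_u\ge t^e_u, a_v\ge t^e_v\}$ covers $R$ (every $v\in R$ is incident to some edge of $E_{\bf a}$). Define assignments ${\bf q},{\bf c}$ with $q_v=c_v=0$ for $v\in V\setminus R$ and, for $u\in R$, $q_u=\min_{e=uv\in E}t^e_u$ and $c_u=\min_{e=uv\in E}(t^e_u+t^e_v)-q_u$. An instance is $\theta$-bounded if $c_u\le\theta q_u$ for all $u\in R$ (by default $\theta=\max_{u\in R}c_u/q_u$, the slope). $\omega(\theta)=W(\theta/e)$ is the unique real root of $x+1=\ln(\theta/x)$, where $W$ is the Lambert W-function. *)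

theory Defs
  imports
    "HOL-Analysis.Analysis"
    "HOL-Library.Log_Nat"
    "HOL-Computational_Algebra.Polynomial"
begin

section \<open>Activation Edge-Cover\<close>

text \<open>
  Nodes are \<open>0, \<dots>, n - 1\<close>. A list of edges allows parallel edges; the order of the two
  ends of an edge carries no meaning. Thresholds are rational, so that an instance is a finite
  input, while assignments are real-valued.
\<close>

record edge =
  end1 :: nat
  end2 :: nat
  thr1 :: rat
  thr2 :: rat

record aec =
  num_nodes :: nat
  edges :: "edge list"
  terminals :: "nat set"

definition nodes :: "aec \<Rightarrow> nat set" where
  "nodes I = {..<num_nodes I}"

definition ends :: "edge \<Rightarrow> nat set" where
  "ends e = {end1 e, end2 e}"

definition thr :: "edge \<Rightarrow> nat \<Rightarrow> real" where
  "thr e u = real_of_rat (if u = end1 e then thr1 e else thr2 e)"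

definition aec_instance :: "aec \<Rightarrow> bool" where
  "aec_instance I \<longleftrightarrow>
     terminals I \<subseteq> nodes I \<and>
     (\<forall>e\<in>set (edges I). ends e \<subseteq> nodes I \<and> end1 e \<noteq> end2 e \<and> 0 \<le> thr1 e \<and> 0 \<le> thr2 e)"

definition activated :: "aec \<Rightarrow> (nat \<Rightarrow> real) \<Rightarrow> edge set" where
  "activated I a = {e \<in> set (edges I). \<forall>u\<in>ends e. thr e u \<le> a u}"

definition feasible :: "aec \<Rightarrow> (nat \<Rightarrow> real) \<Rightarrow> bool" where
  "feasible I a \<longleftrightarrow>
     (\<forall>v\<in>nodes I. 0 \<le> a v) \<and> (\<forall>u\<in>terminals I. \<exists>e\<in>activated I a. u \<in> ends e)"

definition assignment_value :: "aec \<Rightarrow> (nat \<Rightarrow> real) \<Rightarrow> real" where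
  "assignment_value I a = (\<Sum>v\<in>nodes I. a v)"

definition solvable :: "aec \<Rightarrow> bool" where
  "solvable I \<longleftrightarrow> (\<exists>a. feasible I a)"

definition opt :: "aec \<Rightarrow> real" where
  "opt I = Inf {assignment_value I a |a. feasible I a}"

definition incident :: "aec \<Rightarrow> nat \<Rightarrow> edge set" where
  "incident I u = {e \<in> set (edges I). u \<in> ends e}"

definition q_assignment :: "aec \<Rightarrow> nat \<Rightarrow> real" where
  "q_assignment I u = (if u \<in> terminals I then Min ((\<lambda>e. thr e u) ` incident I u) else 0)"

definition c_assignment :: "aec \<Rightarrow> nat \<Rightarrow> real" where
  "c_assignment I u = (if u \<in> terminals I
     then Min ((\<lambda>e. thr e (end1 e) + thr e (end2 e)) ` incident I u) - q_assignment I u else 0)"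

definition bounded_instance :: "real \<Rightarrow> aec \<Rightarrow> bool" where
  "bounded_instance \<theta> I \<longleftrightarrow> (\<forall>u\<in>terminals I. c_assignment I u \<le> \<theta> * q_assignment I u)"

definition terminal_neighbors :: "aec \<Rightarrow> nat \<Rightarrow> nat set" where
  "terminal_neighbors I v = {u \<in> terminals I. \<exists>e\<in>set (edges I). ends e = {u, v}}"

definition max_terminal_neighbors :: "aec \<Rightarrow> nat" where
  "max_terminal_neighbors I = Max ((\<lambda>v. card (terminal_neighbors I v)) ` nodes I)"

definition independent_terminals :: "aec \<Rightarrow> bool" where
  "independent_terminals I \<longleftrightarrow> (\<forall>e\<in>set (edges I). \<not> ends e \<subseteq> terminals I)"


section \<open>The function \<open>\<omega>\<close>\<close>

text \<open>Principal branch of the Lambert function.\<close>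

definition lambert_W :: "real \<Rightarrow> real" where
  "lambert_W y = (THE w. -1 \<le> w \<and> w * exp w = y)"

definition omega :: "real \<Rightarrow> real" where
  "omega \<theta> = lambert_W (\<theta> / exp 1)"

lemma lambert_W_pos_ex1:
  assumes "0 < (y::real)"
  shows "\<exists>!w. -1 \<le> w \<and> w * exp w = y"
proof -
  have "\<exists>w\<ge>0. w \<le> y \<and> w * exp w = y"
    using assms by (intro IVT') (auto intro!: continuous_intros)
  then obtain w where w: "0 \<le> w" "w * exp w = y" by blast
  show ?thesis
  proof (rule ex1I[of _ w])
    show "-1 \<le> w \<and> w * exp w = y" using w by simp
  next
    fix v assume v: "-1 \<le> v \<and> v * exp v = y"
    have "0 < v" using v assms by (metis exp_gt_zero zero_less_mult_pos2)
    moreover have "0 < w" using w assms by (cases "w = 0") auto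
    ultimately show "v = w"
      using v w mult_strict_mono[of v w "exp v" "exp w"] mult_strict_mono[of w v "exp w" "exp v"]
      by (cases v w rule: linorder_cases) auto
  qed
qed

lemma omega_iff_root:
  assumes "0 < \<theta>"
  shows "omega \<theta> = x \<longleftrightarrow> 0 < x \<and> x + 1 = ln (\<theta> / x)"
proof -
  have ex1: "\<exists>!w. -1 \<le> w \<and> w * exp w = \<theta> / exp 1"
    using lambert_W_pos_ex1 assms by simp
  have "omega \<theta> = x \<longleftrightarrow> -1 \<le> x \<and> x * exp x = \<theta> / exp 1"
    unfolding omega_def lambert_W_def using theI'[OF ex1] the1_equality[OF ex1] by blast
  also have "\<dots> \<longleftrightarrow> 0 < x \<and> x * exp x = \<theta> / exp 1"
    using assms by (smt (verit) divide_pos_pos exp_gt_zero mult_nonneg_nonneg mult_nonpos_nonneg)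
  also have "\<dots> \<longleftrightarrow> 0 < x \<and> exp (x + 1) = \<theta> / x"
    by (auto simp: exp_add field_simps)
  also have "\<dots> \<longleftrightarrow> 0 < x \<and> x + 1 = ln (\<theta> / x)"
    using assms by (metis divide_pos_pos exp_ln ln_exp)
  finally show ?thesis .
qed


section \<open>Polynomial-time algorithms\<close>

text \<open>
  Algorithms are programs of a random access machine with structured control and logarithmic
  cost: each number that is read, written, used as an address or produced by an operation is
  charged its bit length. The memory consists of arrays of integers (a program mentions only
  finitely many of them); a scalar variable is an array used at one index only. The programs
  running in polynomial time are, up to encoding, exactly the polynomial-time Turing machines.
\<close>

type_synonym state = "nat \<Rightarrow> int \<Rightarrow> int"

datatype aexp = Const int | Get nat aexp | Add aexp aexp | Sub aexp aexp | Mul aexp aexp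

datatype bexp = Less aexp aexp | Neg bexp | Conj bexp bexp

datatype com = Skip | Put nat aexp aexp | Seq com com | Cond bexp com com | While bexp com

definition blen :: "int \<Rightarrow> nat" where
  "blen x = Suc (floorlog 2 (nat \<bar>x\<bar>))"

fun aval :: "aexp \<Rightarrow> state \<Rightarrow> int" where
  "aval (Const k) s = k"
| "aval (Get x a) s = s x (aval a s)"
| "aval (Add a b) s = aval a s + aval b s"
| "aval (Sub a b) s = aval a s - aval b s"
| "aval (Mul a b) s = aval a s * aval b s"

fun acost :: "aexp \<Rightarrow> state \<Rightarrow> nat" where
  "acost (Const k) s = blen k"
| "acost (Get x a) s = acost a s + blen (aval (Get x a) s)"
| "acost (Add a b) s = acost a s + acost b s + blen (aval (Add a b) s)"
| "acost (Sub a b) s = acost a s + acost b s + blen (aval (Sub a b) s)"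
| "acost (Mul a b) s = acost a s + acost b s + blen (aval (Mul a b) s)"

fun bval :: "bexp \<Rightarrow> state \<Rightarrow> bool" where
  "bval (Less a b) s \<longleftrightarrow> aval a s < aval b s"
| "bval (Neg b) s \<longleftrightarrow> \<not> bval b s"
| "bval (Conj b d) s \<longleftrightarrow> bval b s \<and> bval d s"

fun bcost :: "bexp \<Rightarrow> state \<Rightarrow> nat" where
  "bcost (Less a b) s = acost a s + acost b s + 1"
| "bcost (Neg b) s = bcost b s + 1"
| "bcost (Conj b d) s = bcost b s + bcost d s + 1"

text \<open>\<open>exec P s n t\<close>: started in \<open>s\<close>, program \<open>P\<close> halts in \<open>t\<close> at total cost \<open>n\<close>.\<close>

inductive exec :: "com \<Rightarrow> state \<Rightarrow> nat \<Rightarrow> state \<Rightarrow> bool" where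
  Skip: "exec Skip s 1 s"
| Put: "exec (Put x i a) s (acost i s + acost a s + 1) (s(x := (s x)(aval i s := aval a s)))"
| Seq: "exec P s m s' \<Longrightarrow> exec Q s' n t \<Longrightarrow> exec (Seq P Q) s (m + n) t"
| CondTrue: "bval b s \<Longrightarrow> exec P s n t \<Longrightarrow> exec (Cond b P Q) s (bcost b s + n) t"
| CondFalse: "\<not> bval b s \<Longrightarrow> exec Q s n t \<Longrightarrow> exec (Cond b P Q) s (bcost b s + n) t"
| WhileFalse: "\<not> bval b s \<Longrightarrow> exec (While b P) s (bcost b s) s"
| WhileTrue: "bval b s \<Longrightarrow> exec P s m s' \<Longrightarrow> exec (While b P) s' n t \<Longrightarrow>
    exec (While b P) s (bcost b s + m + n) t"

inductive_cases exec_SkipE: "exec Skip s n t"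
inductive_cases exec_PutE: "exec (Put x i a) s n t"
inductive_cases exec_SeqE: "exec (Seq P Q) s n t"
inductive_cases exec_CondE: "exec (Cond b P Q) s n t"
inductive_cases exec_WhileE: "exec (While b P) s n t"

lemma exec_deterministic:
  "exec P s n t \<Longrightarrow> exec P s n' t' \<Longrightarrow> n' = n \<and> t' = t"
proof (induction arbitrary: n' t' rule: exec.induct)
  case Skip
  then show ?case by (auto elim: exec_SkipE)
next
  case Put
  then show ?case by (auto elim: exec_PutE)
next
  case Seq
  from Seq.prems show ?case by (rule exec_SeqE) (use Seq.IH in blast)
next
  case CondTrue
  from CondTrue.prems show ?case by (rule exec_CondE) (use CondTrue.hyps CondTrue.IH in blast)+
next
  case CondFalse
  from CondFalse.prems show ?case by (rule exec_CondE) (use CondFalse.hyps CondFalse.IH in blast)+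
next
  case WhileFalse
  from WhileFalse.prems show ?case by (rule exec_WhileE) (use WhileFalse.hyps in blast)+
next
  case WhileTrue
  from WhileTrue.prems show ?case by (rule exec_WhileE) (use WhileTrue.hyps WhileTrue.IH in blast)+
qed

text \<open>
  Input: array 0 holds the numbers of nodes and edges, array 1 the indicator of the terminals,
  arrays 2--4 and 5--7 the first and second ends of the edges with numerator and denominator of
  their thresholds. All other memory cells are 0.
\<close>

definition array_of_list :: "int list \<Rightarrow> int \<Rightarrow> int" where
  "array_of_list xs i = (if 0 \<le> i \<and> i < int (length xs) then xs ! nat i else 0)"

definition numer :: "rat \<Rightarrow> int" where
  "numer r = fst (quotient_of r)"

definition denom :: "rat \<Rightarrow> int" where
  "denom r = snd (quotient_of r)"

definition input_arrays :: "aec \<Rightarrow> int list list" where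
  "input_arrays I =
    [[int (num_nodes I), int (length (edges I))],
     map (\<lambda>v. if v \<in> terminals I then 1 else 0) [0..<num_nodes I],
     map (\<lambda>e. int (end1 e)) (edges I),
     map (\<lambda>e. numer (thr1 e)) (edges I),
     map (\<lambda>e. denom (thr1 e)) (edges I),
     map (\<lambda>e. int (end2 e)) (edges I),
     map (\<lambda>e. numer (thr2 e)) (edges I),
     map (\<lambda>e. denom (thr2 e)) (edges I)]"

definition input_state :: "aec \<Rightarrow> state" where
  "input_state I x = (if x < length (input_arrays I) then array_of_list (input_arrays I ! x) else (\<lambda>_. 0))"

definition input_size :: "aec \<Rightarrow> nat" where
  "input_size I = (\<Sum>xs\<leftarrow>input_arrays I. \<Sum>k\<leftarrow>xs. blen k)"

text \<open>Output: numerators in array 8 and denominators in array 9.\<close>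

definition output_assignment :: "state \<Rightarrow> nat \<Rightarrow> real" where
  "output_assignment t v = real_of_int (t 8 (int v)) / real_of_int (t 9 (int v))"

definition poly_time_algorithm :: "com \<Rightarrow> bool" where
  "poly_time_algorithm P \<longleftrightarrow>
    (\<exists>p :: nat poly. \<forall>I. aec_instance I \<longrightarrow> solvable I \<longrightarrow>
      (\<exists>n t. exec P (input_state I) n t \<and> n \<le> poly p (input_size I) \<and>
         (\<forall>v\<in>nodes I. 0 < t 9 (int v)) \<and> feasible I (output_assignment t)))"

definition achieves_ratio :: "com \<Rightarrow> aec \<Rightarrow> real \<Rightarrow> bool" where
  "achieves_ratio P I \<rho> \<longleftrightarrow>
    (\<exists>n t. exec P (input_state I) n t \<and> feasible I (output_assignment t) \<and>
       assignment_value I (output_assignment t) \<le> \<rho> * opt I)"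

end

theory Submission imports Defs begin

text \<open>
  Start with the assignment \<open>q\<close> and charge each terminal \<open>u\<close> that is not yet covered its price \<open>c u\<close>,
  for which a single edge covers it. Repeatedly add the star, a centre with some uncovered terminals
  as leaves, that has the smallest ratio of cost to the total price of the terminals it covers.
  For every feasible assignment \<open>z\<close>, the edges of a minimal edge cover activated by \<open>z\<close> split into
  node-disjoint stars of total cost at most \<open>\<tau> = z(V) - q(V)\<close>. So if the uncovered terminals have
  total price \<open>\<nu>\<close>, the best ratio is at most \<open>min 1 (\<tau> / \<nu>)\<close>. Integrating this slope from \<open>0\<close> to
  \<open>c(R)\<close>, the final value is at most \<open>q(R) + \<tau> + \<tau> ln (c(R) / \<tau>)\<close>, unless \<open>c(R) \<le> \<tau>\<close>, where
  \<open>q(R) + c(R)\<close> suffices. The three ratios follow from \<open>c(R) \<le> \<theta> q(R)\<close>, from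
  \<open>c(R) \<le> (\<Delta> + 1) \<tau> + \<Delta> q(R)\<close> and, for independent terminals, from \<open>c(R) \<le> \<Delta> \<tau>\<close>; all three are
  attained by the same program.
\<close>

section \<open>Loop programs and their cost\<close>

text \<open>A star has exponentially many possible leaf sets, but a round may try only polynomially
  many. Two arcs describe a candidate: one fixes the centre and its level, the other a threshold on
  the ratio of cost to price of single leaves, since against a fixed density it is best to take
  exactly the leaves whose own ratio does not exceed it. The obstacle is a centre that is itself an
  uncovered terminal: its price is gained only together with some leaf, and every leaf alone may be
  too expensive. Then one edge with exchanged roles is good enough, which is why each edge is kept
  as two opposite arcs. Costs are increments over the current assignment \<open>a\<close>, not over
  \<open>q\<close>; as \<open>a\<close> and \<open>z\<close> both dominate \<open>q\<close>, still
  \<open>max z a - a \<le> z - q\<close>, so the budget \<tau> is the same in all rounds. The slope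
  bound 1 comes from the edge that attains \<open>c u\<close>. Thresholds are scaled to integers, so
  that ratios are compared exactly by cross-multiplication. For the running time, the algorithm is
  written with counting loops, whose semantics is a total function; one structural induction then
  bounds cost and length of numbers.\<close>

datatype prog =
    Nop
  | Assign nat aexp aexp
  | Then prog prog (infixr \<open>;;\<close> 60)
  | Branch bexp prog prog
  | For nat aexp prog

abbreviation incr :: "nat \<Rightarrow> state \<Rightarrow> state" where
  "incr x s \<equiv> s(x := (s x)(0 := s x 0 + 1))"

text \<open>The guard of the \<open>While\<close> reevaluates the bound \<open>e\<close> in every
  iteration, whereas \<open>run\<close> evaluates it once. Both agree for \<open>well_formed\<close>
  programs, whose bounds read only array 0 and whose loop bodies write neither the input nor the
  counter.\<close>

fun compile :: "prog \<Rightarrow> com" where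
  "compile Nop = Skip"
| "compile (Assign x i a) = Put x i a"
| "compile (P ;; Q) = Seq (compile P) (compile Q)"
| "compile (Branch b P Q) = Cond b (compile P) (compile Q)"
| "compile (For x e P) = Seq (Put x (Const 0) (Const 0))
     (While (Less (Get x (Const 0)) e)
        (Seq (compile P) (Put x (Const 0) (Add (Get x (Const 0)) (Const 1)))))"

fun run :: "prog \<Rightarrow> state \<Rightarrow> state" where
  "run Nop s = s"
| "run (Assign x i a) s = s(x := (s x)(aval i s := aval a s))"
| "run (P ;; Q) s = run Q (run P s)"
| "run (Branch b P Q) s = (if bval b s then run P s else run Q s)"
| "run (For x e P) s =
     ((\<lambda>t. incr x (run P t)) ^^ nat (aval e s)) (s(x := (s x)(0 := 0)))"

fun writes :: "prog \<Rightarrow> nat set" where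
  "writes Nop = {}"
| "writes (Assign x i a) = {x}"
| "writes (P ;; Q) = writes P \<union> writes Q"
| "writes (Branch b P Q) = writes P \<union> writes Q"
| "writes (For x e P) = insert x (writes P)"

text \<open>
  Loop bounds are numbers of the input, and a stored product has a number of the input as a factor.
  Hence the number of steps is polynomial, and each step lengthens the numbers in the memory only
  by as many bits as the input has.
\<close>

definition input_bound :: "aexp \<Rightarrow> bool" where
  "input_bound e \<longleftrightarrow>
     e \<in> {Get 0 (Const 0), Get 0 (Const 1), Add (Get 0 (Const 1)) (Get 0 (Const 1))}"

fun linear_exp :: "aexp \<Rightarrow> bool" where
  "linear_exp (Const k) = True"
| "linear_exp (Get x a) = True"
| "linear_exp (Add a b) = (linear_exp a \<and> linear_exp b)"
| "linear_exp (Sub a b) = (linear_exp a \<and> linear_exp b)"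
| "linear_exp (Mul a b) = (linear_exp a \<and> (\<exists>x i. b = Get x i \<and> x < 8))"

fun well_formed :: "prog \<Rightarrow> bool" where
  "well_formed Nop = True"
| "well_formed (Assign x i a) = (8 \<le> x \<and> linear_exp a)"
| "well_formed (P ;; Q) = (well_formed P \<and> well_formed Q)"
| "well_formed (Branch b P Q) = (well_formed P \<and> well_formed Q)"
| "well_formed (For x e P) = (8 \<le> x \<and> input_bound e \<and> x \<notin> writes P \<and> well_formed P)"

lemma run_frame: "x \<notin> writes P \<Longrightarrow> run P s x = s x"
proof (induction P arbitrary: s)
  case (For y e P)
  have "((\<lambda>t. incr y (run P t)) ^^ k) t x = t x" for k t
    using For by (induction k) auto
  then show ?case using For by simp
qed auto

lemma well_formed_writes: "well_formed P \<Longrightarrow> x \<in> writes P \<Longrightarrow> 8 \<le> x"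
  by (induction P) auto

lemma run_input: "well_formed P \<Longrightarrow> x < 8 \<Longrightarrow> run P s x = s x"
  using run_frame well_formed_writes not_le by blast

text \<open>A constant weighs its absolute value, so that \<open>abs_le_two_power\<close> bounds it
  by two to its size; the constants of a program do not depend on the input, so the waste is
  harmless.\<close>

fun exp_size :: "aexp \<Rightarrow> nat" where
  "exp_size (Const k) = nat \<bar>k\<bar> + 1"
| "exp_size (Get x a) = exp_size a + 1"
| "exp_size (Add a b) = exp_size a + exp_size b + 1"
| "exp_size (Sub a b) = exp_size a + exp_size b + 1"
| "exp_size (Mul a b) = exp_size a + exp_size b + 1"

fun test_size :: "bexp \<Rightarrow> nat" where
  "test_size (Less a b) = exp_size a + exp_size b + 1"
| "test_size (Neg b) = test_size b + 1"
| "test_size (Conj b d) = test_size b + test_size d + 1"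

text \<open>This becomes \<open>K\<close>, a bound on the size of every single command and test. The
  10 covers what \<open>compile\<close> adds to a loop: the reset has size 3, the increment 7, and
  the guard exceeds the bound \<open>e\<close> by 3.\<close>

fun prog_size :: "prog \<Rightarrow> nat" where
  "prog_size Nop = 1"
| "prog_size (Assign x i a) = exp_size i + exp_size a + 1"
| "prog_size (P ;; Q) = prog_size P + prog_size Q"
| "prog_size (Branch b P Q) = test_size b + prog_size P + prog_size Q"
| "prog_size (For x e P) = exp_size e + prog_size P + 10"

text \<open>The argument of the polynomial is the largest loop bound.\<close>

fun steps :: "prog \<Rightarrow> nat poly" where
  "steps Nop = 1"
| "steps (Assign x i a) = 1"
| "steps (P ;; Q) = steps P + steps Q"
| "steps (Branch b P Q) = 1 + steps P + steps Q"
| "steps (For x e P) = 2 + [:0, 1:] * (steps P + 2)"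

section \<open>Bit lengths of values and costs of expressions\<close>

lemma exp_size_pos: "0 < exp_size e"
  by (cases e) auto

text \<open>Each summand is at most half of the right-hand side, as the other exponent is
  positive.\<close>

lemma power2_add_le:
  assumes "0 < p" "0 < q"
  shows "(2::int) ^ (\<beta> + p) + 2 ^ (\<beta> + q) \<le> 2 ^ (\<beta> + (p + q))"
proof -
  have "(2::int) ^ (\<beta> + p) \<le> 2 ^ (\<beta> + (p + q) - 1)" "(2::int) ^ (\<beta> + q) \<le> 2 ^ (\<beta> + (p + q) - 1)"
    using assms by (auto intro!: power_increasing)
  moreover have "(2::int) ^ (\<beta> + (p + q)) = 2 * 2 ^ (\<beta> + (p + q) - 1)"
    using assms by (cases p) auto
  ultimately show ?thesis by linarith
qed

lemma abs_le_two_power: "\<bar>k\<bar> \<le> (2::int) ^ nat \<bar>k\<bar>"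
proof -
  have "int (nat \<bar>k\<bar>) \<le> int (2 ^ nat \<bar>k\<bar>)"
    by (metis less_exp less_imp_le of_nat_le_iff)
  then show ?thesis by simp
qed

text \<open>Bits multiplied by the size are affordable for the cost of an evaluation, because the
  values of indices and tests are not stored. Values that are written get the sharper bound
  \<open>abs_aval_linear_le\<close>.\<close>

lemma abs_aval_le:
  assumes "\<And>x i. \<bar>s x i\<bar> \<le> 2 ^ \<beta>"
  shows "\<bar>aval e s\<bar> \<le> 2 ^ (exp_size e * (\<beta> + 1))"
proof (induction e)
  case (Const k)
  have "\<bar>k\<bar> \<le> 2 ^ nat \<bar>k\<bar>" by (rule abs_le_two_power)
  also have "\<dots> \<le> 2 ^ (exp_size (Const k) * (\<beta> + 1))" by (rule power_increasing) auto
  finally show ?case by simp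
next
  case (Get x a)
  have "\<bar>s x (aval a s)\<bar> \<le> 2 ^ \<beta>" by (rule assms)
  also have "\<dots> \<le> 2 ^ (exp_size (Get x a) * (\<beta> + 1))" by (rule power_increasing) auto
  finally show ?case by simp
next
  case (Add a b)
  have "\<bar>aval (Add a b) s\<bar> \<le> 2 ^ (0 + exp_size a * (\<beta> + 1)) + 2 ^ (0 + exp_size b * (\<beta> + 1))"
    using Add by simp
  also have "\<dots> \<le> 2 ^ (0 + (exp_size a * (\<beta> + 1) + exp_size b * (\<beta> + 1)))"
    by (rule power2_add_le) (auto simp: exp_size_pos)
  also have "\<dots> \<le> 2 ^ (exp_size (Add a b) * (\<beta> + 1))"
    by (rule power_increasing) (auto simp: algebra_simps)
  finally show ?case .
next
  case (Sub a b)
  have "\<bar>aval (Sub a b) s\<bar> \<le> 2 ^ (0 + exp_size a * (\<beta> + 1)) + 2 ^ (0 + exp_size b * (\<beta> + 1))"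
    using Sub by simp
  also have "\<dots> \<le> 2 ^ (0 + (exp_size a * (\<beta> + 1) + exp_size b * (\<beta> + 1)))"
    by (rule power2_add_le) (auto simp: exp_size_pos)
  also have "\<dots> \<le> 2 ^ (exp_size (Sub a b) * (\<beta> + 1))"
    by (rule power_increasing) (auto simp: algebra_simps)
  finally show ?case .
next
  case (Mul a b)
  have "\<bar>aval (Mul a b) s\<bar> \<le> 2 ^ (exp_size a * (\<beta> + 1)) * 2 ^ (exp_size b * (\<beta> + 1))"
    unfolding aval.simps abs_mult by (rule mult_mono) (use Mul in auto)
  also have "\<dots> \<le> 2 ^ (exp_size (Mul a b) * (\<beta> + 1))"
    unfolding power_add[symmetric] by (rule power_increasing) (auto simp: algebra_simps)
  finally show ?case .
qed

text \<open>The bits of the memory enter only additively: the right factor of a product is an input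
  cell of at most \<open>\<mu>\<close> bits. Under a multiplicative bound, iterated assignments
  would lengthen the numbers exponentially.\<close>

lemma abs_aval_linear_le:
  assumes "linear_exp e" and "\<And>x i. \<bar>s x i\<bar> \<le> 2 ^ \<beta>"
    and "\<And>x i. x < 8 \<Longrightarrow> \<bar>s x i\<bar> \<le> 2 ^ \<mu>"
  shows "\<bar>aval e s\<bar> \<le> 2 ^ (\<beta> + exp_size e * (\<mu> + 1))"
  using assms(1)
proof (induction e)
  case (Const k)
  have "\<bar>k\<bar> \<le> 2 ^ nat \<bar>k\<bar>" by (rule abs_le_two_power)
  also have "\<dots> \<le> 2 ^ (\<beta> + exp_size (Const k) * (\<mu> + 1))" by (rule power_increasing) auto
  finally show ?case by simp
next
  case (Get x a)
  have "\<bar>s x (aval a s)\<bar> \<le> 2 ^ \<beta>" by (rule assms)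
  also have "\<dots> \<le> 2 ^ (\<beta> + exp_size (Get x a) * (\<mu> + 1))" by (rule power_increasing) auto
  finally show ?case by simp
next
  case (Add a b)
  have "\<bar>aval (Add a b) s\<bar> \<le> 2 ^ (\<beta> + exp_size a * (\<mu> + 1)) + 2 ^ (\<beta> + exp_size b * (\<mu> + 1))"
    using Add by auto
  also have "\<dots> \<le> 2 ^ (\<beta> + (exp_size a * (\<mu> + 1) + exp_size b * (\<mu> + 1)))"
    by (rule power2_add_le) (auto simp: exp_size_pos)
  also have "\<dots> \<le> 2 ^ (\<beta> + exp_size (Add a b) * (\<mu> + 1))"
    by (rule power_increasing) (auto simp: algebra_simps)
  finally show ?case .
next
  case (Sub a b)
  have "\<bar>aval (Sub a b) s\<bar> \<le> 2 ^ (\<beta> + exp_size a * (\<mu> + 1)) + 2 ^ (\<beta> + exp_size b * (\<mu> + 1))"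
    using Sub by auto
  also have "\<dots> \<le> 2 ^ (\<beta> + (exp_size a * (\<mu> + 1) + exp_size b * (\<mu> + 1)))"
    by (rule power2_add_le) (auto simp: exp_size_pos)
  also have "\<dots> \<le> 2 ^ (\<beta> + exp_size (Sub a b) * (\<mu> + 1))"
    by (rule power_increasing) (auto simp: algebra_simps)
  finally show ?case .
next
  case (Mul a b)
  then obtain x i where b: "b = Get x i" "x < 8" by auto
  have "\<bar>aval (Mul a b) s\<bar> \<le> 2 ^ (\<beta> + exp_size a * (\<mu> + 1)) * 2 ^ \<mu>"
    unfolding aval.simps abs_mult by (rule mult_mono) (use Mul b assms(3) in auto)
  also have "\<dots> \<le> 2 ^ (\<beta> + exp_size (Mul a b) * (\<mu> + 1))"
    unfolding power_add[symmetric] by (rule power_increasing) (auto simp: algebra_simps)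
  finally show ?case .
qed

lemma blen_le: "\<bar>x\<bar> \<le> 2 ^ p \<Longrightarrow> blen x \<le> p + 2"
proof -
  assume a: "\<bar>x\<bar> \<le> 2 ^ p"
  then have "nat \<bar>x\<bar> \<le> 2 ^ p"
    by (simp add: nat_le_iff)
  then have "nat \<bar>x\<bar> < 2 ^ (p + 1)"
    by (rule le_less_trans) simp
  then have "floorlog 2 (nat \<bar>x\<bar>) \<le> p + 1"
    by (simp add: floorlog_le_iff)
  then show ?thesis by (simp add: blen_def)
qed

text \<open>One width \<open>w\<close> fits all subexpressions, since their sizes are
  smaller.\<close>

lemma acost_le:
  assumes "\<And>x i. \<bar>s x i\<bar> \<le> 2 ^ \<beta>" and "exp_size e * (\<beta> + 1) + 2 \<le> w"
  shows "acost e s \<le> exp_size e * w"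
proof -
  have *: "blen (aval e s) \<le> w" if "exp_size e * (\<beta> + 1) + 2 \<le> w" for e
    using blen_le[OF abs_aval_le[of s, OF assms(1)], of e] that by linarith
  show ?thesis using assms(2)
  proof (induction e)
    case (Const k)
    then show ?case using *[of "Const k"] by (auto simp: algebra_simps)
  next
    case (Get x a)
    then show ?case using *[of "Get x a"] by (auto simp: algebra_simps)
  next
    case (Add a b)
    then show ?case using *[of "Add a b"] by (auto simp: algebra_simps)
  next
    case (Sub a b)
    then show ?case using *[of "Sub a b"] by (auto simp: algebra_simps)
  next
    case (Mul a b)
    then show ?case using *[of "Mul a b"] by (auto simp: algebra_simps)
  qed
qed

lemma bcost_le:
  assumes "\<And>x i. \<bar>s x i\<bar> \<le> 2 ^ \<beta>" and "test_size b * (\<beta> + 1) + 2 \<le> w"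
  shows "bcost b s \<le> test_size b * w"
  using assms(2)
proof (induction b)
  case (Less a b)
  have "acost a s \<le> exp_size a * w" "acost b s \<le> exp_size b * w"
    by (rule acost_le[OF assms(1)], use Less in \<open>simp add: algebra_simps\<close>)+
  then show ?case using Less by (simp add: algebra_simps)
qed (auto simp: algebra_simps)

text \<open>
  \<open>T\<close> counts elementary steps, \<open>\<beta>\<close> the bits of the largest number at the start, \<open>g\<close> the bits by
  which a single step can lengthen it.
\<close>

definition bounded_run :: "nat \<Rightarrow> nat \<Rightarrow> nat \<Rightarrow> nat \<Rightarrow> com \<Rightarrow> state \<Rightarrow> state \<Rightarrow> bool" where
  "bounded_run K g \<beta> T P s t \<longleftrightarrow> (\<exists>n. exec P s n t \<and> n \<le> T * (K * (K * (\<beta> + T * g + 1) + 2))) \<and>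
     (\<forall>x i. \<bar>t x i\<bar> \<le> 2 ^ (\<beta> + T * g))"

section \<open>Composing cost bounds\<close>

lemma step_cost_mono:
  fixes K :: nat
  assumes "T \<le> T'" "\<beta> \<le> \<beta>'"
  shows "T * (K * (K * (\<beta> + 1) + 2)) \<le> T' * (K * (K * (\<beta>' + 1) + 2))"
  using assms by (intro mult_le_mono add_le_mono) auto

lemma bounded_run_mono:
  assumes "bounded_run K g \<beta> T P s t" "T \<le> T'"
  shows "bounded_run K g \<beta> T' P s t"
proof -
  have "T * g \<le> T' * g" using assms by simp
  moreover have "(2::int) ^ (\<beta> + T * g) \<le> 2 ^ (\<beta> + T' * g)"
    using assms by (intro power_increasing) auto
  ultimately show ?thesis
    using assms step_cost_mono[of T T' "\<beta> + T * g" "\<beta> + T' * g" K] unfolding bounded_run_def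
    by (meson add_left_mono order_trans)
qed

text \<open>The second phase starts with numbers that the first has lengthened, so both phases are
  charged at the final width.\<close>

lemma cost_add:
  fixes K :: nat
  assumes "m \<le> T * (K * (K * (\<beta> + T * g + 1) + 2))"
    "n \<le> T' * (K * (K * (\<beta> + T * g + T' * g + 1) + 2))"
  shows "m + n \<le> (T + T') * (K * (K * (\<beta> + (T + T') * g + 1) + 2))"
proof -
  let ?w = "K * (K * (\<beta> + (T + T') * g + 1) + 2)"
  have "m \<le> T * ?w" using assms(1) step_cost_mono[of T T "\<beta> + T * g" "\<beta> + (T + T') * g" K]
    by (simp add: algebra_simps)
  moreover have "n \<le> T' * ?w" using assms(2) by (simp add: algebra_simps)
  ultimately show ?thesis by (simp add: algebra_simps)
qed

lemma bounded_run_Seq: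
  assumes "bounded_run K g \<beta> T P s s'" "bounded_run K g (\<beta> + T * g) T' Q s' t"
  shows "bounded_run K g \<beta> (T + T') (Seq P Q) s t"
proof -
  obtain m n where mn: "exec P s m s'" "exec Q s' n t"
    and c: "m \<le> T * (K * (K * (\<beta> + T * g + 1) + 2))"
      "n \<le> T' * (K * (K * (\<beta> + T * g + T' * g + 1) + 2))"
    and b: "\<forall>x i. \<bar>t x i\<bar> \<le> 2 ^ (\<beta> + T * g + T' * g)"
    using assms unfolding bounded_run_def by blast
  have "\<beta> + T * g + T' * g = \<beta> + (T + T') * g" by (simp add: algebra_simps)
  then show ?thesis
    using exec.Seq[OF mn] cost_add[OF c] b unfolding bounded_run_def by metis
qed

lemma bounded_run_Put:
  assumes "\<And>x i. \<bar>s x i\<bar> \<le> 2 ^ \<beta>" "\<And>x i. x < 8 \<Longrightarrow> \<bar>s x i\<bar> \<le> 2 ^ \<mu>" "linear_exp a"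
    "exp_size i + exp_size a + 1 \<le> K" "K * (\<mu> + 1) \<le> g"
  shows "bounded_run K g \<beta> 1 (Put x i a) s (s(x := (s x)(aval i s := aval a s)))"
proof -
  let ?w = "K * (\<beta> + g + 1) + 2"
  have "exp_size i * (\<beta> + 1) \<le> K * (\<beta> + g + 1)" "exp_size a * (\<beta> + 1) \<le> K * (\<beta> + g + 1)"
    using assms(4) by (intro mult_le_mono; simp)+
  then have "acost i s \<le> exp_size i * ?w" "acost a s \<le> exp_size a * ?w"
    by (metis (no_types) acost_le[of s, OF assms(1)] add_le_mono1)+
  then have "acost i s + acost a s + 1 \<le> (exp_size i + exp_size a + 1) * ?w"
    by (simp add: algebra_simps)
  also have "\<dots> \<le> K * ?w" using assms(4) by (rule mult_le_mono1)
  finally have 1: "acost i s + acost a s + 1 \<le> K * ?w" .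
  have "\<bar>aval a s\<bar> \<le> 2 ^ (\<beta> + exp_size a * (\<mu> + 1))"
    by (rule abs_aval_linear_le) (use assms in auto)
  also have "exp_size a * (\<mu> + 1) \<le> K * (\<mu> + 1)" using assms(4) by (intro mult_le_mono1) simp
  then have "(2::int) ^ (\<beta> + exp_size a * (\<mu> + 1)) \<le> 2 ^ (\<beta> + g)"
    using assms(5) by (intro power_increasing) auto
  finally have 2: "\<bar>aval a s\<bar> \<le> 2 ^ (\<beta> + g)" .
  have 3: "\<bar>s y k\<bar> \<le> 2 ^ (\<beta> + g)" for y k
    using assms(1)[of y k] power_increasing[of \<beta> "\<beta> + g" "2::int"] by linarith
  show ?thesis
    unfolding bounded_run_def using exec.Put[of x i a s] 1 2 3 by auto
qed

lemma bounded_run_guard: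
  assumes "\<And>x i. \<bar>s x i\<bar> \<le> 2 ^ \<beta>" "test_size b \<le> K"
  shows "bcost b s \<le> K * (K * (\<beta> + g + 1) + 2)"
proof -
  have "test_size b * (\<beta> + 1) \<le> K * (\<beta> + g + 1)"
    using assms(2) by (intro mult_le_mono) auto
  then have "bcost b s \<le> test_size b * (K * (\<beta> + g + 1) + 2)"
    by (intro bcost_le[of s, OF assms(1)]) simp
  also have "\<dots> \<le> K * (K * (\<beta> + g + 1) + 2)" using assms(2) by (rule mult_le_mono1)
  finally show ?thesis .
qed

lemma aval_input_bound:
  "input_bound e \<Longrightarrow> s 0 = t 0 \<Longrightarrow> aval e s = aval e t"
  by (auto simp: input_bound_def)

text \<open>Numbers grow during the run, so \<open>s\<close> and \<open>\<beta>\<close> are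
  generalised in the induction, while \<open>s0\<close> keeps the input: all loop bounds and all
  multipliers refer to it and stay fixed.\<close>

theorem bounded_run_run:
  assumes "well_formed P" "prog_size P \<le> K" "K * (\<mu> + 1) \<le> g"
    and "\<And>x. x < 8 \<Longrightarrow> s x = s0 x" "\<And>x i. x < 8 \<Longrightarrow> \<bar>s0 x i\<bar> \<le> 2 ^ \<mu>"
    and "\<And>x i. \<bar>s x i\<bar> \<le> 2 ^ \<beta>"
    and "\<And>e. input_bound e \<Longrightarrow> aval e s0 \<le> int N"
  shows "bounded_run K g \<beta> (poly (steps P) N) (compile P) s (run P s)"
  using assms
proof (induction P arbitrary: s \<beta>)
  case Nop
  have "\<bar>s x i\<bar> \<le> 2 ^ (\<beta> + g)" for x i
    using Nop.prems(6)[of x i] power_increasing[of \<beta> "\<beta> + g" "2::int"] by linarith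
  moreover have "Suc 0 \<le> K * (K * (\<beta> + g + 1) + 2)" using Nop.prems(2) by simp
  ultimately show ?case using exec.Skip[of s] unfolding bounded_run_def by auto
next
  case (Assign x i a)
  have "bounded_run K g \<beta> 1 (Put x i a) s (s(x := (s x)(aval i s := aval a s)))"
    by (rule bounded_run_Put[where \<mu> = \<mu>]) (use Assign.prems in auto)
  then show ?case by (simp only: steps.simps poly_1 compile.simps run.simps)
next
  case (Then P Q)
  have 1: "bounded_run K g \<beta> (poly (steps P) N) (compile P) s (run P s)"
    by (rule Then.IH(1)) (use Then.prems in auto)
  have 2: "bounded_run K g (\<beta> + poly (steps P) N * g) (poly (steps Q) N) (compile Q) (run P s) (run Q (run P s))"
    by (rule Then.IH(2)) (use Then.prems 1 in \<open>auto simp: run_input bounded_run_def\<close>)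
  show ?case using bounded_run_Seq[OF 1 2] by simp
next
  case (Branch b P Q)
  \<comment> \<open>\<open>R\<close> is the branch taken and \<open>T\<close> its number of steps;
    \<open>T'\<close> is slack for the other branch, so that one bound serves both outcomes.\<close>
  have *: "bounded_run K g \<beta> (1 + T + T') (Cond b (compile P) (compile Q)) s t"
    if w: "bounded_run K g \<beta> T (compile R) s t" and R: "R = (if bval b s then P else Q)" for T T' R t
  proof -
    obtain n where n: "exec (compile R) s n t" "n \<le> T * (K * (K * (\<beta> + T * g + 1) + 2))"
      using w by (auto simp: bounded_run_def)
    have b: "bcost b s \<le> 1 * (K * (K * (\<beta> + 1 * g + 1) + 2))"
      using bounded_run_guard[of s \<beta> b K g] Branch.prems by simp
    have "n \<le> T * (K * (K * (\<beta> + 1 * g + T * g + 1) + 2))"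
      using n(2) step_cost_mono[of T T "\<beta> + T * g" "\<beta> + 1 * g + T * g" K] by (simp add: algebra_simps)
    note c = cost_add[OF b this]
    have ex: "exec (Cond b (compile P) (compile Q)) s (bcost b s + n) t"
      using n(1) R by (auto intro: exec.intros split: if_splits)
    have "(2::int) ^ (\<beta> + T * g) \<le> 2 ^ (\<beta> + (1 + T) * g)" by (rule power_increasing) auto
    then have "\<bar>t y i\<bar> \<le> 2 ^ (\<beta> + (1 + T) * g)" for y i
      using w[unfolded bounded_run_def] order_trans by blast
    then have "bounded_run K g \<beta> (1 + T) (Cond b (compile P) (compile Q)) s t"
      unfolding bounded_run_def using ex c by blast
    then show ?thesis by (rule bounded_run_mono) simp
  qed
  show ?case
  proof (cases "bval b s")
    case True
    have "bounded_run K g \<beta> (poly (steps P) N) (compile P) s (run P s)"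
      by (rule Branch.IH(1)) (use Branch.prems in auto)
    from *[OF this, of "poly (steps Q) N"] True show ?thesis by simp
  next
    case False
    have "bounded_run K g \<beta> (poly (steps Q) N) (compile Q) s (run Q s)"
      by (rule Branch.IH(2)) (use Branch.prems in auto)
    from *[OF this, of "poly (steps P) N"] False show ?thesis by (simp add: ac_simps)
  qed
next
  case (For x e P)
  define T where "T = poly (steps P) N"
  define f where "f = (\<lambda>t. incr x (run P t))"
  let ?g = "Less (Get x (Const 0)) e"
  let ?w = "While ?g (Seq (compile P) (Put x (Const 0) (Add (Get x (Const 0)) (Const 1))))"
  have x: "8 \<le> x" "x \<notin> writes P" "well_formed P" "input_bound e" and sz: "prog_size P \<le> K"
    using For.prems by auto
  \<comment> \<open>The 1 pays for the last, failing guard; each iteration pays \<open>T\<close> for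
    the body and 2 for guard and increment.\<close>
  have loop: "bounded_run K g \<beta> (1 + r * (T + 2)) ?w t ((f ^^ r) t)"
    if "\<And>y i. \<bar>t y i\<bar> \<le> 2 ^ \<beta>" "\<And>y. y < 8 \<Longrightarrow> t y = s0 y" "r = nat (aval e s0 - t x 0)" for r t \<beta>
    using that
  proof (induction r arbitrary: t \<beta>)
    case 0
    have v: "aval e t = aval e s0" using aval_input_bound[of e t s0] x 0 by simp
    then have "\<not> bval ?g t" using 0 by simp
    then have ex: "exec ?w t (bcost ?g t) t" by (rule exec.WhileFalse)
    have "bcost ?g t \<le> K * (K * (\<beta> + g + 1) + 2)"
      by (rule bounded_run_guard[of t \<beta> ?g]) (use 0 For.prems in auto)
    moreover have "(2::int) ^ \<beta> \<le> 2 ^ (\<beta> + g)" by (rule power_increasing) auto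
    then have "\<bar>t y i\<bar> \<le> 2 ^ (\<beta> + g)" for y i using 0(1)[of y i] by linarith
    ultimately have "bounded_run K g \<beta> 1 ?w t t"
      unfolding bounded_run_def mult_1 using ex by blast
    then show ?case by simp
  next
    case (Suc r)
    have v: "aval e t = aval e s0" using aval_input_bound[of e t s0] x Suc.prems by simp
    then have b: "bval ?g t" using Suc.prems by simp
    have gd: "bcost ?g t \<le> 1 * (K * (K * (\<beta> + 1 * g + 1) + 2))"
      using bounded_run_guard[of t \<beta> ?g K g] Suc.prems For.prems by auto
    have 1: "bounded_run K g \<beta> T (compile P) t (run P t)"
      unfolding T_def by (rule For.IH) (use For.prems Suc.prems in auto)
    have 2: "bounded_run K g (\<beta> + T * g) 1 (Put x (Const 0) (Add (Get x (Const 0)) (Const 1))) (run P t) (f t)"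
      using bounded_run_Put[of "run P t" "\<beta> + T * g" \<mu> "Add (Get x (Const 0)) (Const 1)" "Const 0" K g x]
        1 For.prems Suc.prems x by (auto simp: f_def bounded_run_def run_input)
    from bounded_run_Seq[OF 1 2] obtain m where
      m: "exec (Seq (compile P) (Put x (Const 0) (Add (Get x (Const 0)) (Const 1)))) t m (f t)"
        "m \<le> (T + 1) * (K * (K * (\<beta> + (T + 1) * g + 1) + 2))" 
        "\<And>y i. \<bar>f t y i\<bar> \<le> 2 ^ (\<beta> + (T + 1) * g)"
      unfolding bounded_run_def by auto
    have m2: "m \<le> (T + 1) * (K * (K * (\<beta> + 1 * g + (T + 1) * g + 1) + 2))"
      using m(2) step_cost_mono[of "T + 1" "T + 1" "\<beta> + (T + 1) * g" "\<beta> + 1 * g + (T + 1) * g" K]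
      by (simp add: algebra_simps)
    have c1: "bcost ?g t + m \<le> (T + 2) * (K * (K * (\<beta> + (T + 2) * g + 1) + 2))"
      using cost_add[OF gd m2] by simp
    have bd: "\<bar>f t y i\<bar> \<le> 2 ^ (\<beta> + (T + 2) * g)" for y i
    proof -
      have "(2::int) ^ (\<beta> + (T + 1) * g) \<le> 2 ^ (\<beta> + (T + 2) * g)" by (rule power_increasing) auto
      then show ?thesis using m(3)[of y i] by linarith
    qed
    have "bounded_run K g (\<beta> + (T + 2) * g) (1 + r * (T + 2)) ?w (f t) ((f ^^ r) (f t))"
    proof (rule Suc.IH[OF bd])
      show "f t y = s0 y" if "y < 8" for y
        using that x Suc.prems by (simp add: f_def run_input)
      have "f t x 0 = t x 0 + 1" using x by (simp add: f_def run_frame)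
      then show "r = nat (aval e s0 - f t x 0)" using Suc.prems(3) by simp
    qed
    then obtain n where n: "exec ?w (f t) n ((f ^^ r) (f t))"
      "n \<le> (1 + r * (T + 2)) * (K * (K * (\<beta> + (T + 2) * g + (1 + r * (T + 2)) * g + 1) + 2))"
      "\<And>y i. \<bar>(f ^^ r) (f t) y i\<bar> \<le> 2 ^ (\<beta> + (T + 2) * g + (1 + r * (T + 2)) * g)"
      unfolding bounded_run_def by auto
    have "exec ?w t (bcost ?g t + m + n) ((f ^^ Suc r) t)"
      using exec.WhileTrue[OF b m(1) n(1)] by (simp only: funpow_Suc_right o_apply)
    moreover have "bcost ?g t + m + n \<le>
        (1 + Suc r * (T + 2)) * (K * (K * (\<beta> + (1 + Suc r * (T + 2)) * g + 1) + 2))"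
    proof -
      have eq: "(T + 2) + (1 + r * (T + 2)) = 1 + Suc r * (T + 2)" by simp
      show ?thesis using cost_add[OF c1 n(2)] unfolding eq .
    qed
    moreover have "\<bar>(f ^^ Suc r) t y i\<bar> \<le> 2 ^ (\<beta> + (1 + Suc r * (T + 2)) * g)" for y i
      using n(3)[of y i] by (simp only: funpow_Suc_right o_apply) (simp add: algebra_simps)
    ultimately show ?case unfolding bounded_run_def by blast
  qed
  define s1 where "s1 = s(x := (s x)(0 := 0))"
  have w1: "bounded_run K g \<beta> 1 (Put x (Const 0) (Const 0)) s s1"
    using bounded_run_Put[of s \<beta> \<mu> "Const 0" "Const 0" K g x] For.prems by (auto simp: s1_def)
  have "bounded_run K g (\<beta> + 1 * g) (1 + nat (aval e s0) * (T + 2)) ?w s1 ((f ^^ nat (aval e s0)) s1)"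
    by (rule loop) (use w1 x For.prems(4) in \<open>auto simp: s1_def bounded_run_def\<close>)
  from bounded_run_Seq[OF w1 this]
  have "bounded_run K g \<beta> (2 + nat (aval e s0) * (T + 2)) (compile (For x e P)) s ((f ^^ nat (aval e s0)) s1)"
    by simp
  moreover have "aval e s = aval e s0"
    using aval_input_bound[of e s s0] x For.prems(4)[of 0] by simp
  then have "run (For x e P) s = (f ^^ nat (aval e s0)) s1"
    by (simp add: f_def s1_def)
  moreover have "nat (aval e s0) \<le> N" using For.prems(7)[OF x(4)] by simp
  then have "2 + nat (aval e s0) * (T + 2) \<le> poly (steps (For x e P)) N"
    by (simp add: T_def algebra_simps mult_le_mono add_mono)
  ultimately show ?case by (metis bounded_run_mono)
qed

section \<open>The potential of the greedy algorithm\<close>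

text \<open>For nonnegative arguments this is the integral of \<open>min 1 (\<tau> / x)\<close> for
  \<open>x\<close> from 0 to \<open>\<nu>\<close>. If \<open>\<tau> = 0 < \<nu>\<close>, the factor
  \<open>\<tau>\<close> makes it 0, whatever the value of the quotient.\<close>

definition potential :: "real \<Rightarrow> real \<Rightarrow> real" where
  "potential \<tau> \<nu> = (if \<nu> \<le> \<tau> then \<nu> else \<tau> * (1 + ln (\<nu> / \<tau>)))"

lemma ln_ge_one_minus_inverse: "0 < (y::real) \<Longrightarrow> 1 - 1 / y \<le> ln y"
  using ln_le_minus_one[of "1 / y"] by (simp add: ln_div)

text \<open>The potential is concave in \<open>\<nu>\<close> with slope \<open>min 1 (\<tau> / \<nu>)\<close>.\<close>

lemma potential_step:
  assumes "0 \<le> \<tau>" "\<gamma> \<le> \<nu>" "0 \<le> \<delta>" "\<delta> \<le> \<gamma>" "\<delta> * \<nu> \<le> \<tau> * \<gamma>"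
  shows "\<delta> + potential \<tau> (\<nu> - \<gamma>) \<le> potential \<tau> \<nu>"
proof -
  define w where "w = \<nu> - \<gamma>"
  have w: "0 \<le> w" "w \<le> \<nu>" and g: "\<gamma> = \<nu> - w" using assms by (auto simp: w_def)
  \<comment> \<open>The cases are the positions of the interval from \<open>w\<close> to
    \<open>\<nu>\<close> relative to the kink at \<open>\<tau>\<close>; \<open>\<tau> = 0\<close> is
    separate because the last two cases divide by \<open>\<tau>\<close>.\<close>
  consider "\<nu> \<le> \<tau>" | "\<tau> < \<nu>" "\<tau> = 0" | "\<tau> < \<nu>" "0 < \<tau>" "w \<le> \<tau>" | "\<tau> < w" "0 < \<tau>"
    using assms by linarith
  then have "\<delta> + potential \<tau> w \<le> potential \<tau> \<nu>"
  proof cases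
    case 1
    then show ?thesis using assms w by (simp add: potential_def g)
  next
    case 2
    then have "\<delta> = 0" using assms by (simp add: mult_le_0_iff)
    then show ?thesis using 2 w by (simp add: potential_def)
  next
    case 3
    have "\<delta> \<le> \<tau> * (\<nu> - w) / \<nu>" using assms 3 by (simp add: field_simps g)
    also have "\<dots> = \<tau> - w * (\<tau> / \<nu>)" using 3 by (simp add: field_simps)
    finally have "\<delta> + w \<le> \<tau> + w * (1 - \<tau> / \<nu>)" by (simp add: algebra_simps)
    \<comment> \<open>The coefficient of \<open>w\<close> is nonnegative because
      \<open>\<tau> < \<nu>\<close>, so \<open>w\<close> may be raised to the kink
      \<open>\<tau>\<close>.\<close>
    also have "\<dots> \<le> \<tau> + \<tau> * (1 - \<tau> / \<nu>)"
      using 3 by (intro add_left_mono mult_right_mono) auto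
    also have "\<dots> \<le> \<tau> + \<tau> * ln (\<nu> / \<tau>)"
      using 3 ln_ge_one_minus_inverse[of "\<nu> / \<tau>"] by simp
    finally show ?thesis using 3 by (simp add: potential_def algebra_simps)
  next
    case 4
    then have \<nu>: "0 < \<nu>" "\<tau> < \<nu>" using w by auto
    have "\<delta> \<le> \<tau> * (\<nu> - w) / \<nu>" using assms \<nu> by (simp add: field_simps g)
    also have "\<dots> = \<tau> * (1 - 1 / (\<nu> / w))" using 4 \<nu> by (simp add: field_simps)
    also have "\<dots> \<le> \<tau> * ln (\<nu> / w)"
      using 4 \<nu> ln_ge_one_minus_inverse[of "\<nu> / w"] by (intro mult_left_mono) auto
    also have "\<dots> = \<tau> * ln (\<nu> / \<tau>) - \<tau> * ln (w / \<tau>)" using 4 \<nu> by (simp add: ln_div algebra_simps)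
    finally show ?thesis using 4 \<nu> by (simp add: potential_def algebra_simps)
  qed
  then show ?thesis by (simp add: w_def)
qed

section \<open>From the potential to the ratios\<close>

lemma omega_zero: "omega 0 = 0"
  \<comment> \<open>\<open>omega_iff_root\<close> covers positive arguments only; at 0 the defining
    equation has the single root 0.\<close>
  unfolding omega_def lambert_W_def by (rule the_equality) auto

lemma omega_pos: "0 < \<theta> \<Longrightarrow> 0 < omega \<theta>"
  using omega_iff_root by blast

text \<open>With \<open>w = omega \<theta>\<close> and \<open>c = \<theta> * q\<close>, the bound is
  attained at \<open>\<tau> = w * q\<close>. The logarithm is split at that point: the root equation
  turns \<open>ln (\<theta> / w)\<close> into \<open>w + 1\<close>, and the tangent of
  \<open>ln\<close> at 1 bounds the rest, so that \<open>q\<close> and \<open>\<tau>\<close> receive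
  the same coefficient \<open>w\<close>.\<close>

lemma potential_le_omega:
  assumes "0 \<le> \<theta>" "0 \<le> q" "0 \<le> \<tau>" "c \<le> \<theta> * q"
  shows "q + potential \<tau> c \<le> (1 + omega \<theta>) * (q + \<tau>)"
proof -
  have w0: "0 \<le> omega \<theta>" using omega_pos[of \<theta>] omega_zero assms(1) by (cases "\<theta> = 0") auto
  have nn: "0 \<le> omega \<theta> * (q + \<tau>)" using w0 assms by simp
  consider "c \<le> \<tau>" | "\<tau> < c" "\<tau> = 0" | "\<tau> < c" "0 < \<tau>" using assms by linarith
  then show ?thesis
  proof cases
    case 3
    define w where "w = omega \<theta>"
    have "0 < \<theta> * q" using assms 3 by linarith
    then have pos: "0 < \<theta>" "0 < q" using assms by (auto simp: zero_less_mult_iff)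
    have w: "0 < w" "w + 1 = ln (\<theta> / w)" using omega_iff_root[OF pos(1), of w] by (auto simp: w_def)
    have "ln (c / \<tau>) \<le> ln (\<theta> * q / \<tau>)" using 3 assms by (simp add: divide_right_mono)
    also have "\<dots> = ln (\<theta> / w) + ln (w * q / \<tau>)" using pos w 3 by (simp add: ln_div ln_mult)
    also have "\<dots> \<le> w + w * q / \<tau>" using w 3 pos ln_le_minus_one[of "w * q / \<tau>"] by simp
    finally have "\<tau> * ln (c / \<tau>) \<le> \<tau> * (w + w * q / \<tau>)" using 3 by (intro mult_left_mono) auto
    also have "\<dots> = w * (q + \<tau>)" using 3 by (simp add: field_simps)
    finally show ?thesis using 3 by (simp add: potential_def w_def algebra_simps)
  qed (use nn in \<open>auto simp: potential_def algebra_simps\<close>)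
qed

lemma potential_le_ln:
  assumes "1 \<le> d" "0 \<le> q" "0 \<le> \<tau>" "c \<le> d * \<tau>"
  shows "q + potential \<tau> c \<le> (1 + ln d) * (q + \<tau>)"
proof -
  have nn: "0 \<le> ln d * q" "0 \<le> ln d * \<tau>" using assms by simp_all
  consider "c \<le> \<tau>" | "\<tau> < c" "\<tau> = 0" | "\<tau> < c" "0 < \<tau>" using assms by linarith
  then show ?thesis
  proof cases
    case 3
    have "ln (c / \<tau>) \<le> ln d" using 3 assms by (simp add: field_simps)
    then have "\<tau> * ln (c / \<tau>) \<le> \<tau> * ln d" using 3 by (intro mult_left_mono) auto
    then have "\<tau> * ln (c / \<tau>) \<le> ln d * \<tau> + ln d * q" using nn by (simp add: mult.commute)
    then show ?thesis using 3 by (simp add: potential_def algebra_simps)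
  qed (use nn in \<open>auto simp: potential_def algebra_simps\<close>)
qed

text \<open>The bound on \<open>c / \<tau>\<close> factors as \<open>(d + 1) * (1 + r)\<close> with
  \<open>r = d / (d + 1) * (q / \<tau>)\<close>. Then \<open>ln (1 + r) \<le> r\<close>, and
  \<open>d / (d + 1) \<le> ln (d + 1)\<close> gives \<open>q\<close> the same coefficient as
  \<open>\<tau>\<close>.\<close>

lemma potential_le_ln_succ:
  assumes "0 \<le> d" "0 \<le> q" "0 \<le> \<tau>" "c \<le> (d + 1) * \<tau> + d * q"
  shows "q + potential \<tau> c \<le> (1 + ln (d + 1)) * (q + \<tau>)"
proof -
  have nn: "0 \<le> ln (d + 1) * q" "0 \<le> ln (d + 1) * \<tau>" using assms by simp_all
  consider "c \<le> \<tau>" | "\<tau> < c" "\<tau> = 0" | "\<tau> < c" "0 < \<tau>" using assms by linarith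
  then show ?thesis
  proof cases
    case 3
    let ?r = "d / (d + 1) * (q / \<tau>)"
    have r: "0 \<le> ?r" using assms by simp
    have "c / \<tau> \<le> ((d + 1) * \<tau> + d * q) / \<tau>" using 3 assms(4) by (simp add: divide_right_mono)
    also have "\<dots> = (d + 1) * (1 + ?r)"
    proof -
      have "(d + 1) * (1 + ?r) = (d + 1) + ((d + 1) * (d / (d + 1))) * (q / \<tau>)"
        by (simp only: distrib_left mult_1_right mult.assoc)
      also have "(d + 1) * (d / (d + 1)) = d" using assms by simp
      finally show ?thesis using 3 by (simp add: add_divide_distrib)
    qed
    finally have le: "c / \<tau> \<le> (d + 1) * (1 + ?r)" .
    have "0 < c / \<tau>" using 3 by simp
    then have "ln (c / \<tau>) \<le> ln ((d + 1) * (1 + ?r))"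
      using le by (subst ln_le_cancel_iff) linarith+
    also have "\<dots> = ln (d + 1) + ln (1 + ?r)" using assms r by (intro ln_mult_pos) linarith+
    also have "ln (1 + ?r) \<le> ?r" using r by (rule ln_add_one_self_le_self)
    also have "?r = (1 - 1 / (d + 1)) * (q / \<tau>)" using assms by (simp add: field_simps)
    also have "\<dots> \<le> ln (d + 1) * (q / \<tau>)"
      using assms ln_ge_one_minus_inverse[of "d + 1"] by (intro mult_right_mono) auto
    finally have "\<tau> * ln (c / \<tau>) \<le> \<tau> * (ln (d + 1) + ln (d + 1) * (q / \<tau>))"
      using 3 by simp
    also have "\<dots> = ln (d + 1) * (q + \<tau>)" using 3 by (simp add: field_simps)
    finally show ?thesis using 3 by (simp add: potential_def algebra_simps)
  qed (use nn in \<open>auto simp: potential_def algebra_simps\<close>)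
qed

section \<open>Stars\<close>

text \<open>An instance with every edge oriented both ways and with thresholds scaled to integers.
  \<open>reverse_arc\<close> shows that the centre of a star is covered too, and lets a one-edge
  star exchange its roles; \<open>terminal_arc\<close> keeps the minima in \<open>q\<close> and
  \<open>c\<close> nonempty.\<close>

locale arc_system =
  fixes n K :: nat and C L :: "nat \<Rightarrow> nat" and TC TL :: "nat \<Rightarrow> int" and R :: "nat set"
  assumes C_less: "k < K \<Longrightarrow> C k < n" and L_less: "k < K \<Longrightarrow> L k < n"
    and C_neq_L: "k < K \<Longrightarrow> C k \<noteq> L k"
    and TC_nonneg: "k < K \<Longrightarrow> 0 \<le> TC k" and TL_nonneg: "k < K \<Longrightarrow> 0 \<le> TL k"
    and R_subset: "R \<subseteq> {..<n}"
    and reverse_arc: "k < K \<Longrightarrow> \<exists>k'<K. C k' = L k \<and> L k' = C k \<and> TC k' = TL k \<and> TL k' = TC k"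
    and terminal_arc: "u \<in> R \<Longrightarrow> \<exists>k<K. L k = u"
begin

definition q :: "nat \<Rightarrow> int" where
  "q u = (if u \<in> R then Min (TL ` {k. k < K \<and> L k = u}) else 0)"

definition c :: "nat \<Rightarrow> int" where
  "c u = (if u \<in> R then Min ((\<lambda>k. TL k + TC k) ` {k. k < K \<and> L k = u}) - q u else 0)"

definition raised :: "(nat \<Rightarrow> int) \<Rightarrow> nat \<Rightarrow> int" where
  "raised a k = max (a (L k)) (TL k)"

text \<open>
  The star proposed by the arcs \<open>i\<close> and \<open>j\<close> has centre \<open>C i\<close>, raised to the level \<open>TC i\<close>. Its
  leaves are the uncovered terminals whose ratio of cost to gain is at most that of \<open>L j\<close>. A
  positive value \<open>G u\<close> marks the terminal \<open>u\<close> as uncovered.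
\<close>

definition leaf_arcs :: "(nat \<Rightarrow> int) \<Rightarrow> (nat \<Rightarrow> int) \<Rightarrow> nat \<Rightarrow> nat \<Rightarrow> nat \<Rightarrow> nat set" where
  "leaf_arcs a G i j \<kappa> = {k. k < \<kappa> \<and> C k = C i \<and> TC k \<le> max (a (C i)) (TC i) \<and> 0 < G (L k) \<and>
     (raised a k - a (L k)) * G (L j) \<le> (raised a j - a (L j)) * G (L k)}"

text \<open>\<open>\<kappa>\<close> is the number of arcs scanned: \<open>K\<close> gives the whole
  star, smaller values are the intermediate states of the loop in \<open>star_prog\<close>. The
  minimum takes care of parallel arcs to the same leaf.\<close>

definition star_a :: "(nat \<Rightarrow> int) \<Rightarrow> (nat \<Rightarrow> int) \<Rightarrow> nat \<Rightarrow> nat \<Rightarrow> nat \<Rightarrow> nat \<Rightarrow> int" where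
  "star_a a G i j \<kappa> u =
     (if u = C i then max (a u) (TC i)
      else if u \<in> L ` leaf_arcs a G i j \<kappa> then Min (raised a ` {k \<in> leaf_arcs a G i j \<kappa>. L k = u})
      else a u)"

text \<open>The edge to any leaf also covers the centre, so the price of the centre is gained as
  soon as one leaf exists.\<close>

definition star_G :: "(nat \<Rightarrow> int) \<Rightarrow> (nat \<Rightarrow> int) \<Rightarrow> nat \<Rightarrow> nat \<Rightarrow> nat \<Rightarrow> nat \<Rightarrow> int" where
  "star_G a G i j \<kappa> u =
     (if u \<in> L ` leaf_arcs a G i j \<kappa> \<or> u = C i \<and> leaf_arcs a G i j \<kappa> \<noteq> {} then 0 else G u)"

definition star_cost :: "(nat \<Rightarrow> int) \<Rightarrow> (nat \<Rightarrow> int) \<Rightarrow> nat \<Rightarrow> nat \<Rightarrow> int" where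
  "star_cost a G i j = (\<Sum>u<n. star_a a G i j K u - a u)"

definition star_gain :: "(nat \<Rightarrow> int) \<Rightarrow> (nat \<Rightarrow> int) \<Rightarrow> nat \<Rightarrow> nat \<Rightarrow> int" where
  "star_gain a G i j = (\<Sum>u<n. G u - star_G a G i j K u)"

text \<open>A relation and not a function: ties between candidates stay open, and cells outside the
  nodes are unconstrained. Cross-multiplied ratios stay within the integers.\<close>

definition greedy_step ::
  "(nat \<Rightarrow> int) \<Rightarrow> (nat \<Rightarrow> int) \<Rightarrow> (nat \<Rightarrow> int) \<Rightarrow> (nat \<Rightarrow> int) \<Rightarrow> bool" where
  "greedy_step a G a' G' \<longleftrightarrow>
     (\<forall>u<n. a' u = a u \<and> G' u = G u) \<and> (\<forall>i<K. \<forall>j<K. star_gain a G i j \<le> 0) \<or>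
     (\<exists>i<K. \<exists>j<K. (\<forall>u<n. a' u = star_a a G i j K u \<and> G' u = star_G a G i j K u) \<and>
        0 < star_gain a G i j \<and>
        (\<forall>i'<K. \<forall>j'<K. star_cost a G i j * star_gain a G i' j' \<le>
            star_cost a G i' j' * star_gain a G i j))"

text \<open>Only the implication from \<open>G u = 0\<close> to coverage is kept: a terminal that
  happens to be covered already may still carry its price.\<close>

definition partial_cover :: "(nat \<Rightarrow> int) \<Rightarrow> (nat \<Rightarrow> int) \<Rightarrow> bool" where
  "partial_cover a G \<longleftrightarrow> (\<forall>u<n. q u \<le> a u) \<and> (\<forall>u<n. G u = 0 \<or> G u = c u) \<and>
     (\<forall>u\<in>R. G u = 0 \<longrightarrow> (\<exists>k<K. L k = u \<and> TL k \<le> a u \<and> TC k \<le> a (C k)))"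

definition cover :: "(nat \<Rightarrow> real) \<Rightarrow> bool" where
  "cover z \<longleftrightarrow> (\<forall>u<n. 0 \<le> z u) \<and> (\<forall>u\<in>R. \<exists>k<K. L k = u \<and> real_of_int (TL k) \<le> z u \<and> real_of_int (TC k) \<le> z (C k))"

section \<open>Prices, covers and partial covers\<close>

lemma q_le: "u \<in> R \<Longrightarrow> k < K \<Longrightarrow> L k = u \<Longrightarrow> q u \<le> TL k"
  unfolding q_def by (auto intro!: Min_le)

lemma q_nonneg: "0 \<le> q u"
  using terminal_arc TL_nonneg by (auto simp: q_def Min_ge_iff)

lemma c_le: "u \<in> R \<Longrightarrow> k < K \<Longrightarrow> L k = u \<Longrightarrow> c u \<le> TL k + TC k - q u"
  unfolding c_def by (auto intro!: Min_le)

lemma c_attained: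
  assumes "u \<in> R"
  obtains k where "k < K" "L k = u" "c u = TL k + TC k - q u"
proof -
  let ?S = "{k. k < K \<and> L k = u}"
  have "Min ((\<lambda>k. TL k + TC k) ` ?S) \<in> (\<lambda>k. TL k + TC k) ` ?S"
    using terminal_arc[OF assms] by (intro Min_in) auto
  then show ?thesis using that assms by (auto simp: c_def)
qed

lemma c_nonneg: "0 \<le> c u"
proof (cases "u \<in> R")
  case True
  then obtain k where "k < K" "L k = u" "c u = TL k + TC k - q u" by (rule c_attained)
  then show ?thesis using q_le[OF True] TC_nonneg[of k] by force
qed (simp add: c_def)

lemma cover_ge_q: "cover z \<Longrightarrow> u < n \<Longrightarrow> real_of_int (q u) \<le> z u"
proof (cases "u \<in> R")
  case True
  assume "cover z"
  then obtain k where k: "k < K" "L k = u" "real_of_int (TL k) \<le> z u" using True by (auto simp: cover_def)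
  then have "real_of_int (q u) \<le> TL k" using q_le[OF True] by simp
  then show ?thesis using k by simp
qed (auto simp: cover_def q_def)

lemma partial_cover_G:
  assumes "partial_cover a G" "u < n"
  shows "0 \<le> G u" "0 < G u \<Longrightarrow> u \<in> R \<and> G u = c u"
proof -
  have G: "G u = 0 \<or> G u = c u" using assms by (simp add: partial_cover_def)
  then show "0 \<le> G u" using c_nonneg[of u] by auto
  show "u \<in> R \<and> G u = c u" if "0 < G u"
    using G that by (cases "u \<in> R") (auto simp: c_def[of u])
qed

text \<open>The point is a terminal of price 0, which counts as covered from the start: on its
  cheapest arc the centre threshold is 0 and the leaf threshold is \<open>q u\<close>, so
  \<open>q\<close> activates it.\<close>

lemma partial_cover_init: "partial_cover q c"
  unfolding partial_cover_def
proof (intro conjI ballI impI)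
  fix u assume u: "u \<in> R" "c u = 0"
  then obtain k where k: "k < K" "L k = u" "c u = TL k + TC k - q u" by (metis c_attained)
  then have "TC k = 0" "TL k = q u" using u q_le[of u k] TC_nonneg[of k] by auto
  then show "\<exists>k<K. L k = u \<and> TL k \<le> q u \<and> TC k \<le> q (C k)"
    using k q_nonneg by auto
qed auto

lemma finite_leaf_arcs [simp]: "finite (leaf_arcs a G i j \<kappa>)"
  by (rule finite_subset[of _ "{..<\<kappa>}"]) (auto simp: leaf_arcs_def)

lemma leaf_neq_centre: "k \<in> leaf_arcs a G i j K \<Longrightarrow> L k \<noteq> C i"
  using C_neq_L[of k] by (auto simp: leaf_arcs_def)

lemma star_a_attained:
  assumes "u \<in> L ` leaf_arcs a G i j K"
  obtains k where "k \<in> leaf_arcs a G i j K" "L k = u" "star_a a G i j K u = raised a k"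
proof -
  let ?S = "{k \<in> leaf_arcs a G i j K. L k = u}"
  have "Min (raised a ` ?S) \<in> raised a ` ?S" using assms by (intro Min_in) auto
  moreover have "u \<noteq> C i" using assms by (auto dest: leaf_neq_centre)
  ultimately show ?thesis using that assms by (auto simp: star_a_def)
qed

lemma star_a_le_raised:
  assumes "k \<in> leaf_arcs a G i j K"
  shows "star_a a G i j K (L k) \<le> raised a k"
proof -
  have "L k \<noteq> C i" using assms by (rule leaf_neq_centre)
  then show ?thesis using assms by (auto simp: star_a_def intro!: Min_le)
qed

lemma star_a_ge: "a u \<le> star_a a G i j K u"
proof (cases "u \<in> L ` leaf_arcs a G i j K")
  case True
  then obtain k where "L k = u" "star_a a G i j K u = raised a k" by (rule star_a_attained)
  then show ?thesis by (simp add: raised_def)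
qed (auto simp: star_a_def)

lemma partial_cover_star:
  assumes "partial_cover a G" "i < K"
  shows "partial_cover (star_a a G i j K) (star_G a G i j K)"
  unfolding partial_cover_def
proof (intro conjI ballI allI impI)
  let ?b = "star_a a G i j K"
  let ?Q = "leaf_arcs a G i j K"
  show "q u \<le> ?b u" if "u < n" for u
    using assms that star_a_ge[of a u G i j] by (fastforce simp: partial_cover_def)
  show "star_G a G i j K u = 0 \<or> star_G a G i j K u = c u" if "u < n" for u
    using assms that by (auto simp: partial_cover_def star_G_def)
  \<comment> \<open>Not \<open>k\<close> itself but the cheapest arc of the star with the same leaf
    is activated, since \<open>star_a\<close> raises the leaf only to the minimum.\<close>
  have leaf: "\<exists>k'\<in>?Q. k' < K \<and> L k' = L k \<and> TL k' \<le> ?b (L k) \<and> C k' = C i \<and> TC k' \<le> ?b (C k')"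
    if "k \<in> ?Q" for k
  proof -
    have "L k \<in> L ` ?Q" using that by simp
    then obtain k' where k': "k' \<in> ?Q" "L k' = L k" "?b (L k) = raised a k'" by (rule star_a_attained)
    then show ?thesis by (intro bexI[of _ k']) (auto simp: leaf_arcs_def raised_def star_a_def)
  qed
  fix u assume u: "u \<in> R" "star_G a G i j K u = 0"
  consider "G u = 0" | k where "k \<in> ?Q" "u = L k" | k where "k \<in> ?Q" "u = C i"
    using u(2) unfolding star_G_def by (auto split: if_splits)
  then show "\<exists>k<K. L k = u \<and> TL k \<le> ?b u \<and> TC k \<le> ?b (C k)"
  proof cases
    case 1
    then obtain k where "k < K" "L k = u" "TL k \<le> a u" "TC k \<le> a (C k)"
      using assms u by (auto simp: partial_cover_def)
    then show ?thesis using star_a_ge[of a u G i j] star_a_ge[of a "C k" G i j] by force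
  next
    case (2 k)
    then show ?thesis using leaf[of k] by auto
  next
    \<comment> \<open>The centre has become covered: reversing the activated arc to any leaf gives
      an arc that ends in the centre.\<close>
    case (3 k)
    from leaf[OF 3(1)] obtain k' where k': "k' < K" "L k' = L k" "TL k' \<le> ?b (L k)" "C k' = C i"
      "TC k' \<le> ?b (C k')" by blast
    from reverse_arc[OF k'(1)] obtain k'' where "k'' < K" "C k'' = L k'" "L k'' = C k'"
      "TC k'' = TL k'" "TL k'' = TC k'" by blast
    then show ?thesis using k' 3 by (intro exI[of _ k'']) auto
  qed
qed

section \<open>Some candidate is as good as any given star\<close>

lemma star_cost_nonneg: "0 \<le> star_cost a G i j"
  unfolding star_cost_def using star_a_ge by (intro sum_nonneg) simp

lemma star_cost_eq:
  fixes a G :: "nat \<Rightarrow> int" and i j :: nat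
  assumes "i < K"
  defines "B \<equiv> leaf_arcs a G i j K"
  shows "star_cost a G i j =
    max (a (C i)) (TC i) - a (C i) + (\<Sum>u\<in>L ` B. star_a a G i j K u - a u)"
proof -
  have v: "C i \<notin> L ` B" unfolding B_def by (auto dest: leaf_neq_centre)
  have "star_cost a G i j = (\<Sum>u\<in>insert (C i) (L ` B). star_a a G i j K u - a u)"
    unfolding star_cost_def
    by (rule sum.mono_neutral_right)
      (use assms C_less L_less in \<open>auto simp: leaf_arcs_def star_a_def\<close>)
  also have "\<dots> = star_a a G i j K (C i) - a (C i) + (\<Sum>u\<in>L ` B. star_a a G i j K u - a u)"
    using v by (simp add: B_def)
  finally show ?thesis by (simp add: star_a_def)
qed

lemma star_gain_eq:
  fixes a G :: "nat \<Rightarrow> int" and i j :: nat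
  assumes "i < K" and ne: "leaf_arcs a G i j K \<noteq> {}"
  defines "B \<equiv> leaf_arcs a G i j K"
  shows "star_gain a G i j = G (C i) + (\<Sum>u\<in>L ` B. G u)"
proof -
  have v: "C i \<notin> L ` B" unfolding B_def by (auto dest: leaf_neq_centre)
  have "star_gain a G i j = (\<Sum>u\<in>insert (C i) (L ` B). G u - star_G a G i j K u)"
    unfolding star_gain_def
    by (rule sum.mono_neutral_right)
      (use assms C_less L_less in \<open>auto simp: leaf_arcs_def star_G_def\<close>)
  also have "\<dots> = (\<Sum>u\<in>insert (C i) (L ` B). G u)"
    using ne by (intro sum.cong) (auto simp: star_G_def B_def)
  also have "\<dots> = G (C i) + (\<Sum>u\<in>L ` B. G u)"
    using v by (simp add: B_def)
  finally show ?thesis .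
qed

text \<open>
  With \<open>\<sigma> = p / g\<close>: dropping the leaves of ratio above \<open>\<sigma>\<close> from a star of density at most \<open>\<sigma>\<close>, and
  adding those of ratio at most \<open>\<sigma>\<close>, keeps the density at most \<open>\<sigma>\<close>. The leaf of largest ratio in the
  result serves as \<open>j\<close>.
\<close>

lemma dense_candidate:
  assumes pc: "partial_cover a G" and i: "i < K" and A: "A \<subseteq> {..<K}" "inj_on L A"
    and arc: "\<And>k. k \<in> A \<Longrightarrow> C k = C i \<and> 0 < G (L k) \<and> TC k \<le> TC i" and g: "0 < (g::int)"
    and le: "g * (max (a (C i)) (TC i) - a (C i) + (\<Sum>k\<in>A. raised a k - a (L k)))
               \<le> p * (G (C i) + (\<Sum>k\<in>A. G (L k)))"
    and k0: "k0 \<in> A" "g * (raised a k0 - a (L k0)) \<le> p * G (L k0)"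
  shows "\<exists>j<K. 0 < star_gain a G i j \<and> g * star_cost a G i j \<le> p * star_gain a G i j"
proof -
  let ?x = "\<lambda>k. raised a k - a (L k)"
  \<comment> \<open>All arcs at this centre with ratio at most \<open>p / g\<close>, whether or not
    they belong to \<open>A\<close>.\<close>
  define B where "B = {k. k < K \<and> C k = C i \<and> TC k \<le> max (a (C i)) (TC i) \<and> 0 < G (L k) \<and>
    g * ?x k \<le> p * G (L k)}"
  define r where "r k = real_of_int (?x k) / real_of_int (G (L k))" for k
  have AB: "k \<in> B" if "k \<in> A" "g * ?x k \<le> p * G (L k)" for k
    using that arc[OF that(1)] A by (auto simp: B_def)
  have fin: "finite B" by (rule finite_subset[of _ "{..<K}"]) (auto simp: B_def)
  have ne: "B \<noteq> {}" using AB[OF k0] by auto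
  obtain j where j: "j \<in> B" "\<And>k. k \<in> B \<Longrightarrow> r k \<le> r j"
  proof -
    have "Max (r ` B) \<in> r ` B" using fin ne by (intro Max_in) auto
    then obtain j where "j \<in> B" "Max (r ` B) = r j" by auto
    then show ?thesis using that[of j] Max_ge[of "r ` B"] fin by auto
  qed
  have jK: "j < K" and Gj: "0 < G (L j)" and gj: "g * ?x j \<le> p * G (L j)" using j by (auto simp: B_def)
  \<comment> \<open>The largest ratio in \<open>B\<close> selects the same arcs as the threshold
    \<open>p / g\<close>; hence \<open>B\<close> is one of the polynomially many candidates.\<close>
  have Beq: "leaf_arcs a G i j K = B"
  proof (intro set_eqI iffI)
    fix k assume k: "k \<in> B"
    then have Gk: "0 < G (L k)" by (simp add: B_def)
    have "real_of_int (?x k) * real_of_int (G (L j)) \<le> real_of_int (?x j) * real_of_int (G (L k))"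
      using j(2)[OF k] Gj Gk by (simp add: r_def field_simps)
    then have "?x k * G (L j) \<le> ?x j * G (L k)"
      by (simp only: of_int_le_iff flip: of_int_mult)
    then show "k \<in> leaf_arcs a G i j K" using k by (auto simp: leaf_arcs_def B_def)
  next
    fix k assume k: "k \<in> leaf_arcs a G i j K"
    then have k': "k < K" "C k = C i" "TC k \<le> max (a (C i)) (TC i)" "0 < G (L k)"
      "?x k * G (L j) \<le> ?x j * G (L k)" by (auto simp: leaf_arcs_def)
    have "g * ?x k * G (L j) \<le> g * ?x j * G (L k)"
      using k'(5) g by (metis mult.assoc mult_left_mono order_less_imp_le)
    also have "\<dots> \<le> p * G (L j) * G (L k)" using gj k'(4) by (intro mult_right_mono) auto
    finally have "(g * ?x k) * G (L j) \<le> (p * G (L k)) * G (L j)" by (simp add: mult_ac)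
    then have "g * ?x k \<le> p * G (L k)" using Gj by (rule mult_right_le_imp_le)
    then show "k \<in> B" using k' by (simp add: B_def)
  qed
  define F where "F u = (if u \<in> L ` B then g * (star_a a G i j K u - a u) - p * G u else 0)" for u
  have F0: "F u \<le> 0" for u
  proof (cases "u \<in> L ` B")
    case True
    then have "u \<in> L ` leaf_arcs a G i j K" using Beq by simp
    then obtain k where k: "k \<in> leaf_arcs a G i j K" "L k = u" "star_a a G i j K u = raised a k"
      by (rule star_a_attained)
    then have "k \<in> B" using Beq by simp
    then show ?thesis using k by (auto simp: F_def B_def)
  qed (simp add: F_def)
  have FA: "F (L k) \<le> g * ?x k - p * G (L k)" if k: "k \<in> A" for k
  proof (cases "k \<in> B")
    case True
    have "g * (star_a a G i j K (L k) - a (L k)) \<le> g * ?x k"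
      using star_a_le_raised[of k a G i j] True Beq g by simp
    then show ?thesis using True by (simp add: F_def)
  next
    case False
    then have "g * ?x k > p * G (L k)" using AB[OF k] by linarith
    then show ?thesis using F0[of "L k"] by linarith
  qed
  have finA: "finite A" using A finite_subset by blast
  have "(\<Sum>u\<in>L ` B. F u) = (\<Sum>u\<in>L ` A \<union> L ` B. F u)"
    using fin finA by (intro sum.mono_neutral_left) (auto simp: F_def)
  also have "\<dots> = (\<Sum>u\<in>L ` A \<union> L ` B - L ` A. F u) + (\<Sum>u\<in>L ` A. F u)"
    using fin finA by (intro sum.subset_diff) auto
  also have "\<dots> \<le> (\<Sum>u\<in>L ` A. F u)"
    using sum_nonpos[of "L ` A \<union> L ` B - L ` A" F] F0 by simp
  also have "\<dots> = (\<Sum>k\<in>A. F (L k))" using A by (simp add: sum.reindex)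
  also have "\<dots> \<le> (\<Sum>k\<in>A. g * ?x k - p * G (L k))" by (rule sum_mono) (rule FA)
  also have "\<dots> = g * (\<Sum>k\<in>A. ?x k) - p * (\<Sum>k\<in>A. G (L k))"
    by (subst sum_subtractf) (simp only: sum_distrib_left)
  finally have 1: "(\<Sum>u\<in>L ` B. F u) \<le> g * (\<Sum>k\<in>A. ?x k) - p * (\<Sum>k\<in>A. G (L k))" .
  have 2: "(\<Sum>u\<in>L ` B. F u) = g * (\<Sum>u\<in>L ` B. star_a a G i j K u - a u) - p * (\<Sum>u\<in>L ` B. G u)"
    unfolding sum_distrib_left sum_subtractf[symmetric] by (simp add: F_def)
  have cost: "star_cost a G i j =
      max (a (C i)) (TC i) - a (C i) + (\<Sum>u\<in>L ` B. star_a a G i j K u - a u)"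
    using star_cost_eq[OF i, of a G j] unfolding Beq .
  have gain: "star_gain a G i j = G (C i) + (\<Sum>u\<in>L ` B. G u)"
    using star_gain_eq[OF i, of a G j] ne unfolding Beq .
  have "g * star_cost a G i j \<le> p * star_gain a G i j"
    unfolding cost gain using 1 2 le by (simp add: algebra_simps)
  moreover have "0 < star_gain a G i j"
  proof -
    have "0 < (\<Sum>u\<in>L ` B. G u)" using fin ne by (intro sum_pos) (auto simp: B_def)
    then show ?thesis unfolding gain using partial_cover_G(1)[OF pc C_less[OF i]] by linarith
  qed
  ultimately show ?thesis using jK by blast
qed

text \<open>
  If all leaves have ratio above the density, the gain comes from the centre, and reversing a
  single arc turns the centre into a leaf of small ratio.
\<close>

lemma star_has_candidate:
  fixes a G :: "nat \<Rightarrow> int" and i :: nat and A :: "nat set"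
  assumes pc: "partial_cover a G" and i: "i \<in> A" and A: "A \<subseteq> {..<K}" "inj_on L A"
    and arc: "\<And>k. k \<in> A \<Longrightarrow> C k = C i \<and> 0 < G (L k) \<and> TC k \<le> TC i"
  defines "p \<equiv> max (a (C i)) (TC i) - a (C i) + (\<Sum>k\<in>A. raised a k - a (L k))"
    and "g \<equiv> G (C i) + (\<Sum>k\<in>A. G (L k))"
  shows "\<exists>i<K. \<exists>j<K. 0 < star_gain a G i j \<and> g * star_cost a G i j \<le> p * star_gain a G i j"
proof -
  let ?x = "\<lambda>k. raised a k - a (L k)"
  have finA: "finite A" using A finite_subset by blast
  have iK: "i < K" using i A by auto
  have sG: "0 < (\<Sum>k\<in>A. G (L k))" using finA i arc by (intro sum_pos) auto
  have Gi: "0 \<le> G (C i)" by (rule partial_cover_G(1)[OF pc C_less[OF iK]])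
  have g: "0 < g" using sG Gi by (simp add: g_def)
  show ?thesis
  proof (cases "\<exists>k\<in>A. g * ?x k \<le> p * G (L k)")
    case True
    then obtain k0 where k0: "k0 \<in> A" "g * ?x k0 \<le> p * G (L k0)" by blast
    have "g * p \<le> p * g" by simp
    then show ?thesis
      using dense_candidate[OF pc iK A arc g _ k0] iK unfolding p_def g_def by blast
  next
    case False
    let ?d = "max (a (C i)) (TC i) - a (C i)"
    \<comment> \<open>All leaves lie above the density, so dropping all but \<open>i\<close> does
      not raise it: the single edge of \<open>i\<close> still has density at most
      \<open>p / g\<close>.\<close>
    have big: "p * G (L k) \<le> g * ?x k" if "k \<in> A" for k using False that by force
    have "p * (\<Sum>k\<in>A - {i}. G (L k)) \<le> g * (\<Sum>k\<in>A - {i}. ?x k)"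
      unfolding sum_distrib_left using big by (intro sum_mono) auto
    moreover have "(\<Sum>k\<in>A. G (L k)) = G (L i) + (\<Sum>k\<in>A - {i}. G (L k))"
      "(\<Sum>k\<in>A. ?x k) = ?x i + (\<Sum>k\<in>A - {i}. ?x k)"
      using finA i by (simp_all add: sum.remove)
    moreover have "g * (?d + (\<Sum>k\<in>A. ?x k)) = p * (G (C i) + (\<Sum>k\<in>A. G (L k)))"
      by (simp add: p_def g_def mult.commute)
    ultimately have pair: "g * (?d + ?x i) \<le> p * (G (C i) + G (L i))"
      by (simp only: distrib_left)
    have strict: "p * G (L i) < g * ?x i" using False i by force
    \<comment> \<open>Leaf \<open>i\<close> alone exceeds the density, so the increment at the
      centre must lie strictly below it, which forces a positive price there.\<close>
    with pair have ctr: "g * ?d < p * G (C i)" by (simp add: algebra_simps)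
    have "0 \<le> ?d" by simp
    with ctr g have "0 < p * G (C i)" by (meson mult_nonneg_nonneg order.strict_trans1 order_less_imp_le)
    then have Gpos: "0 < G (C i)" using Gi by (cases "G (C i) = 0") auto
    obtain i' where i': "i' < K" "C i' = L i" "L i' = C i" "TC i' = TL i" "TL i' = TC i"
      using reverse_arc[OF iK] by blast
    \<comment> \<open>Reversal swaps the two increments of the edge and thus keeps its total cost
      and gain.\<close>
    have r: "raised a i' = max (a (C i)) (TC i)" "max (a (C i')) (TC i') = raised a i"
      using i' by (simp_all add: raised_def)
    have "\<exists>j<K. 0 < star_gain a G i' j \<and> g * star_cost a G i' j \<le> p * star_gain a G i' j"
    proof (rule dense_candidate[OF pc i'(1), where A = "{i'}" and ?k0.0 = i'])
      show "g * (max (a (C i')) (TC i') - a (C i') + (\<Sum>k\<in>{i'}. raised a k - a (L k)))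
          \<le> p * (G (C i') + (\<Sum>k\<in>{i'}. G (L k)))"
        using pair r i' by (simp add: algebra_simps)
      show "g * (raised a i' - a (L i')) \<le> p * G (L i')" using ctr r i' by simp
    qed (use i' Gpos g in auto)
    then show ?thesis using i' by blast
  qed
qed

text \<open>The ratio \<open>\<delta> / \<gamma>\<close> is at most that of the candidate from
  \<open>star_has_candidate\<close>, which is at most that of the given star. The gain of the
  candidate is positive and cancels.\<close>

lemma star_density:
  assumes pc: "partial_cover a G" and i: "i \<in> A" and A: "A \<subseteq> {..<K}" "inj_on L A"
    and arc: "\<And>k. k \<in> A \<Longrightarrow> C k = C i \<and> 0 < G (L k) \<and> TC k \<le> TC i"
    and \<gamma>: "0 \<le> \<gamma>"
    and best: "\<And>i j. i < K \<Longrightarrow> j < K \<Longrightarrow> \<delta> * star_gain a G i j \<le> star_cost a G i j * \<gamma>"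
  shows "\<delta> * (G (C i) + (\<Sum>k\<in>A. G (L k))) \<le>
    (max (a (C i)) (TC i) - a (C i) + (\<Sum>k\<in>A. raised a k - a (L k))) * \<gamma>"
    (is "\<delta> * ?g \<le> ?p * \<gamma>")
proof -
  obtain i' j' where ij: "i' < K" "j' < K" "0 < star_gain a G i' j'"
    "?g * star_cost a G i' j' \<le> ?p * star_gain a G i' j'"
    using star_has_candidate[OF pc i A arc] by blast
  let ?s = "star_gain a G i' j'"
  have "0 \<le> G (C i)" using pc C_less i A by (auto intro!: partial_cover_G(1))
  moreover have "0 \<le> (\<Sum>k\<in>A. G (L k))" using arc by (intro sum_nonneg) force
  ultimately have g: "0 \<le> ?g" by simp
  have "\<delta> * ?g * ?s \<le> star_cost a G i' j' * \<gamma> * ?g"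
    using mult_right_mono[OF best[OF ij(1,2)] g] by (simp add: mult_ac)
  also have "\<dots> \<le> ?p * ?s * \<gamma>"
    using mult_right_mono[OF ij(4) \<gamma>] by (simp add: mult_ac)
  finally have "(\<delta> * ?g) * ?s \<le> (?p * \<gamma>) * ?s" by (simp add: mult_ac)
  then show ?thesis using ij(3) by (rule mult_right_le_imp_le)
qed

text \<open>Every edge of a minimal edge cover has an end that no other edge covers: its leaf.\<close>

lemma star_decomposition:
  assumes z: "cover z" and U: "U \<subseteq> R"
  obtains J where "J \<subseteq> {..<K}" "inj_on L J" "L ` J \<subseteq> U" "L ` J \<inter> C ` J = {}" "U \<subseteq> L ` J \<union> C ` J"
    "\<forall>k\<in>J. real_of_int (TL k) \<le> z (L k) \<and> real_of_int (TC k) \<le> z (C k)"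
proof -
  define ok where "ok J \<longleftrightarrow> J \<subseteq> {k. k < K \<and> real_of_int (TL k) \<le> z (L k) \<and> real_of_int (TC k) \<le> z (C k)} \<and>
    U \<subseteq> L ` J \<union> C ` J" for J
  have "ok {k. k < K \<and> real_of_int (TL k) \<le> z (L k) \<and> real_of_int (TC k) \<le> z (C k)}"
    using z U by (force simp: ok_def cover_def)
  then obtain J where J: "ok J" and min: "\<And>J'. ok J' \<Longrightarrow> card J \<le> card J'"
    using ex_has_least_nat[of ok _ card] by blast
  have sub: "J \<subseteq> {..<K}" using J by (auto simp: ok_def)
  then have fin: "finite J" using finite_subset by blast
  \<comment> \<open>By minimality, deleting \<open>k\<close> would uncover some \<open>u\<close> in
    \<open>U\<close>. This private end is made the leaf, by reversing the arc if it is the centre;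
    privacy later yields injectivity and disjointness from the centres.\<close>
  have "\<exists>k'<K. L k' \<in> U \<and> {L k', C k'} = {L k, C k} \<and> (\<forall>f\<in>J. L k' \<in> {L f, C f} \<longrightarrow> f = k) \<and>
      real_of_int (TL k') \<le> z (L k') \<and> real_of_int (TC k') \<le> z (C k')" if k: "k \<in> J" for k
  proof -
    have "\<not> ok (J - {k})" using min[of "J - {k}"] k fin by (metis card_Diff1_less not_le)
    then obtain u where u: "u \<in> U" "u \<notin> L ` (J - {k}) \<union> C ` (J - {k})"
      using J by (auto simp: ok_def)
    then have p: "\<forall>f\<in>J. u \<in> {L f, C f} \<longrightarrow> f = k" by blast
    have uk: "u = L k \<or> u = C k" using J u by (auto simp: ok_def)
    have k': "k < K" "real_of_int (TL k) \<le> z (L k)" "real_of_int (TC k) \<le> z (C k)" using J k by (auto simp: ok_def)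
    from uk show ?thesis
    proof
      assume "u = L k" then show ?thesis using u(1) p k' by blast
    next
      assume "u = C k"
      moreover obtain l where "l < K" "C l = L k" "L l = C k" "TC l = TL k" "TL l = TC k"
        using reverse_arc[OF k'(1)] by blast
      ultimately show ?thesis using u(1) p k' by (intro exI[of _ l]) auto
    qed
  qed
  then obtain f where f: "\<And>k. k \<in> J \<Longrightarrow> f k < K \<and> L (f k) \<in> U \<and> {L (f k), C (f k)} = {L k, C k} \<and>
      (\<forall>e\<in>J. L (f k) \<in> {L e, C e} \<longrightarrow> e = k) \<and> real_of_int (TL (f k)) \<le> z (L (f k)) \<and> real_of_int (TC (f k)) \<le> z (C (f k))"
    by metis
  show ?thesis
  proof (rule that[of "f ` J"])
    show "inj_on L (f ` J)"
    proof (rule inj_onI)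
      fix x y assume "x \<in> f ` J" "y \<in> f ` J" and eq: "L x = L y"
      then obtain k l where kl: "k \<in> J" "l \<in> J" "x = f k" "y = f l" by blast
      have "L (f k) \<in> {L l, C l}" using eq f[OF kl(2)] kl by auto
      then have "l = k" using f[OF kl(1)] kl by blast
      then show "x = y" using kl by simp
    qed
    show "L ` f ` J \<inter> C ` f ` J = {}"
    proof (rule ccontr)
      assume "L ` f ` J \<inter> C ` f ` J \<noteq> {}"
      then obtain k l where kl: "k \<in> J" "l \<in> J" "L (f k) = C (f l)" by auto
      have "L (f k) \<in> {L l, C l}" using kl(3) f[OF kl(2)] by auto
      then have "l = k" using f[OF kl(1)] kl by blast
      then show False using kl C_neq_L[of "f k"] f[OF kl(1)] by auto
    qed
    show "U \<subseteq> L ` f ` J \<union> C ` f ` J"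
    proof
      fix u assume "u \<in> U"
      then obtain k where "k \<in> J" "u \<in> {L k, C k}" using J by (auto simp: ok_def)
      then show "u \<in> L ` f ` J \<union> C ` f ` J" using f[of k] by blast
    qed
  qed (use f in auto)
qed

text \<open>Grouped by centre, the arcs of \<open>J\<close> form stars on disjoint node sets, so
  each node is counted once.\<close>

lemma sum_over_stars:
  fixes h :: "nat \<Rightarrow> real"
  assumes "J \<subseteq> {..<K}" "inj_on L J" "L ` J \<inter> C ` J = {}"
  shows "(\<Sum>v\<in>C ` J. h v + (\<Sum>k\<in>{k \<in> J. C k = v}. h (L k))) = (\<Sum>u\<in>L ` J \<union> C ` J. h u)"
proof -
  have fin: "finite J" using assms finite_subset by blast
  have "(\<Sum>v\<in>C ` J. \<Sum>k\<in>{k \<in> J. C k = v}. h (L k)) = (\<Sum>k\<in>J. h (L k))"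
    by (rule sum.image_gen[OF fin, symmetric])
  also have "\<dots> = (\<Sum>u\<in>L ` J. h u)" using assms by (simp add: sum.reindex)
  finally show ?thesis
    using fin assms(3) by (simp add: sum.distrib sum.union_disjoint)
qed

text \<open>An averaging argument: the best ratio bounds every star of an edge cover activated by
  \<open>z\<close>, and the sum over node-disjoint stars compares the total uncovered price with the
  total cost.\<close>

lemma optimal_density:
  assumes pc: "partial_cover a G" and z: "cover z" and \<gamma>: "0 \<le> \<gamma>"
    and best: "\<And>i j. i < K \<Longrightarrow> j < K \<Longrightarrow> \<delta> * star_gain a G i j \<le> star_cost a G i j * \<gamma>"
  shows "real_of_int \<delta> * (\<Sum>u<n. real_of_int (G u)) \<le> (\<Sum>u<n. z u - real_of_int (q u)) * real_of_int \<gamma>"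
proof -
  let ?U = "{u. u < n \<and> 0 < G u}"
  have "?U \<subseteq> R" using partial_cover_G(2)[OF pc] by blast
  then obtain J where J: "J \<subseteq> {..<K}" "inj_on L J" "L ` J \<subseteq> ?U" "L ` J \<inter> C ` J = {}"
    "?U \<subseteq> L ` J \<union> C ` J" and
    J6: "\<forall>k\<in>J. real_of_int (TL k) \<le> z (L k) \<and> real_of_int (TC k) \<le> z (C k)"
    by (rule star_decomposition[OF z])
  have sub: "L ` J \<union> C ` J \<subseteq> {..<n}" using J(1) C_less L_less by auto
  have fin: "finite J" using J finite_subset by blast
  \<comment> \<open>The stars need no increment beyond \<open>m\<close> over the current
    \<open>a\<close>. Since \<open>z\<close> and \<open>a\<close> both dominate \<open>q\<close>,
    \<open>m u \<le> z u - q u\<close> however far \<open>a\<close> has grown.\<close>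
  define m where "m u = max (z u) (a u) - real_of_int (a u)" for u
  have m0: "0 \<le> m u" for u by (simp add: m_def)
  have star: "real_of_int \<delta> * (G v + (\<Sum>k\<in>{k \<in> J. C k = v}. real_of_int (G (L k))))
      \<le> (m v + (\<Sum>k\<in>{k \<in> J. C k = v}. m (L k))) * real_of_int \<gamma>" if v: "v \<in> C ` J" for v
  proof -
    let ?A = "{k \<in> J. C k = v}"
    \<comment> \<open>The arc with the highest threshold at the centre determines the level for the
      whole star.\<close>
    have A: "finite ?A" "?A \<noteq> {}" using fin v by auto
    then have "Max (TC ` ?A) \<in> TC ` ?A" by (intro Max_in) auto
    then obtain i where i: "i \<in> ?A" "Max (TC ` ?A) = TC i" by auto
    have max: "TC k \<le> TC i" if "k \<in> ?A" for k
      using that A by (auto simp flip: i(2) intro!: Max_ge)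
    have "\<delta> * (G (C i) + (\<Sum>k\<in>?A. G (L k))) \<le>
        (max (a (C i)) (TC i) - a (C i) + (\<Sum>k\<in>?A. raised a k - a (L k))) * \<gamma>"
      by (rule star_density[OF pc i(1) _ _ _ \<gamma> best])
        (use J i max in \<open>auto intro: inj_on_subset\<close>)
    then have "real_of_int (\<delta> * (G v + (\<Sum>k\<in>?A. G (L k)))) \<le>
        real_of_int ((max (a v) (TC i) - a v + (\<Sum>k\<in>?A. raised a k - a (L k))) * \<gamma>)"
      using i(1) unfolding of_int_le_iff by simp
    also have "\<dots> = (max (a v) (TC i) - a v + (\<Sum>k\<in>?A. real_of_int (raised a k - a (L k)))) * real_of_int \<gamma>"
      by simp
    also have "\<dots> \<le> (m v + (\<Sum>k\<in>?A. m (L k))) * real_of_int \<gamma>"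
    proof (intro mult_right_mono add_mono sum_mono)
      show "real_of_int (max (a v) (TC i) - a v) \<le> m v" using J6[rule_format, of i] i(1) by (auto simp: m_def)
      show "real_of_int (raised a k - a (L k)) \<le> m (L k)" if "k \<in> ?A" for k
        using J6[rule_format, of k] that by (auto simp: m_def raised_def)
    qed (use \<gamma> in auto)
    finally show ?thesis by simp
  qed
  have "(\<Sum>u<n. real_of_int (G u)) = (\<Sum>u\<in>L ` J \<union> C ` J. real_of_int (G u))"
    using sub J(5) partial_cover_G(1)[OF pc] by (intro sum.mono_neutral_right) force+
  also have "\<dots> = (\<Sum>v\<in>C ` J. G v + (\<Sum>k\<in>{k \<in> J. C k = v}. real_of_int (G (L k))))"
    using sum_over_stars[OF J(1,2,4), of "\<lambda>u. real_of_int (G u)"] by simp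
  finally have "\<delta> * (\<Sum>u<n. real_of_int (G u)) =
      (\<Sum>v\<in>C ` J. real_of_int \<delta> * (G v + (\<Sum>k\<in>{k \<in> J. C k = v}. real_of_int (G (L k)))))"
    by (simp only: sum_distrib_left)
  also have "\<dots> \<le> (\<Sum>v\<in>C ` J. (m v + (\<Sum>k\<in>{k \<in> J. C k = v}. m (L k))) * real_of_int \<gamma>)"
    by (rule sum_mono) (rule star)
  also have "\<dots> = (\<Sum>u\<in>L ` J \<union> C ` J. m u) * real_of_int \<gamma>"
    using sum_over_stars[OF J(1,2,4), of m] by (simp flip: sum_distrib_right)
  also have "\<dots> \<le> (\<Sum>u<n. z u - real_of_int (q u)) * real_of_int \<gamma>"
  proof (rule mult_right_mono)
    have "(\<Sum>u\<in>L ` J \<union> C ` J. m u) \<le> (\<Sum>u<n. m u)" using sub m0 by (intro sum_mono2) auto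
    also have "\<dots> \<le> (\<Sum>u<n. z u - real_of_int (q u))"
    proof (rule sum_mono)
      fix u assume "u \<in> {..<n}"
      then have "real_of_int (q u) \<le> z u" "q u \<le> a u"
        using cover_ge_q[OF z] pc by (auto simp: partial_cover_def)
      then show "m u \<le> z u - real_of_int (q u)" by (auto simp: m_def max_def)
    qed
    finally show "(\<Sum>u\<in>L ` J \<union> C ` J. m u) \<le> (\<Sum>u<n. z u - real_of_int (q u))" .
  qed (use \<gamma> in auto)
  finally show ?thesis .
qed

text \<open>The arc attaining \<open>c u\<close> works: its price is its cost above
  \<open>q u\<close> at the leaf and above 0 at the centre, and \<open>a\<close> is already at least
  that high.\<close>

lemma single_arc_star:
  assumes pc: "partial_cover a G" and u: "u < n" "0 < G u"
  obtains k where "k < K" "L k = u"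
    "max (a (C k)) (TC k) - a (C k) + (raised a k - a (L k)) \<le> G u"
proof -
  have R: "u \<in> R" and Gc: "G u = c u" using partial_cover_G(2)[OF pc u] by auto
  obtain k where k: "k < K" "L k = u" "c u = TL k + TC k - q u" using R by (rule c_attained)
  have "q u \<le> TL k" "q u \<le> a u" "0 \<le> a (C k)" "0 \<le> TC k"
    using q_le[OF R k(1,2)] pc u C_less[OF k(1)] q_nonneg[of "C k"] TC_nonneg[OF k(1)]
    by (auto simp: partial_cover_def intro: order_trans)
  then show ?thesis using k Gc by (intro that[of k]) (auto simp: raised_def)
qed

text \<open>This is the bound 1 in the slope \<open>min 1 (\<tau> / \<nu>)\<close>; it matters once
  the uncovered price has dropped below the budget.\<close>

lemma density_le_one:
  assumes pc: "partial_cover a G" and u: "u < n" "0 < G u" and \<gamma>: "0 \<le> \<gamma>" and \<delta>: "0 \<le> \<delta>"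
    and best: "\<And>i j. i < K \<Longrightarrow> j < K \<Longrightarrow> \<delta> * star_gain a G i j \<le> star_cost a G i j * \<gamma>"
  shows "\<delta> \<le> \<gamma>"
proof -
  obtain k where k: "k < K" "L k = u"
    "max (a (C k)) (TC k) - a (C k) + (raised a k - a (L k)) \<le> G u"
    using single_arc_star[of a G u] pc u by blast
  have "\<delta> * (G (C k) + (\<Sum>k\<in>{k}. G (L k))) \<le>
      (max (a (C k)) (TC k) - a (C k) + (\<Sum>k\<in>{k}. raised a k - a (L k))) * \<gamma>"
    by (rule star_density[OF pc _ _ _ _ \<gamma> best]) (use k u in auto)
  also have "\<dots> \<le> G u * \<gamma>" using k \<gamma> by (intro mult_right_mono) auto
  finally have "\<delta> * (G (C k) + G u) \<le> \<gamma> * G u" using k by (simp add: mult_ac)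
  moreover have "\<delta> * G u \<le> \<delta> * (G (C k) + G u)"
    using \<delta> partial_cover_G(1)[OF pc C_less[OF k(1)]] by (intro mult_left_mono) auto
  ultimately have "\<delta> * G u \<le> \<gamma> * G u" by linarith
  then show ?thesis using u by simp
qed

section \<open>Progress of one greedy round\<close>

lemma partial_cover_cong:
  assumes "partial_cover a G" "\<And>u. u < n \<Longrightarrow> a' u = a u \<and> G' u = G u"
  shows "partial_cover a' G'"
  unfolding partial_cover_def
proof (intro conjI ballI allI impI)
  fix u assume u: "u \<in> R" "G' u = 0"
  then have "u < n" using R_subset by auto
  then obtain k where "k < K" "L k = u" "TL k \<le> a u" "TC k \<le> a (C k)"
    using assms u by (auto simp: partial_cover_def)
  then show "\<exists>k<K. L k = u \<and> TL k \<le> a' u \<and> TC k \<le> a' (C k)"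
    using assms(2) C_less \<open>u < n\<close> by (intro exI[of _ k]) auto
qed (use assms in \<open>auto simp: partial_cover_def\<close>)

text \<open>By the second claim, as many rounds as nodes suffice; truncated subtraction lets it hold
  for an idle round as well, when nothing is uncovered. By the third, value plus potential never
  increases.\<close>

lemma greedy_step_progress:
  assumes pc: "partial_cover a G" and step: "greedy_step a G a' G'"
  shows "partial_cover a' G'"
    and "card {u. u < n \<and> 0 < G' u} \<le> card {u. u < n \<and> 0 < G u} - 1"
    and "\<And>z. cover z \<Longrightarrow>
      (\<Sum>u<n. real_of_int (a' u)) + potential (\<Sum>u<n. z u - real_of_int (q u)) (\<Sum>u<n. real_of_int (G' u)) \<le>
      (\<Sum>u<n. real_of_int (a u)) + potential (\<Sum>u<n. z u - real_of_int (q u)) (\<Sum>u<n. real_of_int (G u))"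
proof -
  let ?pot = "\<lambda>z G. potential (\<Sum>u<n. z u - real_of_int (q u)) (\<Sum>u<n. real_of_int (G u))"
  consider
    (idle) "\<And>u. u < n \<Longrightarrow> a' u = a u \<and> G' u = G u" "\<And>i j. i < K \<Longrightarrow> j < K \<Longrightarrow> star_gain a G i j \<le> 0" |
    (star) i j where "i < K" "j < K"
      "\<And>u. u < n \<Longrightarrow> a' u = star_a a G i j K u \<and> G' u = star_G a G i j K u"
      "0 < star_gain a G i j"
      "\<And>i' j'. i' < K \<Longrightarrow> j' < K \<Longrightarrow> star_cost a G i j * star_gain a G i' j' \<le>
            star_cost a G i' j' * star_gain a G i j"
    using step unfolding greedy_step_def by blast
  then have "partial_cover a' G' \<and> card {u. u < n \<and> 0 < G' u} \<le> card {u. u < n \<and> 0 < G u} - 1 \<and>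
    (\<forall>z. cover z \<longrightarrow> (\<Sum>u<n. real_of_int (a' u)) + ?pot z G' \<le> (\<Sum>u<n. real_of_int (a u)) + ?pot z G)"
  proof cases
    case idle
    \<comment> \<open>An uncovered terminal would give a one-arc star and with it a candidate of
      positive gain.\<close>
    have none: "{u. u < n \<and> 0 < G u} = {}"
    proof (rule ccontr)
      assume "\<not> ?thesis"
      then obtain u where u: "u < n" "0 < G u" by blast
      obtain k where k: "k < K" "L k = u" using single_arc_star[of a G u] pc u by blast
      have "\<exists>i<K. \<exists>j<K. 0 < star_gain a G i j"
        using star_has_candidate[OF pc, of k "{k}"] k u by auto
      then show False using idle(2) by fastforce
    qed
    have eq: "(\<Sum>u<n. real_of_int (a' u)) = (\<Sum>u<n. real_of_int (a u))"
      "(\<Sum>u<n. real_of_int (G' u)) = (\<Sum>u<n. real_of_int (G u))"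
      using idle(1) by (auto intro!: sum.cong)
    have none': "{u. u < n \<and> 0 < G' u} = {}" using none idle(1) by auto
    show ?thesis unfolding none' using partial_cover_cong[OF pc idle(1)] eq by simp
  next
    case (star i j)
    let ?\<delta> = "star_cost a G i j" and ?\<gamma> = "star_gain a G i j"
    have pc': "partial_cover a' G'"
      by (rule partial_cover_cong[OF partial_cover_star[OF pc star(1)] star(3)])
    have le: "G' u \<le> G u \<and> (0 < G' u \<longrightarrow> G' u = G u)" if "u < n" for u
      using star(3)[OF that] partial_cover_G(1)[OF pc that] by (auto simp: star_G_def)
    have gain: "?\<gamma> = (\<Sum>u<n. G u - G' u)" unfolding star_gain_def using star(3) by (intro sum.cong) auto
    have cost: "?\<delta> = (\<Sum>u<n. a' u - a u)" unfolding star_cost_def using star(3) by (intro sum.cong) auto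
    obtain u where u: "u < n" "G' u < G u"
      using star(4) sum_nonpos[of "{..<n}" "\<lambda>u. G u - G' u"] unfolding gain
      by (metis diff_le_0_iff_le lessThan_iff not_le)
    have Gu: "0 < G u" using u partial_cover_G(1)[OF pc' u(1)] by simp
    have "{u. u < n \<and> 0 < G' u} \<subset> {u. u < n \<and> 0 < G u}"
      using u Gu le by force
    then have "card {u. u < n \<and> 0 < G' u} < card {u. u < n \<and> 0 < G u}"
      by (intro psubset_card_mono) auto
    moreover have "(\<Sum>u<n. real_of_int (a' u)) + ?pot z G' \<le> (\<Sum>u<n. real_of_int (a u)) + ?pot z G"
      if z: "cover z" for z
    proof -
      let ?\<tau> = "\<Sum>u<n. z u - real_of_int (q u)"
      have \<tau>: "0 \<le> ?\<tau>" using cover_ge_q[OF z] by (intro sum_nonneg) simp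
      have 1: "?\<delta> \<le> ?\<gamma>"
        by (rule density_le_one[OF pc u(1) Gu]) (use star star_cost_nonneg in auto)
      have 2: "real_of_int ?\<delta> * (\<Sum>u<n. real_of_int (G u)) \<le> ?\<tau> * real_of_int ?\<gamma>"
        by (rule optimal_density[OF pc z]) (use star in auto)
      have G': "(\<Sum>u<n. real_of_int (G' u)) = (\<Sum>u<n. real_of_int (G u)) - ?\<gamma>"
        unfolding gain by (simp add: sum_subtractf)
      have "0 \<le> (\<Sum>u<n. real_of_int (G' u))"
        using partial_cover_G(1)[OF pc'] by (intro sum_nonneg) auto
      then have "?\<gamma> \<le> (\<Sum>u<n. real_of_int (G u))" unfolding G' by simp
      then have "?\<delta> + potential ?\<tau> ((\<Sum>u<n. real_of_int (G u)) - ?\<gamma>) \<le> ?pot z G"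
        using potential_step[OF \<tau> _ _ _ 2] 1 star_cost_nonneg[of a G i j] by simp
      moreover have "(\<Sum>u<n. real_of_int (a' u)) = (\<Sum>u<n. real_of_int (a u)) + ?\<delta>"
        unfolding cost by (simp add: sum_subtractf)
      ultimately show ?thesis unfolding G' by simp
    qed
    ultimately show ?thesis using pc' by auto
  qed
  then show "partial_cover a' G'" "card {u. u < n \<and> 0 < G' u} \<le> card {u. u < n \<and> 0 < G u} - 1"
    "\<And>z. cover z \<Longrightarrow> (\<Sum>u<n. real_of_int (a' u)) + ?pot z G' \<le> (\<Sum>u<n. real_of_int (a u)) + ?pot z G"
    by blast+
qed

text \<open>The level of a centre serves at most \<open>\<Delta>\<close> leaves and so enters their
  prices at most \<open>\<Delta>\<close> times. A centre that is itself a terminal has its own price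
  bounded through one of its arcs, reversed; this adds 1 to the factor \<open>\<Delta>\<close>, and
  since the levels of terminals contain \<open>q\<close>, terms in \<open>q\<close> appear.
  Independence excludes such centres.\<close>

lemma sum_c_le:
  assumes z: "cover z" and \<Delta>: "\<And>v. v < n \<Longrightarrow> card (L ` {k. k < K \<and> C k = v \<and> L k \<in> R}) \<le> \<Delta>"
  shows "(\<Sum>u<n. real_of_int (c u)) \<le>
      (real \<Delta> + 1) * (\<Sum>u<n. z u - real_of_int (q u)) + real \<Delta> * (\<Sum>u<n. real_of_int (q u))"
    and "(\<And>k. k < K \<Longrightarrow> C k \<in> R \<Longrightarrow> L k \<notin> R) \<Longrightarrow>
      (\<Sum>u<n. real_of_int (c u)) \<le> real \<Delta> * (\<Sum>u<n. z u - real_of_int (q u))"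
proof -
  obtain J where J: "J \<subseteq> {..<K}" "inj_on L J" "L ` J \<subseteq> R" "L ` J \<inter> C ` J = {}"
    "R \<subseteq> L ` J \<union> C ` J" and
    J6: "\<forall>k\<in>J. real_of_int (TL k) \<le> z (L k) \<and> real_of_int (TC k) \<le> z (C k)"
    by (rule star_decomposition[OF z order_refl])
  have sub: "L ` J \<union> C ` J \<subseteq> {..<n}" using J(1) C_less L_less by auto
  have fin: "finite J" using J finite_subset by blast
  define m where "m u = z u - real_of_int (q u)" for u
  have m0: "0 \<le> m u" if "u < n" for u using cover_ge_q[OF z that] by (simp add: m_def)
  have mJ: "0 \<le> m (L k)" "0 \<le> m (C k)" if "k \<in> J" for k using that J(1) L_less C_less m0 by auto
  let ?A = "\<lambda>v. {k \<in> J. C k = v}"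
  have arc: "real_of_int (c (L k)) \<le> m (L k) + z (C k)" if "k \<in> J" for k
  proof -
    have "real_of_int (c (L k)) \<le> real_of_int (TL k + TC k - q (L k))"
      unfolding of_int_le_iff by (rule c_le) (use that J in auto)
    then show ?thesis using J6[rule_format, OF that] by (simp add: m_def)
  qed
  have N: "real (card (?A v)) \<le> real \<Delta>" "1 \<le> real (card (?A v))" if v: "v \<in> C ` J" for v
  proof -
    have "card (?A v) = card (L ` ?A v)"
      using J(2) by (intro card_image[symmetric]) (auto intro: inj_on_subset)
    also have "\<dots> \<le> card (L ` {k. k < K \<and> C k = v \<and> L k \<in> R})"
      using J(1,3) by (intro card_mono) auto
    also have "\<dots> \<le> \<Delta>" using v sub by (intro \<Delta>) auto
    finally show "real (card (?A v)) \<le> real \<Delta>" by simp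
    have "card (?A v) \<noteq> 0" using v fin by auto
    then show "1 \<le> real (card (?A v))" by simp
  qed
  have leaves: "(\<Sum>k\<in>?A v. real_of_int (c (L k))) \<le> (\<Sum>k\<in>?A v. m (L k)) + real (card (?A v)) * z v" for v
  proof -
    have "(\<Sum>k\<in>?A v. real_of_int (c (L k))) \<le> (\<Sum>k\<in>?A v. m (L k) + z v)"
      using arc by (intro sum_mono) auto
    then show ?thesis by (simp add: sum.distrib)
  qed
  have M0: "0 \<le> (\<Sum>k\<in>?A v. m (L k))" "0 \<le> (\<Sum>k\<in>?A v. real_of_int (q (L k)))" for v
    using mJ q_nonneg by (auto intro!: sum_nonneg)
  \<comment> \<open>Outside \<open>R\<close> both \<open>c\<close> and \<open>q\<close> vanish, so
    the level \<open>z v\<close> is entirely increment.\<close>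
  have outer: "real_of_int (c v) + (\<Sum>k\<in>?A v. real_of_int (c (L k))) \<le> real \<Delta> * (m v + (\<Sum>k\<in>?A v. m (L k)))"
    if v: "v \<in> C ` J" "v \<notin> R" for v
  proof -
    have "c v = 0" "z v = m v" using v by (simp_all add: c_def m_def q_def)
    moreover have "real (card (?A v)) * m v \<le> real \<Delta> * m v"
      using N(1)[OF v(1)] v m0 sub by (intro mult_right_mono) auto
    moreover have "1 * (\<Sum>k\<in>?A v. m (L k)) \<le> real \<Delta> * (\<Sum>k\<in>?A v. m (L k))"
      using N[OF v(1)] M0(1) by (intro mult_right_mono) auto
    ultimately show ?thesis using leaves[of v] by (simp add: algebra_simps)
  qed
  have inner: "real_of_int (c v) + (\<Sum>k\<in>?A v. real_of_int (c (L k))) \<le>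
      (real \<Delta> + 1) * (m v + (\<Sum>k\<in>?A v. m (L k))) + real \<Delta> * (real_of_int (q v) + (\<Sum>k\<in>?A v. real_of_int (q (L k))))"
    if v: "v \<in> C ` J" for v
  proof (cases "v \<in> R")
    case True
    obtain k where k: "k \<in> J" "C k = v" using v by auto
    then have kK: "k < K" using J by auto
    obtain k' where k': "k' < K" "C k' = L k" "L k' = C k" "TC k' = TL k" "TL k' = TC k"
      using reverse_arc[OF kK] by blast
    have "real_of_int (c v) \<le> real_of_int (TL k' + TC k' - q v)"
      unfolding of_int_le_iff by (rule c_le) (use True k k' in auto)
    then have cv: "real_of_int (c v) \<le> m v + m (L k) + q (L k)"
      using J6[rule_format, OF k(1)] k k' by (simp add: m_def)
    have kA: "k \<in> ?A v" using k by simp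
    have s: "m (L k) \<le> (\<Sum>k\<in>?A v. m (L k))" "real_of_int (q (L k)) \<le> (\<Sum>k\<in>?A v. real_of_int (q (L k)))"
      using fin mJ q_nonneg
      by (auto intro!: member_le_sum[OF kA, of "\<lambda>k. m (L k)"] member_le_sum[OF kA, of "\<lambda>k. real_of_int (q (L k))"])
    have vn: "0 \<le> m v" using v m0 sub by auto
    have "real (card (?A v)) * z v \<le> real \<Delta> * z v"
      using N(1)[OF v] vn q_nonneg[of v] by (intro mult_right_mono) (auto simp: m_def)
    also have "\<dots> = real \<Delta> * m v + real \<Delta> * q v" by (simp add: m_def algebra_simps)
    finally have 1: "real (card (?A v)) * z v \<le> real \<Delta> * m v + real \<Delta> * q v" .
    have 2: "1 * (\<Sum>k\<in>?A v. m (L k)) \<le> real \<Delta> * (\<Sum>k\<in>?A v. m (L k))"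
      "1 * (\<Sum>k\<in>?A v. real_of_int (q (L k))) \<le> real \<Delta> * (\<Sum>k\<in>?A v. real_of_int (q (L k)))"
      using N[OF v] M0 by (intro mult_right_mono; simp)+
    show ?thesis using leaves[of v] cv s 1 2 by (simp add: algebra_simps)
  next
    case False
    have "0 \<le> m v" using v m0 sub by auto
    moreover have "0 \<le> real \<Delta> * (real_of_int (q v) + (\<Sum>k\<in>?A v. real_of_int (q (L k))))"
      using M0(2) q_nonneg by (intro mult_nonneg_nonneg add_nonneg_nonneg) auto
    ultimately show ?thesis using outer[OF v False] M0(1)[of v] by (simp add: algebra_simps)
  qed
  note stars = sum_over_stars[OF J(1,2,4)]
  have cs: "(\<Sum>u<n. real_of_int (c u)) = (\<Sum>v\<in>C ` J. real_of_int (c v) + (\<Sum>k\<in>?A v. real_of_int (c (L k))))"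
    unfolding stars[of "\<lambda>u. real_of_int (c u)"]
    by (rule sum.mono_neutral_right) (use sub J(5) in \<open>auto simp: c_def\<close>)
  have ms: "(\<Sum>v\<in>C ` J. m v + (\<Sum>k\<in>?A v. m (L k))) \<le> (\<Sum>u<n. z u - real_of_int (q u))"
    unfolding stars[of m] m_def[symmetric] using sub m0 by (intro sum_mono2) auto
  have qs: "(\<Sum>v\<in>C ` J. real_of_int (q v) + (\<Sum>k\<in>?A v. real_of_int (q (L k)))) \<le> (\<Sum>u<n. real_of_int (q u))"
    unfolding stars[of "\<lambda>u. real_of_int (q u)"] using sub q_nonneg by (intro sum_mono2) auto
  have "(\<Sum>u<n. real_of_int (c u)) \<le> (\<Sum>v\<in>C ` J. (real \<Delta> + 1) * (m v + (\<Sum>k\<in>?A v. m (L k))) +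
      real \<Delta> * (real_of_int (q v) + (\<Sum>k\<in>?A v. real_of_int (q (L k)))))"
    unfolding cs by (rule sum_mono) (rule inner)
  also have "\<dots> = (real \<Delta> + 1) * (\<Sum>v\<in>C ` J. m v + (\<Sum>k\<in>?A v. m (L k))) +
      real \<Delta> * (\<Sum>v\<in>C ` J. real_of_int (q v) + (\<Sum>k\<in>?A v. real_of_int (q (L k))))"
    by (simp only: sum.distrib[of "\<lambda>v. (real \<Delta> + 1) * (m v + (\<Sum>k\<in>?A v. m (L k)))"] sum_distrib_left)
  also have "\<dots> \<le> (real \<Delta> + 1) * (\<Sum>u<n. z u - real_of_int (q u)) + real \<Delta> * (\<Sum>u<n. real_of_int (q u))"
    using ms qs by (intro add_mono mult_left_mono) auto
  finally show "(\<Sum>u<n. real_of_int (c u)) \<le>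
      (real \<Delta> + 1) * (\<Sum>u<n. z u - real_of_int (q u)) + real \<Delta> * (\<Sum>u<n. real_of_int (q u))" .
  assume indep: "\<And>k. k < K \<Longrightarrow> C k \<in> R \<Longrightarrow> L k \<notin> R"
  have "v \<notin> R" if "v \<in> C ` J" for v using that J(1,3) indep by auto
  then have "(\<Sum>u<n. real_of_int (c u)) \<le> (\<Sum>v\<in>C ` J. real \<Delta> * (m v + (\<Sum>k\<in>?A v. m (L k))))"
    unfolding cs using outer by (intro sum_mono) auto
  also have "\<dots> = real \<Delta> * (\<Sum>v\<in>C ` J. m v + (\<Sum>k\<in>?A v. m (L k)))" by (simp only: sum_distrib_left)
  also have "\<dots> \<le> real \<Delta> * (\<Sum>u<n. z u - real_of_int (q u))" using ms by (rule mult_left_mono) simp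
  finally show "(\<Sum>u<n. real_of_int (c u)) \<le> real \<Delta> * (\<Sum>u<n. z u - real_of_int (q u))" .
qed

end

section \<open>The greedy program\<close>

declare run.simps(5) [simp del]

text \<open>The invariant rule for loops. \<open>indep\<close> carries the invariant through the
  reset and the increments of the counter; the frame premise in \<open>step\<close> tells which
  arrays still have their initial contents.\<close>

lemma run_For:
  assumes "x \<notin> writes P" and N: "nat (aval e s) = N"
    and init: "Inv 0 s"
    and indep: "\<And>i t f. Inv i t \<Longrightarrow> Inv i (t(x := f))"
    and step: "\<And>i t. i < N \<Longrightarrow> t x 0 = int i \<Longrightarrow> (\<And>y. y \<notin> writes P \<Longrightarrow> y \<noteq> x \<Longrightarrow> t y = s y) \<Longrightarrow>
      Inv i t \<Longrightarrow> Inv (Suc i) (run P t)"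
  shows "Inv N (run (For x e P) s)"
proof -
  define f where "f = (\<lambda>t. incr x (run P t))"
  define s0 where "s0 = s(x := (s x)(0 := 0))"
  have "Inv i ((f ^^ i) s0) \<and> (f ^^ i) s0 x 0 = int i \<and>
      (\<forall>y. y \<notin> writes P \<longrightarrow> y \<noteq> x \<longrightarrow> (f ^^ i) s0 y = s y)" if "i \<le> N" for i
    using that
  proof (induction i)
    case 0
    have "Inv 0 s0" unfolding s0_def by (rule indep[OF init])
    moreover have "s0 x 0 = int 0" "\<forall>y. y \<notin> writes P \<longrightarrow> y \<noteq> x \<longrightarrow> s0 y = s y"
      by (simp_all add: s0_def)
    ultimately show ?case by (simp only: funpow_0)
  next
    case (Suc i)
    let ?t = "(f ^^ i) s0"
    have IH: "Inv i ?t" "?t x 0 = int i" "\<And>y. y \<notin> writes P \<Longrightarrow> y \<noteq> x \<Longrightarrow> ?t y = s y"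
      using Suc by auto
    have "Inv (Suc i) (run P ?t)" using step[OF _ IH(2) IH(3) IH(1)] Suc.prems by simp
    then have "Inv (Suc i) (f ?t)" unfolding f_def by (rule indep)
    moreover have "f ?t x 0 = int (Suc i)" "\<forall>y. y \<notin> writes P \<longrightarrow> y \<noteq> x \<longrightarrow> f ?t y = s y"
      using IH(2,3) run_frame[of _ P ?t] assms(1) unfolding f_def by simp_all
    ultimately show ?case by (simp only: funpow.simps o_apply)
  qed
  from this[of N] have "Inv N ((f ^^ N) s0)" by simp
  then show ?thesis using N by (simp add: run.simps f_def s0_def)
qed

abbreviation scalar :: "nat \<Rightarrow> aexp" where "scalar x \<equiv> Get x (Const 0)"
abbreviation Le :: "aexp \<Rightarrow> aexp \<Rightarrow> bexp" where "Le a b \<equiv> Neg (Less b a)"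
abbreviation Eq :: "aexp \<Rightarrow> aexp \<Rightarrow> bexp" where "Eq a b \<equiv> Conj (Le a b) (Le b a)"
abbreviation Or :: "bexp \<Rightarrow> bexp \<Rightarrow> bexp" where "Or b d \<equiv> Neg (Conj (Neg b) (Neg d))"
abbreviation node_count :: aexp where "node_count \<equiv> Get 0 (Const 0)"
abbreviation edge_count :: aexp where "edge_count \<equiv> Get 0 (Const 1)"
abbreviation arc_count :: aexp where "arc_count \<equiv> Add edge_count edge_count"

text \<open>
  Arc \<open>k\<close> of the program is the edge \<open>k\<close> with its first end as the centre; arc \<open>m + k\<close> is the same
  edge with its second end as the centre. Arrays 10--13 hold the centres, the leaves and the
  thresholds at the centres and at the leaves, multiplied by the product of all denominators, which
  is stored in array 14. Arrays 8 and 15 hold the current assignment and the gains \<open>G\<close>, arrays 16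
  and 17 the same data after adding the star under consideration, and arrays 18 and 19 after adding
  the best star so far, whose cost and gain are in 20 and 21. Array 24 holds the levels to which the
  arcs raise their leaves. Arrays 25--29 are loop counters.
\<close>

definition other_denoms_prog :: prog where
  "other_denoms_prog =
     Assign 30 (Const 0) (Const 1) ;;
     For 26 edge_count
       (Branch (Eq (scalar 26) (scalar 25)) Nop
         (Assign 30 (Const 0) (Mul (Mul (scalar 30) (Get 4 (scalar 26))) (Get 7 (scalar 26)))))"

definition scale_prog :: prog where
  "scale_prog =
     Assign 14 (Const 0) (Const 1) ;;
     For 25 edge_count
       (Assign 14 (Const 0) (Mul (Mul (scalar 14) (Get 4 (scalar 25))) (Get 7 (scalar 25)))) ;;
     For 25 edge_count
       (Assign 10 (scalar 25) (Get 2 (scalar 25)) ;;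
        Assign 11 (scalar 25) (Get 5 (scalar 25)) ;;
        Assign 10 (Add (scalar 25) edge_count) (Get 5 (scalar 25)) ;;
        Assign 11 (Add (scalar 25) edge_count) (Get 2 (scalar 25)) ;;
        other_denoms_prog ;;
        Assign 12 (scalar 25) (Mul (Mul (scalar 30) (Get 3 (scalar 25))) (Get 7 (scalar 25))) ;;
        Assign 13 (scalar 25) (Mul (Mul (scalar 30) (Get 6 (scalar 25))) (Get 4 (scalar 25))) ;;
        Assign 12 (Add (scalar 25) edge_count) (Get 13 (scalar 25)) ;;
        Assign 13 (Add (scalar 25) edge_count) (Get 12 (scalar 25)))"

text \<open>A negative cell means that nothing has been stored yet.\<close>

definition lower :: "nat \<Rightarrow> aexp \<Rightarrow> aexp \<Rightarrow> prog" where
  "lower x i e = Branch (Or (Less (Get x i) (Const 0)) (Less e (Get x i))) (Assign x i e) Nop"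

definition minima_prog :: prog where
  "minima_prog =
     For 26 arc_count
       (Branch (Eq (Get 11 (scalar 26)) (scalar 25))
         (lower 8 (scalar 25) (Get 13 (scalar 26)) ;;
          lower 15 (scalar 25) (Add (Get 13 (scalar 26)) (Get 12 (scalar 26))))
         Nop)"

definition init_prog :: prog where
  "init_prog =
     For 25 node_count
       (Assign 8 (scalar 25) (Const (-1)) ;;
        Assign 15 (scalar 25) (Const (-1)) ;;
        minima_prog ;;
        Branch (Less (Const 0) (Get 1 (scalar 25)))
          (Assign 15 (scalar 25) (Sub (Get 15 (scalar 25)) (Get 8 (scalar 25))))
          (Assign 8 (scalar 25) (Const 0) ;; Assign 15 (scalar 25) (Const 0)) ;;
        Assign 9 (scalar 25) (scalar 14))"

definition copy_prog :: "nat \<Rightarrow> nat \<Rightarrow> nat \<Rightarrow> nat \<Rightarrow> prog" where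
  "copy_prog x y x' y' = For 25 node_count
     (Assign x' (scalar 25) (Get x (scalar 25)) ;; Assign y' (scalar 25) (Get y (scalar 25)))"

text \<open>Expressions have no maximum, so \<open>raised\<close> is tabulated once per round; array
  8 stays constant while candidates are compared.\<close>

definition raise_prog :: prog where
  "raise_prog = For 25 arc_count
     (Branch (Less (Get 8 (Get 11 (scalar 25))) (Get 13 (scalar 25)))
       (Assign 24 (scalar 25) (Get 13 (scalar 25)))
       (Assign 24 (scalar 25) (Get 8 (Get 11 (scalar 25)))))"

text \<open>A positive cell of array 17 marks a leaf that this star has not reached yet, whose level
  is then overwritten; later parallel arcs may only lower it. Ratios are tested on arrays 8, 15 and
  24, which the loop leaves alone.\<close>

definition star_prog :: prog where
  "star_prog =
    (let v = Get 10 (scalar 27); l = Get 11 (scalar 25); l' = Get 11 (scalar 28) in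
     For 25 arc_count
       (Branch
         (Conj (Eq (Get 10 (scalar 25)) v)
           (Conj (Le (Get 12 (scalar 25)) (Get 16 v))
             (Conj (Less (Const 0) (Get 15 l))
               (Le (Mul (Sub (Get 24 (scalar 25)) (Get 8 l)) (Get 15 l'))
                   (Mul (Sub (Get 24 (scalar 28)) (Get 8 l')) (Get 15 l))))))
         (Branch (Or (Less (Const 0) (Get 17 l)) (Less (Get 24 (scalar 25)) (Get 16 l)))
           (Assign 16 l (Get 24 (scalar 25)) ;; Assign 17 l (Const 0) ;; Assign 17 v (Const 0))
           Nop)
         Nop))"

definition sum_prog :: prog where
  "sum_prog =
     Assign 22 (Const 0) (Const 0) ;;
     Assign 23 (Const 0) (Const 0) ;;
     For 25 node_count
       (Assign 22 (Const 0) (Add (scalar 22) (Sub (Get 16 (scalar 25)) (Get 8 (scalar 25)))) ;;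
        Assign 23 (Const 0) (Add (scalar 23) (Sub (Get 15 (scalar 25)) (Get 17 (scalar 25)))))"

text \<open>The cross products of costs and gains occur only inside the test: as products of
  computed numbers they violate \<open>linear_exp\<close> and could not be stored.\<close>

definition candidate_prog :: prog where
  "candidate_prog =
    copy_prog 8 15 16 17 ;;
    Branch (Less (Get 8 (Get 10 (scalar 27))) (Get 12 (scalar 27)))
      (Assign 16 (Get 10 (scalar 27)) (Get 12 (scalar 27))) Nop ;;
    star_prog ;;
    sum_prog ;;
    Branch (Less (Mul (scalar 22) (scalar 21)) (Mul (scalar 20) (scalar 23)))
      (Assign 20 (Const 0) (scalar 22) ;; Assign 21 (Const 0) (scalar 23) ;; copy_prog 16 17 18 19)
      Nop"

text \<open>The initial cost 1 and gain 0 act as an infinite ratio: against them the test of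
  \<open>candidate_prog\<close> accepts exactly the positive gains. If no candidate passes, the
  copies in arrays 18 and 19 make the round idle.\<close>

definition round_prog :: prog where
  "round_prog =
     raise_prog ;;
     copy_prog 8 15 18 19 ;;
     Assign 20 (Const 0) (Const 1) ;;
     Assign 21 (Const 0) (Const 0) ;;
     For 27 arc_count (For 28 arc_count candidate_prog) ;;
     copy_prog 18 19 8 15"

definition greedy_prog :: prog where
  "greedy_prog = scale_prog ;; init_prog ;; For 29 node_count round_prog"

lemmas prog_defs = other_denoms_prog_def scale_prog_def lower_def minima_prog_def init_prog_def copy_prog_def raise_prog_def star_prog_def
  sum_prog_def candidate_prog_def round_prog_def greedy_prog_def

lemma well_formed_greedy_prog: "well_formed greedy_prog"
  by (simp add: prog_defs input_bound_def Let_def)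

section \<open>The subprograms meet their specifications\<close>

lemma run_copy_prog:
  assumes "s 0 0 = int n" "x' \<notin> {0, x, y, 25}" "y' \<notin> {0, x, y, 25}" "x' \<noteq> y'" "x \<noteq> 25" "y \<noteq> 25" "u < n"
  shows "run (copy_prog x y x' y') s x' (int u) = s x (int u)"
    "run (copy_prog x y x' y') s y' (int u) = s y (int u)"
proof -
  have "\<forall>u<n. run (copy_prog x y x' y') s x' (int u) = s x (int u) \<and>
      run (copy_prog x y x' y') s y' (int u) = s y (int u)"
    unfolding copy_prog_def
  proof (rule run_For[where Inv = "\<lambda>i t. \<forall>u<i. t x' (int u) = s x (int u) \<and> t y' (int u) = s y (int u)"])
    fix i t
    assume "t 25 0 = int i" and fr: "\<And>z. z \<notin> writes (Assign x' (scalar 25) (Get x (scalar 25)) ;;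
        Assign y' (scalar 25) (Get y (scalar 25))) \<Longrightarrow> z \<noteq> 25 \<Longrightarrow> t z = s z"
      and "\<forall>u<i. t x' (int u) = s x (int u) \<and> t y' (int u) = s y (int u)"
    moreover have "t x = s x" "t y = s y" using fr[of x] fr[of y] assms by auto
    ultimately show "\<forall>u<Suc i. run (Assign x' (scalar 25) (Get x (scalar 25)) ;;
        Assign y' (scalar 25) (Get y (scalar 25))) t x' (int u) = s x (int u) \<and>
       run (Assign x' (scalar 25) (Get x (scalar 25)) ;;
        Assign y' (scalar 25) (Get y (scalar 25))) t y' (int u) = s y (int u)"
      using assms by (auto simp: less_Suc_eq)
  qed (use assms in auto)
  then show "run (copy_prog x y x' y') s x' (int u) = s x (int u)"
    "run (copy_prog x y x' y') s y' (int u) = s y (int u)" using assms by auto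
qed

lemma writes_copy_prog: "writes (copy_prog x y x' y') = {25, x', y'}"
  by (auto simp: copy_prog_def)

lemma writes_star_prog: "writes star_prog = {25, 16, 17}"
  by (auto simp: star_prog_def Let_def)

lemma writes_sum_prog: "writes sum_prog = {25, 22, 23}"
  by (auto simp: sum_prog_def)

lemma writes_candidate_prog: "writes candidate_prog = {25, 16, 17, 18, 19, 20, 21, 22, 23}"
  by (auto simp: candidate_prog_def writes_copy_prog writes_star_prog writes_sum_prog)

lemma writes_raise_prog: "writes raise_prog = {25, 24}"
  by (auto simp: raise_prog_def)

lemma writes_round_prog:
  "writes round_prog = {8, 15, 16, 17, 18, 19, 20, 21, 22, 23, 24, 25, 27, 28}"
  by (auto simp: round_prog_def writes_copy_prog writes_raise_prog writes_candidate_prog)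

lemma writes_minima_prog: "writes minima_prog = {8, 15, 26}"
  by (auto simp: minima_prog_def lower_def)

lemma writes_init_prog: "writes init_prog = {8, 9, 15, 25, 26}"
  by (auto simp: init_prog_def writes_minima_prog)

lemma writes_other_denoms_prog: "writes other_denoms_prog = {26, 30}"
  by (auto simp: other_denoms_prog_def)

lemma run_sum_prog:
  assumes "s 0 0 = int n"
  shows "run sum_prog s 22 0 = (\<Sum>u<n. s 16 (int u) - s 8 (int u))"
    "run sum_prog s 23 0 = (\<Sum>u<n. s 15 (int u) - s 17 (int u))"
proof -
  let ?P = "Assign 22 (Const 0) (Add (scalar 22) (Sub (Get 16 (scalar 25)) (Get 8 (scalar 25)))) ;;
        Assign 23 (Const 0) (Add (scalar 23) (Sub (Get 15 (scalar 25)) (Get 17 (scalar 25))))"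
  let ?s = "run (Assign 22 (Const 0) (Const 0) ;; Assign 23 (Const 0) (Const 0)) s"
  have "run (For 25 node_count ?P) ?s 22 0 = (\<Sum>u<n. s 16 (int u) - s 8 (int u)) \<and>
      run (For 25 node_count ?P) ?s 23 0 = (\<Sum>u<n. s 15 (int u) - s 17 (int u))"
  proof (rule run_For[where Inv = "\<lambda>i t. t 22 0 = (\<Sum>u<i. s 16 (int u) - s 8 (int u)) \<and>
      t 23 0 = (\<Sum>u<i. s 15 (int u) - s 17 (int u))"])
    fix i t
    assume "t 25 0 = int i" and fr: "\<And>z. z \<notin> writes ?P \<Longrightarrow> z \<noteq> 25 \<Longrightarrow> t z = ?s z"
      and "t 22 0 = (\<Sum>u<i. s 16 (int u) - s 8 (int u)) \<and> t 23 0 = (\<Sum>u<i. s 15 (int u) - s 17 (int u))"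
    moreover have "t 8 = s 8" "t 15 = s 15" "t 16 = s 16" "t 17 = s 17"
      using fr[of 8] fr[of 15] fr[of 16] fr[of 17] by auto
    ultimately show "run ?P t 22 0 = (\<Sum>u<Suc i. s 16 (int u) - s 8 (int u)) \<and>
        run ?P t 23 0 = (\<Sum>u<Suc i. s 15 (int u) - s 17 (int u))"
      by simp
  qed (use assms in auto)
  then show "run sum_prog s 22 0 = (\<Sum>u<n. s 16 (int u) - s 8 (int u))"
    "run sum_prog s 23 0 = (\<Sum>u<n. s 15 (int u) - s 17 (int u))"
    by (simp_all add: sum_prog_def)
qed

context arc_system
begin

definition loaded :: "state \<Rightarrow> bool" where
  "loaded s \<longleftrightarrow> s 0 0 = int n \<and> s 0 1 + s 0 1 = int K \<and>
     (\<forall>k<K. s 10 (int k) = int (C k) \<and> s 11 (int k) = int (L k) \<and>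
        s 12 (int k) = TC k \<and> s 13 (int k) = TL k)"

lemma loaded_cong:
  "loaded s \<Longrightarrow> t 0 = s 0 \<Longrightarrow> t 10 = s 10 \<Longrightarrow> t 11 = s 11 \<Longrightarrow> t 12 = s 12 \<Longrightarrow> t 13 = s 13 \<Longrightarrow> loaded t"
  by (simp add: loaded_def)

lemma run_raise_prog:
  assumes "loaded s" "k < K"
  shows "run raise_prog s 24 (int k) = raised (\<lambda>u. s 8 (int u)) k"
proof -
  let ?P = "Branch (Less (Get 8 (Get 11 (scalar 25))) (Get 13 (scalar 25)))
       (Assign 24 (scalar 25) (Get 13 (scalar 25)))
       (Assign 24 (scalar 25) (Get 8 (Get 11 (scalar 25))))"
  have "\<forall>k<K. run (For 25 arc_count ?P) s 24 (int k) = raised (\<lambda>u. s 8 (int u)) k"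
  proof (rule run_For[where Inv = "\<lambda>i t. \<forall>k<i. t 24 (int k) = raised (\<lambda>u. s 8 (int u)) k"])
    fix i t
    assume i: "i < K" "t 25 0 = int i" and fr: "\<And>z. z \<notin> writes ?P \<Longrightarrow> z \<noteq> 25 \<Longrightarrow> t z = s z"
      and inv: "\<forall>k<i. t 24 (int k) = raised (\<lambda>u. s 8 (int u)) k"
    have "t 8 = s 8" "t 11 = s 11" "t 13 = s 13" using fr[of 8] fr[of 11] fr[of 13] by auto
    then show "\<forall>k<Suc i. run ?P t 24 (int k) = raised (\<lambda>u. s 8 (int u)) k"
      using i inv assms by (auto simp: less_Suc_eq raised_def loaded_def)
  qed (use assms in \<open>auto simp: loaded_def\<close>)
  then show ?thesis using assms by (simp add: raise_prog_def)
qed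

text \<open>Membership of \<open>\<kappa>\<close> in the set for \<open>Suc \<kappa>\<close> is what
  the outer test in the loop of \<open>star_prog\<close> decides.\<close>

lemma leaf_arcs_Suc:
  "leaf_arcs a G i j (Suc \<kappa>) =
    (if \<kappa> \<in> leaf_arcs a G i j (Suc \<kappa>) then insert \<kappa> (leaf_arcs a G i j \<kappa>) else leaf_arcs a G i j \<kappa>)"
  by (auto simp: leaf_arcs_def less_Suc_eq)

lemma star_Suc_same:
  assumes "\<kappa> \<notin> leaf_arcs a G i j (Suc \<kappa>)"
  shows "star_a a G i j (Suc \<kappa>) = star_a a G i j \<kappa>" "star_G a G i j (Suc \<kappa>) = star_G a G i j \<kappa>"
  using leaf_arcs_Suc[of a G i j \<kappa>] assms by (auto simp: star_a_def star_G_def fun_eq_iff)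

lemma star_a_Suc:
  assumes "\<kappa> \<in> leaf_arcs a G i j (Suc \<kappa>)" "\<kappa> < K"
  shows "star_a a G i j (Suc \<kappa>) = (star_a a G i j \<kappa>)(L \<kappa> :=
      if L \<kappa> \<in> L ` leaf_arcs a G i j \<kappa> then min (raised a \<kappa>) (star_a a G i j \<kappa> (L \<kappa>)) else raised a \<kappa>)"
proof
  fix u
  let ?Q = "leaf_arcs a G i j \<kappa>"
  have Q: "leaf_arcs a G i j (Suc \<kappa>) = insert \<kappa> ?Q" using leaf_arcs_Suc[of a G i j \<kappa>] assms by simp
  have ne: "L \<kappa> \<noteq> C i" using assms C_neq_L[of \<kappa>] by (auto simp: leaf_arcs_def)
  show "star_a a G i j (Suc \<kappa>) u = ((star_a a G i j \<kappa>)(L \<kappa> :=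
      if L \<kappa> \<in> L ` ?Q then min (raised a \<kappa>) (star_a a G i j \<kappa> (L \<kappa>)) else raised a \<kappa>)) u"
  proof (cases "u = L \<kappa>")
    case True
    let ?S = "{k \<in> ?Q. L k = u}"
    have S: "{k \<in> insert \<kappa> ?Q. L k = u} = insert \<kappa> ?S" using True by auto
    have fin: "finite ?S" by simp
    have 1: "star_a a G i j (Suc \<kappa>) u = Min (insert (raised a \<kappa>) (raised a ` ?S))"
      using True ne unfolding star_a_def Q S by simp
    show ?thesis
    proof (cases "u \<in> L ` ?Q")
      case in_Q: True
      then have "?S \<noteq> {}" by auto
      then have "star_a a G i j (Suc \<kappa>) u = min (raised a \<kappa>) (Min (raised a ` ?S))"
        unfolding 1 using fin by (intro Min_insert) auto
      then show ?thesis using True in_Q ne by (simp add: star_a_def)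
    next
      case False
      then have S0: "?S = {}" by auto
      show ?thesis unfolding 1 S0 using True False by simp
    qed
  next
    case False
    then have "{k \<in> insert \<kappa> ?Q. L k = u} = {k \<in> ?Q. L k = u}" by auto
    then show ?thesis using False by (simp add: star_a_def Q)
  qed
qed

lemma star_G_Suc:
  assumes "\<kappa> \<in> leaf_arcs a G i j (Suc \<kappa>)"
  shows "star_G a G i j (Suc \<kappa>) = (star_G a G i j \<kappa>)(L \<kappa> := 0, C i := 0)"
proof -
  have Q: "leaf_arcs a G i j (Suc \<kappa>) = insert \<kappa> (leaf_arcs a G i j \<kappa>)"
    using leaf_arcs_Suc[of a G i j \<kappa>] assms by simp
  show ?thesis by (auto simp: star_G_def Q fun_eq_iff)
qed

lemma run_star_prog:
  assumes s: "loaded s" and ij: "s 27 0 = int i" "s 28 0 = int j" "i < K" "j < K"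
    and a: "\<And>u. s 8 (int u) = a u" and G: "\<And>u. s 15 (int u) = G u"
    and M: "\<And>k. k < K \<Longrightarrow> s 24 (int k) = raised a k"
    and init: "\<And>u. u < n \<Longrightarrow> s 16 (int u) = star_a a G i j 0 u \<and> s 17 (int u) = star_G a G i j 0 u"
  shows "\<forall>u<n. run star_prog s 16 (int u) = star_a a G i j K u \<and>
      run star_prog s 17 (int u) = star_G a G i j K u"
  unfolding star_prog_def Let_def
proof (rule run_For[where Inv = "\<lambda>\<kappa> t. \<forall>u<n. t 16 (int u) = star_a a G i j \<kappa> u \<and>
    t 17 (int u) = star_G a G i j \<kappa> u"], goal_cases)
  case (5 \<kappa> t)
  note fr = 5(3)
  have t: "t 8 = s 8" "t 10 = s 10" "t 11 = s 11" "t 12 = s 12" "t 15 = s 15" "t 24 = s 24"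
      "t 27 = s 27" "t 28 = s 28"
    using fr[of 8] fr[of 10] fr[of 11] fr[of 12] fr[of 15] fr[of 24] fr[of 27] fr[of 28] by auto
  have ev: "t 10 (t 25 0) = int (C \<kappa>)" "t 10 (t 27 0) = int (C i)" "t 11 (t 25 0) = int (L \<kappa>)"
      "t 11 (t 28 0) = int (L j)" "t 12 (t 25 0) = TC \<kappa>" "t 24 (t 25 0) = raised a \<kappa>"
      "t 24 (t 28 0) = raised a j" "t 8 (int (L \<kappa>)) = a (L \<kappa>)" "t 8 (int (L j)) = a (L j)"
      "t 15 (int (L \<kappa>)) = G (L \<kappa>)" "t 15 (int (L j)) = G (L j)"
    using s ij 5(1,2) t a G M by (auto simp: loaded_def)
  have b: "t 16 (int u) = star_a a G i j \<kappa> u" "t 17 (int u) = star_G a G i j \<kappa> u" if "u < n" for u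
    using 5(4) that by auto
  have lt: "C i < n" "L \<kappa> < n" using C_less L_less ij 5(1) by auto
  have bC: "t 16 (int (C i)) = max (a (C i)) (TC i)" using b lt by (simp add: star_a_def)
  have cond: "bval (Conj (Eq (Get 10 (scalar 25)) (Get 10 (scalar 27)))
           (Conj (Le (Get 12 (scalar 25)) (Get 16 (Get 10 (scalar 27))))
             (Conj (Less (Const 0) (Get 15 (Get 11 (scalar 25))))
               (Le (Mul (Sub (Get 24 (scalar 25)) (Get 8 (Get 11 (scalar 25)))) (Get 15 (Get 11 (scalar 28))))
                   (Mul (Sub (Get 24 (scalar 28)) (Get 8 (Get 11 (scalar 28)))) (Get 15 (Get 11 (scalar 25)))))))) t
      \<longleftrightarrow> \<kappa> \<in> leaf_arcs a G i j (Suc \<kappa>)"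
    by (simp add: ev bC leaf_arcs_def not_less) (auto simp: mult.commute)
  show ?case
  proof (cases "\<kappa> \<in> leaf_arcs a G i j (Suc \<kappa>)")
    case False
    then show ?thesis using cond b star_Suc_same[OF False] by (simp del: bval.simps)
  next
    case True
    have Gp: "0 < G (L \<kappa>)" and ne: "L \<kappa> \<noteq> C i"
      using True C_neq_L[OF 5(1)] by (auto simp: leaf_arcs_def)
    have upd: "bval (Or (Less (Const 0) (Get 17 (Get 11 (scalar 25))))
          (Less (Get 24 (scalar 25)) (Get 16 (Get 11 (scalar 25))))) t \<longleftrightarrow>
        L \<kappa> \<notin> L ` leaf_arcs a G i j \<kappa> \<or> raised a \<kappa> < star_a a G i j \<kappa> (L \<kappa>)"
      using lt Gp ne by (auto simp: ev b star_G_def)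
    \<comment> \<open>If the inner test fails, an earlier arc has already reached this leaf at no
      higher level; both gains are 0 by then, so skipping the writes is right.\<close>
    have in_C: "star_G a G i j \<kappa> (C i) = 0" "star_G a G i j \<kappa> (L \<kappa>) = 0"
      if "L \<kappa> \<in> L ` leaf_arcs a G i j \<kappa>"
      using that by (auto simp: star_G_def)
    show ?thesis
      using cond True upd lt in_C
      by (auto simp: ev b star_a_Suc[OF True 5(1)] star_G_Suc[OF True] simp del: bval.simps split: if_splits)
  qed
qed (use s init in \<open>auto simp: loaded_def\<close>)

lemma run_candidate_prog:
  assumes s: "loaded s" and ij: "s 27 0 = int i" "s 28 0 = int j" "i < K" "j < K"
    and a: "\<And>u. s 8 (int u) = a u" and G: "\<And>u. s 15 (int u) = G u"
    and M: "\<And>k. k < K \<Longrightarrow> s 24 (int k) = raised a k"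
  defines "t \<equiv> run candidate_prog s"
  shows "if star_cost a G i j * s 21 0 < s 20 0 * star_gain a G i j
    then t 20 0 = star_cost a G i j \<and> t 21 0 = star_gain a G i j \<and>
      (\<forall>u<n. t 18 (int u) = star_a a G i j K u \<and> t 19 (int u) = star_G a G i j K u)
    else t 18 = s 18 \<and> t 19 = s 19 \<and> t 20 = s 20 \<and> t 21 = s 21"
proof -
  define s1 where "s1 = run (copy_prog 8 15 16 17) s"
  define s2 where "s2 = run (Branch (Less (Get 8 (Get 10 (scalar 27))) (Get 12 (scalar 27)))
      (Assign 16 (Get 10 (scalar 27)) (Get 12 (scalar 27))) Nop) s1"
  define s3 where "s3 = run star_prog s2"
  define s4 where "s4 = run sum_prog s3"
  have n: "s 0 0 = int n" using s by (simp add: loaded_def)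
  have f1: "s1 y = s y" if "y \<notin> {16, 17, 25}" for y
    unfolding s1_def using that by (intro run_frame) (auto simp: writes_copy_prog)
  have f2: "s2 y = s1 y" if "y \<noteq> 16" for y
    unfolding s2_def using that by (intro run_frame) auto
  have f3: "s3 y = s2 y" if "y \<notin> {16, 17, 25}" for y
    unfolding s3_def using that by (intro run_frame) (auto simp: writes_star_prog)
  have f4: "s4 y = s3 y" if "y \<notin> {22, 23, 25}" for y
    unfolding s4_def using that by (intro run_frame) (auto simp: writes_sum_prog)
  have fs: "s4 y = s y" "s3 y = s y" "s2 y = s y" if "y \<notin> {16, 17, 22, 23, 25}" for y
    using that f1 f2 f3 f4 by auto
  have 1: "s1 16 (int u) = a u" "s1 17 (int u) = G u" if "u < n" for u
    unfolding s1_def using that n a G by (simp_all add: run_copy_prog)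
  have lC: "C i < n" using C_less ij by auto
  have e0: "leaf_arcs a G i j 0 = {}" by (simp add: leaf_arcs_def)
  have 2: "s2 16 (int u) = star_a a G i j 0 u \<and> s2 17 (int u) = star_G a G i j 0 u" if "u < n" for u
    using that s ij a 1 lC f1[of 8] f1[of 10] f1[of 12] f1[of 27]
    by (auto simp: s2_def star_a_def star_G_def e0 loaded_def max_def)
  have "loaded s2" by (rule loaded_cong[OF s]) (simp_all add: fs)
  then have 3: "\<forall>u<n. s3 16 (int u) = star_a a G i j K u \<and> s3 17 (int u) = star_G a G i j K u"
    unfolding s3_def by (rule run_star_prog) (use ij a G M 2 in \<open>simp_all add: fs\<close>)
  have "s3 0 0 = int n" by (simp add: fs n)
  then have 4: "s4 22 0 = star_cost a G i j" "s4 23 0 = star_gain a G i j"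
    unfolding s4_def star_cost_def star_gain_def using 3 a G
    by (auto simp: run_sum_prog fs intro!: sum.cong)
  have 5: "s4 16 (int u) = star_a a G i j K u" "s4 17 (int u) = star_G a G i j K u" if "u < n" for u
    using 3 that f4[of 16] f4[of 17] by auto
  let ?copy = "copy_prog 16 17 18 19"
  have t: "t = (if star_cost a G i j * s 21 0 < s 20 0 * star_gain a G i j
    then run ?copy (run (Assign 20 (Const 0) (scalar 22) ;; Assign 21 (Const 0) (scalar 23)) s4)
    else s4)"
  proof -
    have "t = (if bval (Less (Mul (scalar 22) (scalar 21)) (Mul (scalar 20) (scalar 23))) s4
      then run ?copy (run (Assign 20 (Const 0) (scalar 22) ;; Assign 21 (Const 0) (scalar 23)) s4)
      else s4)"
      unfolding t_def candidate_prog_def s4_def s3_def s2_def s1_def by (simp only: run.simps)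
    also have "bval (Less (Mul (scalar 22) (scalar 21)) (Mul (scalar 20) (scalar 23))) s4 \<longleftrightarrow>
        star_cost a G i j * s 21 0 < s 20 0 * star_gain a G i j"
      by (simp add: 4 fs)
    finally show ?thesis .
  qed
  define s5 where "s5 = run (Assign 20 (Const 0) (scalar 22) ;; Assign 21 (Const 0) (scalar 23)) s4"
  have s5: "s5 20 0 = star_cost a G i j" "s5 21 0 = star_gain a G i j" "s5 16 = s4 16" "s5 17 = s4 17"
      "s5 0 0 = int n"
    by (simp_all add: s5_def 4 fs n)
  have "run ?copy s5 20 = s5 20" "run ?copy s5 21 = s5 21"
    by (simp_all add: run_frame writes_copy_prog)
  then show ?thesis
    unfolding t s5_def[symmetric] using s5 5 by (auto simp: run_copy_prog[where s = s5 and n = n, OF s5(5)] fs)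
qed

text \<open>\<open>S\<close> collects the pairs tried so far. The first alternative is the
  artificial ratio of 1 to 0, which persists while no candidate has positive gain.\<close>

definition best_among :: "(nat \<times> nat) set \<Rightarrow> (nat \<Rightarrow> int) \<Rightarrow> (nat \<Rightarrow> int) \<Rightarrow> state \<Rightarrow> bool" where
  "best_among S a G t \<longleftrightarrow>
     (t 20 0 = 1 \<and> t 21 0 = 0 \<and> (\<forall>u<n. t 18 (int u) = a u \<and> t 19 (int u) = G u) \<and>
       (\<forall>(i, j)\<in>S. star_gain a G i j \<le> 0)) \<or>
     (\<exists>i<K. \<exists>j<K. t 20 0 = star_cost a G i j \<and> t 21 0 = star_gain a G i j \<and> 0 < star_gain a G i j \<and>
       (\<forall>u<n. t 18 (int u) = star_a a G i j K u \<and> t 19 (int u) = star_G a G i j K u) \<and>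
       (\<forall>(i', j')\<in>S. star_cost a G i j * star_gain a G i' j' \<le> star_cost a G i' j' * star_gain a G i j))"

text \<open>Chaining two cross-multiplied comparisons needs positive gains, so candidates of gain at
  most 0 are settled by their sign alone.\<close>

lemma best_among_insert:
  assumes best: "best_among S a G s" and ij: "i < K" "j < K"
    and step: "if star_cost a G i j * s 21 0 < s 20 0 * star_gain a G i j
      then t 20 0 = star_cost a G i j \<and> t 21 0 = star_gain a G i j \<and>
        (\<forall>u<n. t 18 (int u) = star_a a G i j K u \<and> t 19 (int u) = star_G a G i j K u)
      else t 18 = s 18 \<and> t 19 = s 19 \<and> t 20 = s 20 \<and> t 21 = s 21"
  shows "best_among (insert (i, j) S) a G t"
proof -
  let ?c = "star_cost a G" and ?g = "star_gain a G"
  note nn = star_cost_nonneg[of a G]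
  have nonpos: "?c i j * x \<le> ?c i' j' * ?g i j" if "x \<le> 0" "0 < ?g i j" for x i' j'
    using that nn by (meson mult_nonneg_nonneg mult_nonneg_nonpos order_less_imp_le order_trans)
  from best consider
    (none) "s 20 0 = 1" "s 21 0 = 0" "\<forall>u<n. s 18 (int u) = a u \<and> s 19 (int u) = G u"
      "\<forall>(i, j)\<in>S. ?g i j \<le> 0" |
    (some) k l where "k < K" "l < K" "s 20 0 = ?c k l" "s 21 0 = ?g k l" "0 < ?g k l"
      "\<forall>u<n. s 18 (int u) = star_a a G k l K u \<and> s 19 (int u) = star_G a G k l K u"
      "\<forall>(i', j')\<in>S. ?c k l * ?g i' j' \<le> ?c i' j' * ?g k l"
    unfolding best_among_def by blast
  then show ?thesis
  proof cases
    case none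
    show ?thesis
    proof (cases "0 < ?g i j")
      case True
      then have t: "t 20 0 = ?c i j" "t 21 0 = ?g i j"
        "\<forall>u<n. t 18 (int u) = star_a a G i j K u \<and> t 19 (int u) = star_G a G i j K u"
        using step none by auto
      have "\<forall>(i', j')\<in>insert (i, j) S. ?c i j * ?g i' j' \<le> ?c i' j' * ?g i j"
        using none(4) nonpos[OF _ True] by auto
      then show ?thesis unfolding best_among_def using t True ij by blast
    next
      case False
      then show ?thesis using step none unfolding best_among_def by auto
    qed
  next
    case some
    show ?thesis
    proof (cases "?c i j * ?g k l < ?c k l * ?g i j")
      case True
      have g: "0 < ?g i j"
      proof (rule ccontr)
        assume "\<not> ?thesis"
        then have "?c k l * ?g i j \<le> 0" using nn[of k l] by (simp add: mult_nonneg_nonpos)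
        moreover have "0 \<le> ?c i j * ?g k l" using nn[of i j] some(5) by simp
        ultimately show False using True by linarith
      qed
      have t: "t 20 0 = ?c i j" "t 21 0 = ?g i j"
        "\<forall>u<n. t 18 (int u) = star_a a G i j K u \<and> t 19 (int u) = star_G a G i j K u"
        using step some True by auto
      have "?c i j * ?g i' j' \<le> ?c i' j' * ?g i j" if "(i', j') \<in> S" for i' j'
      proof (cases "?g i' j' \<le> 0")
        case g': True
        then show ?thesis using nonpos g by blast
      next
        case False
        \<comment> \<open>Transitivity through the former best pair, whose positive gain cancels at
          the end.\<close>
        have "(?c i j * ?g i' j') * ?g k l = (?c i j * ?g k l) * ?g i' j'" by simp
        also have "\<dots> \<le> (?c k l * ?g i j) * ?g i' j'" using True False by (intro mult_right_mono) auto
        also have "\<dots> = (?c k l * ?g i' j') * ?g i j" by simp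
        also have "\<dots> \<le> (?c i' j' * ?g k l) * ?g i j"
          using some(7) that g by (intro mult_right_mono) auto
        finally have "(?c i j * ?g i' j') * ?g k l \<le> (?c i' j' * ?g i j) * ?g k l" by (simp add: mult_ac)
        then show ?thesis using some(5) by (rule mult_right_le_imp_le)
      qed
      then have "\<forall>(i', j')\<in>insert (i, j) S. ?c i j * ?g i' j' \<le> ?c i' j' * ?g i j" by auto
      then show ?thesis unfolding best_among_def using t g ij by blast
    next
      case False
      then have t: "t 18 = s 18" "t 19 = s 19" "t 20 = s 20" "t 21 = s 21" using step some by auto
      have all: "\<forall>(i', j')\<in>insert (i, j) S. ?c k l * ?g i' j' \<le> ?c i' j' * ?g k l"
        using some(7) False by auto
      show ?thesis unfolding best_among_def t
        by (intro disjI2 exI[of _ k] exI[of _ l] conjI all) (use some in auto)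
    qed
  qed
qed

lemma run_round_prog:
  assumes s: "loaded s"
  shows "greedy_step (\<lambda>u. s 8 (int u)) (\<lambda>u. s 15 (int u))
    (\<lambda>u. run round_prog s 8 (int u)) (\<lambda>u. run round_prog s 15 (int u))"
proof -
  define a where "a = (\<lambda>u. s 8 (int u))"
  define G where "G = (\<lambda>u. s 15 (int u))"
  define s1 where "s1 = run raise_prog s"
  define s2 where "s2 = run (copy_prog 8 15 18 19) s1"
  define s3 where "s3 = run (Assign 20 (Const 0) (Const 1) ;; Assign 21 (Const 0) (Const 0)) s2"
  define s4 where "s4 = run (For 27 arc_count (For 28 arc_count candidate_prog)) s3"
  have f1: "s1 y = s y" if "y \<notin> {24, 25}" for y
    unfolding s1_def using that by (intro run_frame) (auto simp: writes_raise_prog)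
  have f2: "s2 y = s1 y" if "y \<notin> {25, 18, 19}" for y
    unfolding s2_def using that by (intro run_frame) (auto simp: writes_copy_prog)
  have f3: "s3 y = s2 y" if "y \<notin> {20, 21}" for y
    unfolding s3_def using that by (intro run_frame) auto
  have f: "s3 y = s y" if "y \<notin> {24, 25, 18, 19, 20, 21}" for y using that f1 f2 f3 by auto
  have n: "s1 0 0 = int n" using s f1[of 0] by (simp add: loaded_def)
  have M: "s3 24 (int k) = raised a k" if "k < K" for k
    using run_raise_prog[OF s that] f2[of 24] f3[of 24] by (simp add: s1_def a_def)
  have c: "s3 18 (int u) = a u" "s3 19 (int u) = G u" if "u < n" for u
    using that f1[of 8] f1[of 15] f3[of 18] f3[of 19] n by (simp_all add: s2_def run_copy_prog a_def G_def)
  have l3: "loaded s3" by (rule loaded_cong[OF s]) (simp_all add: f)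
  have K: "nat (aval arc_count t) = K" if "loaded t" for t using that by (simp add: loaded_def)
  \<comment> \<open>The pairs that precede \<open>(i, j)\<close> lexicographically, which is the
    order of the nested loops.\<close>
  define S where "S i j = {(i', j'). i' < K \<and> j' < K \<and> (i' < i \<or> i' = i \<and> j' < j)}" for i j
  have start: "best_among (S 0 0) a G s3"
    unfolding best_among_def using c by (auto simp: s3_def S_def)
  have inner: "best_among (S (Suc i) 0) a G (run (For 28 arc_count candidate_prog) t)"
    if t: "i < K" "t 27 0 = int i" "best_among (S i 0) a G t"
      "\<And>y. y \<notin> writes (For 28 arc_count candidate_prog) \<Longrightarrow> y \<noteq> 27 \<Longrightarrow> t y = s3 y" for i t
  proof -
    have lt: "loaded t" by (rule loaded_cong[OF l3]) (auto intro!: t(4) simp: writes_candidate_prog)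
    have t8: "t 8 = s3 8" "t 15 = s3 15" "t 24 = s3 24"
      by (auto intro!: t(4) simp: writes_candidate_prog)
    have "best_among (S i K) a G (run (For 28 arc_count candidate_prog) t)"
    proof (rule run_For[where Inv = "\<lambda>j. best_among (S i j) a G"], goal_cases)
      case (5 j r)
      have r: "r y = t y" if "y \<notin> {25, 16, 17, 18, 19, 20, 21, 22, 23, 28}" for y
        using 5(3)[of y] that by (simp add: writes_candidate_prog)
      have "loaded r" by (rule loaded_cong[OF lt]) (simp_all add: r)
      moreover have "r 27 0 = int i" "r 28 0 = int j" using r t(2) 5(2) by auto
      moreover have "r 8 (int u) = a u" "r 15 (int u) = G u" for u
        using r[of 8] r[of 15] t8 f[of 8] f[of 15] by (simp_all add: a_def G_def)
      moreover have "r 24 (int k) = raised a k" if "k < K" for k using M[OF that] r[of 24] t8 by simp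
      ultimately have "best_among (insert (i, j) (S i j)) a G (run candidate_prog r)"
        using 5(1,4) t(1) by (intro best_among_insert[OF _ _ _ run_candidate_prog]) auto
      moreover have "insert (i, j) (S i j) = S i (Suc j)" using 5(1) t(1) by (auto simp: S_def)
      ultimately show ?case by simp
    next
      case 2
      show ?case by (rule K[OF lt])
    qed (use t(3) in \<open>simp_all add: writes_candidate_prog best_among_def\<close>)
    moreover have "S i K = S (Suc i) 0" using t(1) by (auto simp: S_def less_Suc_eq)
    ultimately show ?thesis by simp
  qed
  have best: "best_among (S K 0) a G s4"
    unfolding s4_def
  proof (rule run_For[where Inv = "\<lambda>i. best_among (S i 0) a G"], goal_cases)
    case (5 i t)
    show ?case by (rule inner[OF 5(1,2,4) 5(3)])
  next
    case 2
    show ?case by (rule K[OF l3])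
  qed (use start in \<open>simp_all add: writes_candidate_prog best_among_def\<close>)
  have n4: "s4 0 0 = int n"
    using l3 unfolding s4_def by (subst run_frame) (auto simp: writes_candidate_prog loaded_def)
  have "run round_prog s = run (copy_prog 18 19 8 15) s4"
    by (simp add: round_prog_def s4_def s3_def s2_def s1_def)
  then have fin: "run round_prog s 8 (int u) = s4 18 (int u)" "run round_prog s 15 (int u) = s4 19 (int u)"
    if "u < n" for u using that n4 by (simp_all add: run_copy_prog)
  have S: "(i, j) \<in> S K 0" if "i < K" "j < K" for i j using that by (simp add: S_def)
  show ?thesis
    using best S unfolding best_among_def greedy_step_def a_def[symmetric] G_def[symmetric]
    by (auto simp: fin) (blast+)?
qed

theorem run_rounds:
  assumes s: "loaded s" and q: "\<forall>u<n. s 8 (int u) = q u \<and> s 15 (int u) = c u"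
  defines "t \<equiv> run (For 29 node_count round_prog) s"
  shows "\<And>u. u \<in> R \<Longrightarrow> \<exists>k<K. L k = u \<and> TL k \<le> t 8 (int u) \<and> TC k \<le> t 8 (int (C k))"
    and "\<And>u. u < n \<Longrightarrow> q u \<le> t 8 (int u)"
    and "\<And>z. cover z \<Longrightarrow> (\<Sum>u<n. real_of_int (t 8 (int u))) \<le>
      (\<Sum>u<n. real_of_int (q u)) + potential (\<Sum>u<n. z u - real_of_int (q u)) (\<Sum>u<n. real_of_int (c u))"
proof -
  let ?pot = "\<lambda>z G. potential (\<Sum>u<n. z u - real_of_int (q u)) (\<Sum>u<n. real_of_int (G u))"
  \<comment> \<open>At most \<open>n - r\<close> terminals are uncovered after \<open>r\<close>
    rounds, hence none after \<open>n\<close>.\<close>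
  define Inv where "Inv = (\<lambda>r (t::state). let a = \<lambda>u. t 8 (int u); G = \<lambda>u. t 15 (int u) in
    partial_cover a G \<and> card {u. u < n \<and> 0 < G u} \<le> n - r \<and>
    (\<forall>z. cover z \<longrightarrow> (\<Sum>u<n. real_of_int (a u)) + ?pot z G \<le> (\<Sum>u<n. real_of_int (q u)) + ?pot z c))"
  have "Inv n t"
    unfolding t_def
  proof (rule run_For[where Inv = Inv], goal_cases)
    case 3
    have "partial_cover (\<lambda>u. s 8 (int u)) (\<lambda>u. s 15 (int u))"
      by (rule partial_cover_cong[OF partial_cover_init]) (use q in auto)
    moreover have "card {u. u < n \<and> 0 < s 15 (int u)} \<le> card {..<n}" by (rule card_mono) auto
    moreover have "(\<Sum>u<n. real_of_int (s 8 (int u))) = (\<Sum>u<n. real_of_int (q u))"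
      "(\<Sum>u<n. real_of_int (s 15 (int u))) = (\<Sum>u<n. real_of_int (c u))"
      using q by (auto intro!: sum.cong)
    ultimately show ?case by (simp add: Inv_def Let_def)
  next
    case (5 r t)
    have lt: "loaded t" by (rule loaded_cong[OF s]) (auto intro!: 5(3) simp: writes_round_prog)
    note prog = greedy_step_progress[OF _ run_round_prog[OF lt]]
    from 5(4) have i: "partial_cover (\<lambda>u. t 8 (int u)) (\<lambda>u. t 15 (int u))"
      "card {u. u < n \<and> 0 < t 15 (int u)} \<le> n - r"
      and z: "\<And>z. cover z \<Longrightarrow> (\<Sum>u<n. real_of_int (t 8 (int u))) + ?pot z (\<lambda>u. t 15 (int u))
        \<le> (\<Sum>u<n. real_of_int (q u)) + ?pot z c"
      by (auto simp: Inv_def Let_def)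
    show ?case unfolding Inv_def Let_def
      using prog(1)[OF i(1)] prog(2)[OF i(1)] i(2) prog(3)[OF i(1)] z by (fastforce intro: order_trans)
  qed (use s in \<open>auto simp: writes_round_prog loaded_def Inv_def Let_def\<close>)
  then have pc: "partial_cover (\<lambda>u. t 8 (int u)) (\<lambda>u. t 15 (int u))"
    and card: "card {u. u < n \<and> 0 < t 15 (int u)} = 0"
    and z: "\<And>z. cover z \<Longrightarrow> (\<Sum>u<n. real_of_int (t 8 (int u))) + ?pot z (\<lambda>u. t 15 (int u))
        \<le> (\<Sum>u<n. real_of_int (q u)) + ?pot z c"
    by (auto simp: Inv_def Let_def)
  have "{u. u < n \<and> 0 < t 15 (int u)} = {}" using card by simp
  then have G0: "t 15 (int u) = 0" if "u < n" for u
    using partial_cover_G(1)[OF pc that] that by force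
  show "\<exists>k<K. L k = u \<and> TL k \<le> t 8 (int u) \<and> TC k \<le> t 8 (int (C k))" if "u \<in> R" for u
    using pc G0[of u] that R_subset unfolding partial_cover_def by auto
  show "q u \<le> t 8 (int u)" if "u < n" for u using pc that by (simp add: partial_cover_def)
  fix z assume cz: "cover z"
  \<comment> \<open>With a nonnegative budget, \<open>potential\<close> at 0 falls into its first
    branch and vanishes.\<close>
  have "0 \<le> (\<Sum>u<n. z u - real_of_int (q u))" using cover_ge_q[OF cz] by (intro sum_nonneg) simp
  then have "?pot z (\<lambda>u. t 15 (int u)) = 0" using G0 by (simp add: potential_def)
  then show "(\<Sum>u<n. real_of_int (t 8 (int u))) \<le> (\<Sum>u<n. real_of_int (q u)) + ?pot z c"
    using z[OF cz] by linarith
qed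

end

context arc_system
begin

text \<open>The value \<open>-1\<close> stands for the minimum of the empty set; the true minima are nonnegative.\<close>

definition leaf_min :: "(nat \<Rightarrow> int) \<Rightarrow> nat \<Rightarrow> nat \<Rightarrow> int" where
  "leaf_min f u \<kappa> = (if \<exists>k<\<kappa>. L k = u then Min (f ` {k. k < \<kappa> \<and> L k = u}) else -1)"

text \<open>Nonnegative values make a negative \<open>leaf_min\<close> equivalent to having seen no
  arc, which is how the guard of \<open>lower\<close> reads it.\<close>

lemma leaf_min_Suc:
  assumes "\<kappa> < K" "\<And>k. k < K \<Longrightarrow> 0 \<le> f k"
  shows "leaf_min f u (Suc \<kappa>) = (if L \<kappa> = u \<and> (leaf_min f u \<kappa> < 0 \<or> f \<kappa> < leaf_min f u \<kappa>)
    then f \<kappa> else leaf_min f u \<kappa>)"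
proof (cases "L \<kappa> = u")
  case True
  let ?A = "{k. k < \<kappa> \<and> L k = u}"
  have A: "{k. k < Suc \<kappa> \<and> L k = u} = insert \<kappa> ?A" using True by (auto simp: less_Suc_eq)
  have ex: "\<exists>k<Suc \<kappa>. L k = u" using True by blast
  show ?thesis
  proof (cases "\<exists>k<\<kappa>. L k = u")
    case ne: True
    then have nonempty: "f ` ?A \<noteq> {}" by auto
    have eq: "leaf_min f u \<kappa> = Min (f ` ?A)" unfolding leaf_min_def if_P[OF ne] by (rule refl)
    have "0 \<le> leaf_min f u \<kappa>" unfolding eq using ne assms by (subst Min_ge_iff) auto
    moreover have "leaf_min f u (Suc \<kappa>) = min (f \<kappa>) (leaf_min f u \<kappa>)"
      unfolding eq unfolding leaf_min_def if_P[OF ex] A image_insert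
      using nonempty by (intro Min_insert) auto
    ultimately show ?thesis using True by auto
  next
    case False
    then have empty: "?A = {}" by auto
    have "Min (f ` {k. k < Suc \<kappa> \<and> L k = u}) = f \<kappa>" unfolding A empty by simp
    then show ?thesis using False True ex by (auto simp: leaf_min_def)
  qed
next
  case False
  then have "{k. k < Suc \<kappa> \<and> L k = u} = {k. k < \<kappa> \<and> L k = u}"
    "(\<exists>k<Suc \<kappa>. L k = u) \<longleftrightarrow> (\<exists>k<\<kappa>. L k = u)" by (auto simp: less_Suc_eq)
  then show ?thesis using False by (auto simp: leaf_min_def)
qed

lemma run_lower:
  "run (lower x i e) s = (if s x (aval i s) < 0 \<or> aval e s < s x (aval i s)
    then s(x := (s x)(aval i s := aval e s)) else s)"
  by (simp add: lower_def)

lemma run_minima_prog: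
  assumes s: "loaded s" "s 25 0 = int u" "s 8 (int u) = -1" "s 15 (int u) = -1"
  shows "run minima_prog s 8 = (s 8)(int u := leaf_min TL u K) \<and>
    run minima_prog s 15 = (s 15)(int u := leaf_min (\<lambda>k. TL k + TC k) u K)"
  unfolding minima_prog_def
proof (rule run_For[where Inv = "\<lambda>\<kappa> t. t 8 = (s 8)(int u := leaf_min TL u \<kappa>) \<and>
    t 15 = (s 15)(int u := leaf_min (\<lambda>k. TL k + TC k) u \<kappa>)"], goal_cases)
  case (5 \<kappa> t)
  have t: "t 11 = s 11" "t 12 = s 12" "t 13 = s 13" "t 25 = s 25"
    using 5(3)[of 11] 5(3)[of 12] 5(3)[of 13] 5(3)[of 25] by (simp_all add: lower_def)
  have ev: "t 11 (t 26 0) = int (L \<kappa>)" "t 12 (t 26 0) = TC \<kappa>" "t 13 (t 26 0) = TL \<kappa>" "t 25 0 = int u"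
    using 5(1,2) s t by (auto simp: loaded_def)
  have m: "leaf_min f u (Suc \<kappa>) = (if L \<kappa> = u \<and> (leaf_min f u \<kappa> < 0 \<or> f \<kappa> < leaf_min f u \<kappa>)
      then f \<kappa> else leaf_min f u \<kappa>)" if "f \<in> {TL, \<lambda>k. TL k + TC k}" for f
    using that TL_nonneg TC_nonneg by (intro leaf_min_Suc[OF 5(1)]) auto
  show ?case
  proof (cases "L \<kappa> = u")
    case False
    then show ?thesis using 5(4) by (auto simp: ev m)
  next
    case True
    define t1 where "t1 = run (lower 8 (scalar 25) (Get 13 (scalar 26))) t"
    have t8: "t 8 (int u) = leaf_min TL u \<kappa>" "t 15 (int u) = leaf_min (\<lambda>k. TL k + TC k) u \<kappa>"
      using 5(4) by simp_all
    have t1: "t1 8 = (s 8)(int u := leaf_min TL u (Suc \<kappa>))" "t1 y = t y" if "y \<noteq> 8" for y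
      using 5(4) True that unfolding t1_def run_lower by (simp_all add: ev t8 m)
    have "run (lower 15 (scalar 25) (Add (Get 13 (scalar 26)) (Get 12 (scalar 26)))) t1 8 = t1 8"
      by (rule run_frame) (simp add: lower_def)
    moreover have "run (lower 15 (scalar 25) (Add (Get 13 (scalar 26)) (Get 12 (scalar 26)))) t1 15 =
        (s 15)(int u := leaf_min (\<lambda>k. TL k + TC k) u (Suc \<kappa>))"
      using 5(4) True unfolding run_lower by (simp add: ev t8 t1(2) m)
    \<comment> \<open>The premise \<open>y \<noteq> 8\<close> is attached to both facts of
      \<open>t1\<close>; for the first one it is vacuous, hence the arbitrary instance 0.\<close>
    ultimately show ?thesis using True t1(1)[of 0] by (simp add: ev flip: t1_def)
  qed
next
  case 3
  show ?case using s by (auto simp: leaf_min_def fun_eq_iff)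
qed (use s in \<open>auto simp: lower_def loaded_def\<close>)

lemma run_init_prog:
  assumes s: "loaded s" and R: "\<And>u. u < n \<Longrightarrow> 0 < s 1 (int u) \<longleftrightarrow> u \<in> R"
  shows "\<forall>u<n. run init_prog s 8 (int u) = q u \<and> run init_prog s 15 (int u) = c u \<and>
    run init_prog s 9 (int u) = s 14 0"
  unfolding init_prog_def
proof (rule run_For[where Inv = "\<lambda>i t. \<forall>u<i. t 8 (int u) = q u \<and> t 15 (int u) = c u \<and>
    t 9 (int u) = s 14 0"], goal_cases)
  case (5 i t)
  define t1 where "t1 = run (Assign 8 (scalar 25) (Const (-1)) ;; Assign 15 (scalar 25) (Const (-1))) t"
  define t2 where "t2 = run minima_prog t1"
  have t: "t y = s y" if "y \<notin> {8, 9, 15, 25, 26}" for y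
    using 5(3)[of y] that by (simp add: writes_minima_prog)
  have f2: "t2 y = t1 y" if "y \<notin> {8, 15, 26}" for y
    unfolding t2_def using that by (intro run_frame) (simp add: writes_minima_prog)
  have "loaded t" by (rule loaded_cong[OF s]) (simp_all add: t)
  then have "loaded t1" by (rule loaded_cong) (simp_all add: t1_def)
  then have m: "t2 8 = (t1 8)(int i := leaf_min TL i K)"
    "t2 15 = (t1 15)(int i := leaf_min (\<lambda>k. TL k + TC k) i K)"
    using run_minima_prog[of t1 i] 5(2) by (simp_all add: t1_def t2_def)
  have t2: "t2 (Suc 0) = s (Suc 0)" "t2 14 = s 14" "t2 25 0 = int i" "t2 9 = t 9"
    using f2[of 1] f2[of 14] f2[of 25] f2[of 9] t[of 1] t[of 14] 5(2) by (simp_all add: t1_def)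
  have old: "t2 8 (int u) = t 8 (int u)" "t2 15 (int u) = t 15 (int u)" if "u < i" for u
    using that 5(2) by (simp_all add: m t1_def)
  have new: "i \<in> R \<Longrightarrow> leaf_min TL i K = q i \<and> leaf_min (\<lambda>k. TL k + TC k) i K - q i = c i"
    "i \<notin> R \<Longrightarrow> q i = 0 \<and> c i = 0"
    using terminal_arc[of i] by (auto simp: leaf_min_def q_def c_def)
  have split: "run (Assign 8 (scalar 25) (Const (-1)) ;; Assign 15 (scalar 25) (Const (-1)) ;;
      minima_prog ;; P) t = run P t2" for P
    by (simp add: t2_def t1_def)
  show ?case
    unfolding split using 5(4) R[OF 5(1)] new old
    by (auto simp: t2 m less_Suc_eq)
qed (use s in \<open>auto simp: writes_minima_prog loaded_def\<close>)

end

section \<open>Instances as systems of arcs\<close>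

definition arc_edge :: "aec \<Rightarrow> nat \<Rightarrow> edge" where
  "arc_edge I k = (if k < length (edges I) then edges I ! k else edges I ! (k - length (edges I)))"

definition arc_centre :: "aec \<Rightarrow> nat \<Rightarrow> nat" where
  "arc_centre I k = (if k < length (edges I) then end1 (arc_edge I k) else end2 (arc_edge I k))"

definition arc_leaf :: "aec \<Rightarrow> nat \<Rightarrow> nat" where
  "arc_leaf I k = (if k < length (edges I) then end2 (arc_edge I k) else end1 (arc_edge I k))"

definition denoms :: "aec \<Rightarrow> nat \<Rightarrow> int" where
  "denoms I k = denom (thr1 (edges I ! k)) * denom (thr2 (edges I ! k))"

definition common_denom :: "aec \<Rightarrow> int" where
  "common_denom I = (\<Prod>k<length (edges I). denoms I k)"

text \<open>The machine cannot divide. Instead of dividing the common denominator by that of edge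
  \<open>k\<close>, the product over the other edges is formed anew, so that every product has an
  input number as a factor.\<close>

definition scaled1 :: "aec \<Rightarrow> nat \<Rightarrow> int" where
  "scaled1 I k = (\<Prod>j\<in>{..<length (edges I)} - {k}. denoms I j) *
     numer (thr1 (edges I ! k)) * denom (thr2 (edges I ! k))"

definition scaled2 :: "aec \<Rightarrow> nat \<Rightarrow> int" where
  "scaled2 I k = (\<Prod>j\<in>{..<length (edges I)} - {k}. denoms I j) *
     numer (thr2 (edges I ! k)) * denom (thr1 (edges I ! k))"

definition arc_tc :: "aec \<Rightarrow> nat \<Rightarrow> int" where
  "arc_tc I k = (if k < length (edges I) then scaled1 I k else scaled2 I (k - length (edges I)))"

definition arc_tl :: "aec \<Rightarrow> nat \<Rightarrow> int" where
  "arc_tl I k = (if k < length (edges I) then scaled2 I k else scaled1 I (k - length (edges I)))"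

abbreviation arcs :: "aec \<Rightarrow> nat" where
  "arcs I \<equiv> length (edges I) + length (edges I)"

lemma denom_pos: "0 < denom r"
  by (simp add: denom_def quotient_of_denom_pos')

lemma of_rat_numer_denom: "real_of_rat r = real_of_int (numer r) / real_of_int (denom r)"
proof -
  have "quotient_of r = (numer r, denom r)" by (simp add: numer_def denom_def)
  then have "r = of_int (numer r) / of_int (denom r)" by (rule quotient_of_div)
  then have "real_of_rat r = real_of_rat (of_int (numer r) / of_int (denom r))" by simp
  then show ?thesis by (simp add: of_rat_divide)
qed

lemma denoms_pos: "0 < denoms I k"
  by (simp add: denoms_def denom_pos)

lemma common_denom_pos: "0 < common_denom I"
  unfolding common_denom_def by (intro prod_pos) (simp add: denoms_pos)

lemma scaled_eq:
  assumes "k < length (edges I)"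
  shows "real_of_int (scaled1 I k) = common_denom I * real_of_rat (thr1 (edges I ! k))"
    "real_of_int (scaled2 I k) = common_denom I * real_of_rat (thr2 (edges I ! k))"
proof -
  let ?P = "\<Prod>j\<in>{..<length (edges I)} - {k}. denoms I j"
  let ?d1 = "real_of_int (denom (thr1 (edges I ! k)))" and ?d2 = "real_of_int (denom (thr2 (edges I ! k)))"
  have "common_denom I = denoms I k * ?P"
    unfolding common_denom_def using assms by (subst prod.remove[of _ k]) auto
  then have D: "real_of_int (common_denom I) = (?d1 * ?d2) * real_of_int ?P"
    by (simp add: denoms_def)
  have d: "?d1 \<noteq> 0" "?d2 \<noteq> 0"
    using denom_pos[of "thr1 (edges I ! k)"] denom_pos[of "thr2 (edges I ! k)"] by auto
  show "real_of_int (scaled1 I k) = common_denom I * real_of_rat (thr1 (edges I ! k))"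
    "real_of_int (scaled2 I k) = common_denom I * real_of_rat (thr2 (edges I ! k))"
    unfolding D scaled1_def scaled2_def of_rat_numer_denom using d by (simp_all add: field_simps)
qed

lemma arc_props:
  assumes "aec_instance I" "k < arcs I"
  shows "arc_edge I k \<in> set (edges I)" "ends (arc_edge I k) = {arc_centre I k, arc_leaf I k}"
    "arc_centre I k \<noteq> arc_leaf I k" "arc_centre I k < num_nodes I" "arc_leaf I k < num_nodes I"
    "real_of_int (arc_tc I k) = common_denom I * thr (arc_edge I k) (arc_centre I k)"
    "real_of_int (arc_tl I k) = common_denom I * thr (arc_edge I k) (arc_leaf I k)"
    "0 \<le> arc_tc I k" "0 \<le> arc_tl I k"
proof -
  show e: "arc_edge I k \<in> set (edges I)" using assms(2) by (auto simp: arc_edge_def)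
  then have i: "ends (arc_edge I k) \<subseteq> nodes I" "end1 (arc_edge I k) \<noteq> end2 (arc_edge I k)"
    "0 \<le> thr1 (arc_edge I k)" "0 \<le> thr2 (arc_edge I k)"
    using assms(1) by (auto simp: aec_instance_def)
  show "ends (arc_edge I k) = {arc_centre I k, arc_leaf I k}"
    "arc_centre I k \<noteq> arc_leaf I k" "arc_centre I k < num_nodes I" "arc_leaf I k < num_nodes I"
    using i by (auto simp: arc_centre_def arc_leaf_def ends_def nodes_def)
  show tc: "real_of_int (arc_tc I k) = common_denom I * thr (arc_edge I k) (arc_centre I k)"
    and tl: "real_of_int (arc_tl I k) = common_denom I * thr (arc_edge I k) (arc_leaf I k)"
    using i(2) assms(2) scaled_eq[of k I] scaled_eq[of "k - length (edges I)" I]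
    by (auto simp: arc_tc_def arc_tl_def arc_centre_def arc_leaf_def thr_def arc_edge_def)
  have "0 \<le> thr (arc_edge I k) v" for v using i by (simp add: thr_def)
  then have "0 \<le> real_of_int (arc_tc I k)" "0 \<le> real_of_int (arc_tl I k)"
    unfolding tc tl using common_denom_pos[of I] by simp_all
  then show "0 \<le> arc_tc I k" "0 \<le> arc_tl I k" by simp_all
qed

lemma arc_exists:
  assumes "e \<in> set (edges I)" "u \<in> ends e"
  shows "\<exists>k<arcs I. arc_edge I k = e \<and> arc_leaf I k = u"
proof -
  obtain j where j: "j < length (edges I)" "e = edges I ! j" using assms by (auto simp: in_set_conv_nth)
  from assms(2) consider "u = end1 e" | "u = end2 e" by (auto simp: ends_def)
  then show ?thesis
  proof cases
    case 1
    then show ?thesis using j by (intro exI[of _ "j + length (edges I)"]) (auto simp: arc_edge_def arc_leaf_def)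
  next
    case 2
    then show ?thesis using j by (intro exI[of _ j]) (auto simp: arc_edge_def arc_leaf_def)
  qed
qed

lemma arc_system_of_instance:
  assumes "aec_instance I" "solvable I"
  shows "arc_system (num_nodes I) (arcs I) (arc_centre I) (arc_leaf I) (arc_tc I) (arc_tl I) (terminals I)"
proof
  show "terminals I \<subseteq> {..<num_nodes I}" using assms by (auto simp: aec_instance_def nodes_def)
  \<comment> \<open>Solvability enters here: a feasible assignment activates an edge at every
    terminal.\<close>
  show "\<exists>k<arcs I. arc_leaf I k = u" if u: "u \<in> terminals I" for u
  proof -
    obtain a where "feasible I a" using assms(2) by (auto simp: solvable_def)
    then obtain e where "e \<in> set (edges I)" "u \<in> ends e"
      using u by (auto simp: feasible_def activated_def)
    then show ?thesis using arc_exists by blast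
  qed
  show "\<exists>k'<arcs I. arc_centre I k' = arc_leaf I k \<and> arc_leaf I k' = arc_centre I k \<and>
      arc_tc I k' = arc_tl I k \<and> arc_tl I k' = arc_tc I k" if "k < arcs I" for k
  proof (cases "k < length (edges I)")
    case True
    then show ?thesis by (intro exI[of _ "k + length (edges I)"])
      (auto simp: arc_centre_def arc_leaf_def arc_tc_def arc_tl_def arc_edge_def)
  next
    case False
    then show ?thesis using that by (intro exI[of _ "k - length (edges I)"])
      (auto simp: arc_centre_def arc_leaf_def arc_tc_def arc_tl_def arc_edge_def)
  qed
qed (use assms in \<open>auto simp: arc_props\<close>)

lemma input_state_simps:
  "input_state I 0 0 = int (num_nodes I)" "input_state I 0 1 = int (length (edges I))"
  "k < num_nodes I \<Longrightarrow> input_state I 1 (int k) = (if k \<in> terminals I then 1 else 0)"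
  "k < length (edges I) \<Longrightarrow> input_state I 2 (int k) = int (end1 (edges I ! k))"
  "k < length (edges I) \<Longrightarrow> input_state I 3 (int k) = numer (thr1 (edges I ! k))"
  "k < length (edges I) \<Longrightarrow> input_state I 4 (int k) = denom (thr1 (edges I ! k))"
  "k < length (edges I) \<Longrightarrow> input_state I 5 (int k) = int (end2 (edges I ! k))"
  "k < length (edges I) \<Longrightarrow> input_state I 6 (int k) = numer (thr2 (edges I ! k))"
  "k < length (edges I) \<Longrightarrow> input_state I 7 (int k) = denom (thr2 (edges I ! k))"
  by (simp_all add: input_state_def input_arrays_def array_of_list_def numeral_nat)

lemma run_other_denoms_prog:
  assumes "s 0 1 = int m" "s 25 0 = int k"
  shows "run other_denoms_prog s 30 0 = (\<Prod>j\<in>{..<m} - {k}. s 4 (int j) * s 7 (int j))"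
  unfolding other_denoms_prog_def run.simps(3)
proof (rule run_For[where Inv = "\<lambda>i t. t 30 0 = (\<Prod>j\<in>{..<i} - {k}. s 4 (int j) * s 7 (int j))"], goal_cases)
  case (5 i t)
  have t: "t 4 = s 4" "t 7 = s 7" "t 25 = s 25" using 5(3)[of 4] 5(3)[of 7] 5(3)[of 25] by simp_all
  have "{..<Suc i} - {k} = (if i = k then {..<i} - {k} else insert i ({..<i} - {k}))"
    by (auto simp: less_Suc_eq)
  then show ?case using 5(2,4) assms by (auto simp: t mult_ac)
qed (use assms in auto)

lemma run_scale_prog:
  fixes I :: aec
  defines "t \<equiv> run scale_prog (input_state I)"
  shows "t 14 0 = common_denom I"
    and "k < arcs I \<Longrightarrow> t 10 (int k) = int (arc_centre I k) \<and> t 11 (int k) = int (arc_leaf I k) \<and>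
      t 12 (int k) = arc_tc I k \<and> t 13 (int k) = arc_tl I k"
proof -
  let ?s = "input_state I" and ?m = "length (edges I)"
  define s1 where "s1 = run (For 25 edge_count
       (Assign 14 (Const 0) (Mul (Mul (scalar 14) (Get 4 (scalar 25))) (Get 7 (scalar 25)))))
       (run (Assign 14 (Const 0) (Const 1)) ?s)"
  let ?B = "Assign 10 (scalar 25) (Get 2 (scalar 25)) ;;
        Assign 11 (scalar 25) (Get 5 (scalar 25)) ;;
        Assign 10 (Add (scalar 25) edge_count) (Get 5 (scalar 25)) ;;
        Assign 11 (Add (scalar 25) edge_count) (Get 2 (scalar 25)) ;;
        other_denoms_prog ;;
        Assign 12 (scalar 25) (Mul (Mul (scalar 30) (Get 3 (scalar 25))) (Get 7 (scalar 25))) ;;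
        Assign 13 (scalar 25) (Mul (Mul (scalar 30) (Get 6 (scalar 25))) (Get 4 (scalar 25))) ;;
        Assign 12 (Add (scalar 25) edge_count) (Get 13 (scalar 25)) ;;
        Assign 13 (Add (scalar 25) edge_count) (Get 12 (scalar 25))"
  have t: "t = run (For 25 edge_count ?B) s1"
    by (simp add: t_def scale_prog_def s1_def)
  have D: "s1 14 0 = common_denom I"
    unfolding s1_def common_denom_def
  proof (rule run_For[where Inv = "\<lambda>i t. t 14 0 = (\<Prod>j<i. denoms I j)"], goal_cases)
    case (5 i t)
    have "t 4 = ?s 4" "t 7 = ?s 7" using 5(3)[of 4] 5(3)[of 7] by simp_all
    then show ?case using 5(1,2,4) by (simp add: input_state_simps denoms_def)
  qed (auto simp: input_state_simps)
  have s1: "s1 y = ?s y" if "y < 8" for y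
    unfolding s1_def using that by (simp add: run_frame)
  define good where "good t k \<longleftrightarrow> t 10 (int k) = int (end1 (edges I ! k)) \<and>
      t 11 (int k) = int (end2 (edges I ! k)) \<and> t 12 (int k) = scaled1 I k \<and> t 13 (int k) = scaled2 I k \<and>
      t 10 (int (k + ?m)) = int (end2 (edges I ! k)) \<and> t 11 (int (k + ?m)) = int (end1 (edges I ! k)) \<and>
      t 12 (int (k + ?m)) = scaled2 I k \<and> t 13 (int (k + ?m)) = scaled1 I k" for t :: state and k
  have "\<forall>k<?m. good t k"
    unfolding t
  proof (rule run_For[where Inv = "\<lambda>i t. \<forall>k<i. good t k"], goal_cases)
    case (5 i t)
    have ti: "t y = ?s y" if "y < 8" for y
      using 5(3)[of y] s1[OF that] that by (simp add: writes_other_denoms_prog)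
    have t0: "t 0 (Suc 0) = int ?m" "t 0 1 = int ?m" using ti[of 0] input_state_simps(2) by simp_all
    define t1 where "t1 = run (Assign 10 (scalar 25) (Get 2 (scalar 25)) ;;
        Assign 11 (scalar 25) (Get 5 (scalar 25)) ;;
        Assign 10 (Add (scalar 25) edge_count) (Get 5 (scalar 25)) ;;
        Assign 11 (Add (scalar 25) edge_count) (Get 2 (scalar 25))) t"
    define t2 where "t2 = run other_denoms_prog t1"
    have f2: "t2 y = t1 y" if "y \<notin> {26, 30}" for y
      unfolding t2_def using that by (intro run_frame) (simp add: writes_other_denoms_prog)
    have t1i: "t1 y = ?s y" if "y < 8" for y
      unfolding t1_def using ti[OF that] that by simp
    have t2i: "t2 y = ?s y" if "y < 8" for y using f2[of y] t1i[OF that] that by simp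
    have t125: "t1 25 0 = int i" using 5(2) by (simp add: t1_def)
    have t225: "t2 25 0 = int i" using f2[of 25] t125 by simp
    have P: "t2 30 0 = (\<Prod>j\<in>{..<?m} - {i}. denoms I j)"
      unfolding t2_def using run_other_denoms_prog[of t1 ?m i] t125 t1i[of 0] t1i[of 4] t1i[of 7]
      by (auto simp: input_state_simps denoms_def intro!: prod.cong)
    have a10: "t2 10 = (t 10)(int i := int (end1 (edges I ! i)), int i + int ?m := int (end2 (edges I ! i)))"
      "t2 11 = (t 11)(int i := int (end2 (edges I ! i)), int i + int ?m := int (end1 (edges I ! i)))"
      "t2 12 = t 12" "t2 13 = t 13"
      using f2[of 10] f2[of 11] f2[of 12] f2[of 13] 5(1,2) ti[of 2] ti[of 5] t0
      by (simp_all add: t1_def input_state_simps)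
    have split: "run ?B t = run (Assign 12 (scalar 25) (Mul (Mul (scalar 30) (Get 3 (scalar 25))) (Get 7 (scalar 25))) ;;
        Assign 13 (scalar 25) (Mul (Mul (scalar 30) (Get 6 (scalar 25))) (Get 4 (scalar 25))) ;;
        Assign 12 (Add (scalar 25) edge_count) (Get 13 (scalar 25)) ;;
        Assign 13 (Add (scalar 25) edge_count) (Get 12 (scalar 25))) t2" (is "_ = ?t3")
      by (simp only: run.simps t1_def t2_def)
    have t3: "?t3 10 = t2 10" "?t3 11 = t2 11"
      "?t3 12 = (t 12)(int i := scaled1 I i, int i + int ?m := scaled2 I i)"
      "?t3 13 = (t 13)(int i := scaled2 I i, int i + int ?m := scaled1 I i)"
      using 5(1) t2i[of 0] t2i[of 3] t2i[of 4] t2i[of 6] t2i[of 7] input_state_simps(2)[of I]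
      by (auto simp: t225 P a10 input_state_simps scaled1_def scaled2_def)
    show ?case
    proof (intro allI impI)
      fix k assume k: "k < Suc i"
      \<comment> \<open>Since \<open>i\<close> is below the number of edges, the two cells written
        for edge \<open>i\<close> lie in different halves, and earlier edges are not
        disturbed.\<close>
      have ne: "int k \<noteq> int i + int ?m" "int k + int ?m \<noteq> int i" using k 5(1) by linarith+
      show "good (run ?B t) k"
      proof (cases "k = i")
        case True
        then show ?thesis unfolding split good_def t3 a10 using ne 5(1) by simp
      next
        case False
        then have "good t k" using 5(4) k by simp
        then show ?thesis unfolding split good_def t3 a10 using ne False by simp
      qed
    qed
  qed (auto simp: s1 input_state_simps writes_other_denoms_prog good_def)
  then have good: "good t k" if "k < ?m" for k using that by blast
  show "t 14 0 = common_denom I"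
    unfolding t using D by (simp add: run_frame writes_other_denoms_prog)
  show "t 10 (int k) = int (arc_centre I k) \<and> t 11 (int k) = int (arc_leaf I k) \<and>
      t 12 (int k) = arc_tc I k \<and> t 13 (int k) = arc_tl I k" if "k < arcs I"
  proof (cases "k < ?m")
    case True
    then show ?thesis using good[OF True]
      by (simp add: good_def arc_centre_def arc_leaf_def arc_tc_def arc_tl_def arc_edge_def)
  next
    case False
    then have "k - ?m < ?m" "int (k - ?m) + int ?m = int k" using that by auto
    then show ?thesis using good[of "k - ?m"] False
      by (simp add: good_def arc_centre_def arc_leaf_def arc_tc_def arc_tl_def arc_edge_def)
  qed
qed

section \<open>Running time and approximation ratios\<close>

lemma abs_le_two_power_blen: "\<bar>x\<bar> \<le> 2 ^ blen x"
proof (cases "x = 0")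
  case False
  then have "nat \<bar>x\<bar> < 2 ^ floorlog 2 (nat \<bar>x\<bar>)" using floorlog_bounds[of "nat \<bar>x\<bar>" 2] by simp
  also have "\<dots> \<le> 2 ^ blen x" by (simp add: blen_def)
  finally have "int (nat \<bar>x\<bar>) \<le> int (2 ^ blen x)" by linarith
  then show ?thesis by simp
qed simp

lemma blen_le_input_size:
  assumes "xs \<in> set (input_arrays I)" "k \<in> set xs"
  shows "blen k \<le> input_size I"
proof -
  have "blen k \<le> (\<Sum>k\<leftarrow>xs. blen k)" using assms(2) by (intro member_le_sum_list) auto
  also have "\<dots> \<le> input_size I" unfolding input_size_def using assms(1) by (intro member_le_sum_list) auto
  finally show ?thesis .
qed

lemma length_le_input_size:
  assumes "xs \<in> set (input_arrays I)"
  shows "length xs \<le> input_size I"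
proof -
  have "length xs = (\<Sum>k\<leftarrow>xs. 1)" by (induction xs) auto
  also have "\<dots> \<le> (\<Sum>k\<leftarrow>xs. blen k)" by (intro sum_list_mono) (simp add: blen_def)
  also have "\<dots> \<le> input_size I" unfolding input_size_def using assms by (intro member_le_sum_list) auto
  finally show ?thesis .
qed

lemma abs_input_state_le: "\<bar>input_state I x i\<bar> \<le> 2 ^ input_size I"
proof (cases "x < length (input_arrays I) \<and> 0 \<le> i \<and> i < int (length (input_arrays I ! x))")
  case True
  then have "input_state I x i \<in> set (input_arrays I ! x)"
    by (auto simp: input_state_def array_of_list_def intro!: nth_mem)
  then have "blen (input_state I x i) \<le> input_size I" using True by (intro blen_le_input_size) auto
  then have "(2::int) ^ blen (input_state I x i) \<le> 2 ^ input_size I" by (rule power_increasing) simp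
  then show ?thesis using abs_le_two_power_blen[of "input_state I x i"] by linarith
qed (auto simp: input_state_def array_of_list_def)

text \<open>The polynomial is fixed before the instance; the input size serves at once as bound on
  the bits of every cell and on the numbers of nodes and edges.\<close>

theorem exec_run:
  assumes "well_formed P"
  obtains p :: "nat poly" where
    "\<And>I. \<exists>n. exec (compile P) (input_state I) n (run P (input_state I)) \<and> n \<le> poly p (input_size I)"
proof -
  define K where "K = prog_size P"
  \<comment> \<open>The factor 2 comes from \<open>arc_count\<close>, the largest admissible loop
    bound.\<close>
  define T where "T = pcompose (steps P) [:0, 2:]"
  \<comment> \<open>The cost bound of \<open>bounded_run\<close>, written as a polynomial in the
    input size \<open>N\<close>, with \<open>\<beta> = N\<close> and
    \<open>g = K * (N + 1)\<close>.\<close>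
  define p where "p = T * ([:K:] * ([:K:] * ([:0, 1:] + T * ([:K:] * ([:0, 1:] + 1)) + 1) + 2))"
  have "\<exists>n. exec (compile P) (input_state I) n (run P (input_state I)) \<and> n \<le> poly p (input_size I)" for I
  proof -
    let ?N = "input_size I"
    have "num_nodes I \<le> ?N"
      using length_le_input_size[of "map (\<lambda>v. if v \<in> terminals I then 1 else 0) [0..<num_nodes I]" I]
      by (simp add: input_arrays_def)
    moreover have "length (edges I) \<le> ?N"
      using length_le_input_size[of "map (\<lambda>e. int (end1 e)) (edges I)" I] by (simp add: input_arrays_def)
    ultimately have "bounded_run K (K * (?N + 1)) ?N (poly (steps P) (2 * ?N)) (compile P)
        (input_state I) (run P (input_state I))"
      using assms abs_input_state_le input_state_simps(1)[of I] input_state_simps(2)[of I]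
      by (intro bounded_run_run[where \<mu> = ?N and ?s0.0 = "input_state I"])
        (auto simp: K_def input_bound_def)
    moreover have T: "poly T ?N = poly (steps P) (2 * ?N)"
      by (simp add: T_def poly_pcompose mult.commute)
    moreover have "poly p ?N = poly T ?N * (K * (K * (?N + poly T ?N * (K * (?N + 1)) + 1) + 2))"
      by (simp add: p_def algebra_simps)
    ultimately show ?thesis unfolding bounded_run_def by auto
  qed
  then show ?thesis using that by blast
qed

locale solvable_instance =
  fixes I :: aec
  assumes inst: "aec_instance I" and solv: "solvable I"

sublocale solvable_instance \<subseteq> arc_system "num_nodes I" "arcs I" "arc_centre I" "arc_leaf I"
    "arc_tc I" "arc_tl I" "terminals I"
  using inst solv by (rule arc_system_of_instance)

section \<open>Back from scaled arcs to the instance\<close>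

context solvable_instance
begin

abbreviation D :: real where "D \<equiv> real_of_int (common_denom I)"

lemma D_pos: "0 < D"
  using common_denom_pos[of I] by simp

lemma incident_eq: "incident I u = arc_edge I ` {k. k < arcs I \<and> arc_leaf I k = u}"
proof
  show "incident I u \<subseteq> arc_edge I ` {k. k < arcs I \<and> arc_leaf I k = u}"
    using arc_exists[of _ I u] unfolding incident_def by blast
  show "arc_edge I ` {k. k < arcs I \<and> arc_leaf I k = u} \<subseteq> incident I u"
    using arc_props(1,2)[OF inst] by (auto simp: incident_def)
qed

lemma thr_eq:
  assumes "k < arcs I"
  shows "thr (arc_edge I k) (arc_centre I k) = arc_tc I k / D"
    "thr (arc_edge I k) (arc_leaf I k) = arc_tl I k / D"
  using arc_props(6,7)[OF inst assms] D_pos by (simp_all add: field_simps)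

lemma scaled_Min:
  assumes "u \<in> terminals I"
  shows "Min ((\<lambda>k. real_of_int (f k) / D) ` {k. k < arcs I \<and> arc_leaf I k = u}) =
    real_of_int (Min (f ` {k. k < arcs I \<and> arc_leaf I k = u})) / D"
proof -
  let ?A = "{k. k < arcs I \<and> arc_leaf I k = u}"
  have "mono (\<lambda>x. real_of_int x / D)" using D_pos by (intro monoI divide_right_mono) auto
  moreover have "f ` ?A \<noteq> {}" using terminal_arc[OF assms] by auto
  ultimately have "real_of_int (Min (f ` ?A)) / D = Min ((\<lambda>x. real_of_int x / D) ` f ` ?A)"
    by (intro mono_Min_commute) auto
  then show ?thesis unfolding image_image by (rule sym)
qed

lemma q_assignment_eq: "q_assignment I u = q u / D"
proof (cases "u \<in> terminals I")
  case True
  have "(\<lambda>e. thr e u) ` incident I u = (\<lambda>k. arc_tl I k / D) ` {k. k < arcs I \<and> arc_leaf I k = u}"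
    unfolding incident_eq image_image using thr_eq by (intro image_cong) auto
  then show ?thesis using True scaled_Min[OF True] by (simp add: q_assignment_def q_def)
qed (simp add: q_assignment_def q_def)

lemma c_assignment_eq: "c_assignment I u = c u / D"
proof (cases "u \<in> terminals I")
  case True
  have "thr e (end1 e) + thr e (end2 e) = real_of_int (arc_tl I k + arc_tc I k) / D"
    if "k < arcs I" "e = arc_edge I k" for e k
    using arc_props(2,3)[OF inst that(1)] thr_eq[OF that(1)] that(2)
    by (auto simp: ends_def doubleton_eq_iff add_divide_distrib)
  then have "(\<lambda>e. thr e (end1 e) + thr e (end2 e)) ` incident I u =
      (\<lambda>k. real_of_int (arc_tl I k + arc_tc I k) / D) ` {k. k < arcs I \<and> arc_leaf I k = u}"
    unfolding incident_eq image_image by (intro image_cong) auto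
  then show ?thesis
    using True scaled_Min[OF True, of "\<lambda>k. arc_tl I k + arc_tc I k"]
    by (simp add: c_assignment_def c_def q_assignment_eq diff_divide_distrib)
qed (simp add: c_assignment_def c_def)

lemma cover_of_feasible:
  assumes "feasible I a"
  shows "cover (\<lambda>u. D * a u)"
  unfolding cover_def
proof (intro conjI allI impI ballI)
  show "0 \<le> D * a u" if "u < num_nodes I" for u
    using assms that D_pos by (simp add: feasible_def nodes_def)
  fix u assume "u \<in> terminals I"
  then obtain e where e: "e \<in> set (edges I)" "u \<in> ends e" "\<forall>v\<in>ends e. thr e v \<le> a v"
    using assms by (auto simp: feasible_def activated_def)
  then obtain k where k: "k < arcs I" "arc_edge I k = e" "arc_leaf I k = u" using arc_exists by blast
  then have "thr e u \<le> a u" "thr e (arc_centre I k) \<le> a (arc_centre I k)"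
    using e arc_props(2)[OF inst k(1)] by auto
  then have "D * thr e u \<le> D * a u" "D * thr e (arc_centre I k) \<le> D * a (arc_centre I k)"
    using D_pos by simp_all
  then show "\<exists>k<arcs I. arc_leaf I k = u \<and> arc_tl I k \<le> D * a u \<and> arc_tc I k \<le> D * a (arc_centre I k)"
    using arc_props(6,7)[OF inst k(1)] k by (intro exI[of _ k]) auto
qed

abbreviation final :: state where "final \<equiv> run greedy_prog (input_state I)"

text \<open>All thresholds were multiplied by \<open>D\<close>, so one denominator serves every
  node, and the integer bound is divided by \<open>D\<close> once.\<close>

lemma run_greedy_prog:
  shows final_denom: "u < num_nodes I \<Longrightarrow> final 9 (int u) = common_denom I"
    and final_feasible: "feasible I (output_assignment final)"
    and final_value: "feasible I a \<Longrightarrow> assignment_value I (output_assignment final) \<le>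
      ((\<Sum>u<num_nodes I. real_of_int (q u)) + potential (\<Sum>u<num_nodes I. D * a u - real_of_int (q u))
        (\<Sum>u<num_nodes I. real_of_int (c u))) / D"
proof -
  define s1 where "s1 = run scale_prog (input_state I)"
  define s2 where "s2 = run init_prog s1"
  have fin: "final = run (For 29 node_count round_prog) s2"
    by (simp add: greedy_prog_def s1_def s2_def)
  have wf: "well_formed scale_prog" "well_formed init_prog"
    using well_formed_greedy_prog by (simp_all add: greedy_prog_def)
  have in1: "s1 x = input_state I x" if "x < 8" for x
    unfolding s1_def using wf(1) that by (rule run_input)
  have l1: "loaded s1"
    unfolding loaded_def using in1[of 0] input_state_simps(1,2)[of I] run_scale_prog(2)[of _ I]
    by (simp flip: s1_def)
  have l2: "loaded s2"
    by (rule loaded_cong[OF l1]) (simp_all add: s2_def run_frame writes_init_prog)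
  have init: "\<forall>u<num_nodes I. s2 8 (int u) = q u \<and> s2 15 (int u) = c u \<and> s2 9 (int u) = s1 14 0"
    unfolding s2_def using in1[of 1] input_state_simps(3)[of _ I] by (intro run_init_prog[OF l1]) simp
  have f9: "final 9 = s2 9" unfolding fin by (rule run_frame) (simp add: writes_round_prog)
  show d: "final 9 (int u) = common_denom I" if "u < num_nodes I" for u
    unfolding f9 using init that run_scale_prog(1)[of I] by (simp add: s1_def)
  have "\<forall>u<num_nodes I. s2 8 (int u) = q u \<and> s2 15 (int u) = c u" using init by blast
  note rounds = run_rounds[OF l2 this, folded fin]
  have out: "output_assignment final u = final 8 (int u) / D" if "u < num_nodes I" for u
    using d[OF that] by (simp add: output_assignment_def)
  show "feasible I (output_assignment final)"
    unfolding feasible_def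
  proof (intro conjI ballI)
    fix u assume "u \<in> nodes I"
    then have u: "u < num_nodes I" by (simp add: nodes_def)
    have "0 \<le> final 8 (int u)" using rounds(2)[OF u] q_nonneg[of u] by linarith
    then show "0 \<le> output_assignment final u" using out[OF u] D_pos by simp
  next
    fix u assume u: "u \<in> terminals I"
    obtain k where k: "k < arcs I" "arc_leaf I k = u" "arc_tl I k \<le> final 8 (int u)"
      "arc_tc I k \<le> final 8 (int (arc_centre I k))" using rounds(1)[OF u] by blast
    note p = arc_props[OF inst k(1)]
    have "thr (arc_edge I k) v \<le> output_assignment final v" if "v \<in> ends (arc_edge I k)" for v
    proof -
      have "thr (arc_edge I k) (arc_centre I k) \<le> output_assignment final (arc_centre I k)"
        unfolding out[OF p(4)] thr_eq(1)[OF k(1)] using k(4) D_pos by (intro divide_right_mono) auto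
      moreover have "thr (arc_edge I k) (arc_leaf I k) \<le> output_assignment final (arc_leaf I k)"
        unfolding out[OF p(5)] thr_eq(2)[OF k(1)] using k(2,3) D_pos by (intro divide_right_mono) auto
      moreover have "v = arc_centre I k \<or> v = arc_leaf I k" using that unfolding p(2) by blast
      ultimately show ?thesis by blast
    qed
    then show "\<exists>e\<in>activated I (output_assignment final). u \<in> ends e"
      using p(1,2) k(2) by (intro bexI[of _ "arc_edge I k"]) (auto simp: activated_def)
  qed
  assume "feasible I a"
  have "assignment_value I (output_assignment final) = (\<Sum>u<num_nodes I. real_of_int (final 8 (int u))) / D"
    unfolding assignment_value_def nodes_def sum_divide_distrib using out by (intro sum.cong) auto
  also have "\<dots> \<le> ((\<Sum>u<num_nodes I. real_of_int (q u)) + potential (\<Sum>u<num_nodes I. D * a u - real_of_int (q u))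
        (\<Sum>u<num_nodes I. real_of_int (c u))) / D"
    using D_pos by (intro divide_right_mono rounds(3) cover_of_feasible \<open>feasible I a\<close>) simp
  finally show "assignment_value I (output_assignment final) \<le>
      ((\<Sum>u<num_nodes I. real_of_int (q u)) + potential (\<Sum>u<num_nodes I. D * a u - real_of_int (q u))
        (\<Sum>u<num_nodes I. real_of_int (c u))) / D" .
qed

text \<open>\<open>opt\<close> is an infimum, so the bound is proved against every feasible
  assignment \<open>a\<close>; \<open>q(V) + \<tau>\<close> is then just \<open>D\<close> times the
  value of \<open>a\<close>.\<close>

lemma greedy_achieves_ratio:
  assumes \<rho>: "0 < \<rho>"
    and bound: "\<And>z. cover z \<Longrightarrow>
      (\<Sum>u<num_nodes I. real_of_int (q u)) + potential (\<Sum>u<num_nodes I. z u - real_of_int (q u))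
        (\<Sum>u<num_nodes I. real_of_int (c u)) \<le>
      \<rho> * ((\<Sum>u<num_nodes I. real_of_int (q u)) + (\<Sum>u<num_nodes I. z u - real_of_int (q u)))"
  shows "achieves_ratio (compile greedy_prog) I \<rho>"
proof -
  let ?v = "assignment_value I (output_assignment final)"
  have le: "?v \<le> \<rho> * assignment_value I a" if a: "feasible I a" for a
  proof -
    have "?v \<le> \<rho> * ((\<Sum>u<num_nodes I. real_of_int (q u)) + (\<Sum>u<num_nodes I. D * a u - real_of_int (q u))) / D"
      using final_value[OF a] divide_right_mono[OF bound[OF cover_of_feasible[OF a]], of D] D_pos
      by linarith
    also have "\<dots> = \<rho> * assignment_value I a"
      using D_pos by (simp add: sum_subtractf assignment_value_def nodes_def flip: sum_distrib_left)
    finally show ?thesis .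
  qed
  have "?v / \<rho> \<le> opt I"
    unfolding opt_def
  proof (rule cInf_greatest)
    show "{assignment_value I a |a. feasible I a} \<noteq> {}" using solv by (auto simp: solvable_def)
    show "?v / \<rho> \<le> x" if "x \<in> {assignment_value I a |a. feasible I a}" for x
      using that le \<rho> by (auto simp: field_simps)
  qed
  then have "?v \<le> \<rho> * opt I" using \<rho> by (simp add: field_simps)
  moreover obtain n where "exec (compile greedy_prog) (input_state I) n final"
    using exec_run[OF well_formed_greedy_prog] by blast
  ultimately show ?thesis
    using final_feasible unfolding achieves_ratio_def by blast
qed

lemma cover_sums_nonneg:
  assumes "cover z"
  shows "0 \<le> (\<Sum>u<num_nodes I. real_of_int (q u))" "0 \<le> (\<Sum>u<num_nodes I. z u - real_of_int (q u))"
  using q_nonneg cover_ge_q[OF assms] by (auto intro!: sum_nonneg)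

lemma ratio_omega:
  assumes "0 \<le> \<theta>" "bounded_instance \<theta> I"
  shows "achieves_ratio (compile greedy_prog) I (1 + omega \<theta>)"
proof (rule greedy_achieves_ratio)
  show "0 < 1 + omega \<theta>" using omega_pos[of \<theta>] omega_zero assms(1) by (cases "\<theta> = 0") auto
  have "real_of_int (c u) \<le> \<theta> * real_of_int (q u)" for u
  proof (cases "u \<in> terminals I")
    case True
    then have "c u / D \<le> \<theta> * (q u / D)"
      using assms(2) by (simp add: bounded_instance_def flip: q_assignment_eq c_assignment_eq)
    then show ?thesis using D_pos by (simp add: field_simps)
  qed (simp add: c_def q_def)
  then have "(\<Sum>u<num_nodes I. real_of_int (c u)) \<le> \<theta> * (\<Sum>u<num_nodes I. real_of_int (q u))"
    unfolding sum_distrib_left by (intro sum_mono)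
  then show "(\<Sum>u<num_nodes I. real_of_int (q u)) + potential (\<Sum>u<num_nodes I. z u - real_of_int (q u))
      (\<Sum>u<num_nodes I. real_of_int (c u)) \<le> (1 + omega \<theta>) *
      ((\<Sum>u<num_nodes I. real_of_int (q u)) + (\<Sum>u<num_nodes I. z u - real_of_int (q u)))"
    if "cover z" for z
    using potential_le_omega[OF assms(1) cover_sums_nonneg[OF that]] by blast
qed

text \<open>\<Delta> counts neighbours and not edges; the image under \<open>arc_leaf\<close> merges
  parallel edges.\<close>

lemma card_leaves_le:
  assumes "v < num_nodes I"
  shows "card (arc_leaf I ` {k. k < arcs I \<and> arc_centre I k = v \<and> arc_leaf I k \<in> terminals I})
    \<le> max_terminal_neighbors I"
proof -
  have fin: "finite (terminal_neighbors I v)"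
    using R_subset by (auto intro: finite_subset simp: terminal_neighbors_def)
  have "arc_leaf I ` {k. k < arcs I \<and> arc_centre I k = v \<and> arc_leaf I k \<in> terminals I}
      \<subseteq> terminal_neighbors I v"
  proof
    fix u assume "u \<in> arc_leaf I ` {k. k < arcs I \<and> arc_centre I k = v \<and> arc_leaf I k \<in> terminals I}"
    then obtain k where k: "k < arcs I" "arc_centre I k = v" "arc_leaf I k = u" "u \<in> terminals I" by blast
    then have "ends (arc_edge I k) = {u, v}" using arc_props(2)[OF inst k(1)] by auto
    then show "u \<in> terminal_neighbors I v"
      using arc_props(1)[OF inst k(1)] k(4) by (auto simp: terminal_neighbors_def)
  qed
  then have "card (arc_leaf I ` {k. k < arcs I \<and> arc_centre I k = v \<and> arc_leaf I k \<in> terminals I})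
      \<le> card (terminal_neighbors I v)"
    using fin by (rule card_mono[rotated])
  also have "\<dots> \<le> max_terminal_neighbors I"
    unfolding max_terminal_neighbors_def using assms by (intro Max_ge) (auto simp: nodes_def)
  finally show ?thesis .
qed

lemma ratio_ln_succ:
  "achieves_ratio (compile greedy_prog) I (1 + ln (real (max_terminal_neighbors I) + 1))"
proof (rule greedy_achieves_ratio)
  show "0 < 1 + ln (real (max_terminal_neighbors I) + 1)" by (simp add: add_pos_nonneg)
qed (intro potential_le_ln_succ sum_c_le(1) cover_sums_nonneg card_leaves_le, simp_all)

lemma ratio_ln:
  assumes "independent_terminals I"
  shows "achieves_ratio (compile greedy_prog) I (1 + ln (real (max_terminal_neighbors I)))"
proof (rule greedy_achieves_ratio)
  let ?\<Delta> = "max_terminal_neighbors I"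
  show "0 < 1 + ln (real ?\<Delta>)" by (cases "?\<Delta> = 0") (auto simp: add_pos_nonneg)
  fix z assume z: "cover z"
  let ?\<tau> = "\<Sum>u<num_nodes I. z u - real_of_int (q u)"
  have "arc_leaf I k \<notin> terminals I" if "k < arcs I" "arc_centre I k \<in> terminals I" for k
    using that assms arc_props(1,2)[OF inst that(1)] by (auto simp: independent_terminals_def)
  then have c: "(\<Sum>u<num_nodes I. real_of_int (c u)) \<le> real ?\<Delta> * ?\<tau>"
    using card_leaves_le by (intro sum_c_le(2)[OF z]) auto
  show "(\<Sum>u<num_nodes I. real_of_int (q u)) + potential ?\<tau> (\<Sum>u<num_nodes I. real_of_int (c u)) \<le>
      (1 + ln (real ?\<Delta>)) * ((\<Sum>u<num_nodes I. real_of_int (q u)) + ?\<tau>)"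
  \<comment> \<open>Here \<open>ln 0 = 0\<close>, so the claimed ratio is 1. It holds because then
    the total price is at most 0, which puts \<open>potential\<close> into its first branch with a
    value of at most 0.\<close>
  proof (cases "?\<Delta> = 0")
    case True
    then show ?thesis using c cover_sums_nonneg[OF z] by (simp add: potential_def)
  next
    case False
    then show ?thesis using c cover_sums_nonneg[OF z] by (intro potential_le_ln) auto
  qed
qed

end

theorem theorem1:
  "(\<exists>P. poly_time_algorithm P \<and>
      (\<forall>\<theta>\<ge>0. \<forall>I. aec_instance I \<and> solvable I \<and> bounded_instance \<theta> I \<longrightarrow>
         achieves_ratio P I (1 + omega \<theta>))) \<and>
   (\<exists>P. poly_time_algorithm P \<and>
      (\<forall>I. aec_instance I \<and> solvable I \<longrightarrow>
         achieves_ratio P I (1 + ln (real (max_terminal_neighbors I) + 1)))) \<and>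
   (\<exists>P. poly_time_algorithm P \<and>
      (\<forall>I. aec_instance I \<and> solvable I \<and> independent_terminals I \<longrightarrow>
         achieves_ratio P I (1 + ln (real (max_terminal_neighbors I)))))"
proof -
  have loc: "solvable_instance I" if "aec_instance I" "solvable I" for I
    using that by (rule solvable_instance.intro)
  obtain p :: "nat poly" where p: "\<And>I. \<exists>n. exec (compile greedy_prog) (input_state I) n
      (run greedy_prog (input_state I)) \<and> n \<le> poly p (input_size I)"
    using exec_run[OF well_formed_greedy_prog] by blast
  have "0 < run greedy_prog (input_state I) 9 (int v)" if "aec_instance I" "solvable I" "v \<in> nodes I" for I v
    using solvable_instance.final_denom[OF loc[OF that(1,2)], of v] that(3) common_denom_pos
    by (simp add: nodes_def)
  then have "poly_time_algorithm (compile greedy_prog)"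
    unfolding poly_time_algorithm_def using p solvable_instance.final_feasible[OF loc] by meson
  then show ?thesis
    using solvable_instance.ratio_omega[OF loc] solvable_instance.ratio_ln_succ[OF loc]
      solvable_instance.ratio_ln[OF loc] by blast
qed

end
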